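(* The stationary probability distribution $\pi^{\mathrm i}$ of the stoned inhomogeneous TASEP $\blacktriangle\mathrm{iTASEP}_\lambda$ is given by \[\pi^{\mathrm i}(\mu,\sigma)=\frac1{|\Omega|}\lim_{R\to\infty}\frac{\Psi_\mu(\sigma\boldsymbol\chi)}{\Pi_\lambda(\boldsymbol\chi)}\qquad((\mu,\sigma)\in S_\lambda\times\Omega).\]
   Context: Fix parameters $a_k\in(0,1)$ for each integer $k\ge0$, and a nondecreasing tuple $\lambda=(\lambda_1\le\cdots\le\lambda_n)$ of nonnegative integers with set of rearrangements $S_\lambda$. For $w\in\mathfrak S_n$ and a tuple $y$, $wy=(y_{w^{-1}(1)},\dots,y_{w^{-1}(n)})$; for a polynomial $f$, $(wf)(\mathbf x)=f(w\mathbf x)$. Indices are modulo $n$; $\overline s_i$ ($i\in\mathbb Z/n\mathbb Z$) is the transposition of $i$ and $i+1$; $c$ is the cycle $(1\,2\cdots n)$. Inhomogeneous TASEP polynomials (Cantini) $(\Psi_\mu(\mathbf x))_{\mu\in S_\lambda}$ are polynomials in $x_1,\dots,x_n$ with coefficients rational in $a_{\lambda_1},\dots,a_{\lambda_n}$, determined up to a common scalar factor (a normalization is fixed) by: $\frac{x_i(x_{i+1}-a_{\mu_{i+1}})}{a_{\mu_{i+1}}(x_i-x_{i+1})}(1-\overline s_i)\Psi_\mu=\Psi_{\overline s_i\mu}$ if $\mu_i<\mu_{i+1}$; $\overline s_i\Psi_\mu=\Psi_\mu$ if $\mu_i=\mu_{i+1}$; $c\Psi_{c\mu}=\Psi_\mu$.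 $\Pi_\lambda=\sum_{\mu\in S_\lambda}\Psi_\mu$ (a symmetric polynomial). Stones $\blacktriangle_1,\dots,\blacktriangle_n$ with densities $\varrho$ taking exactly the two values $1,2$, $1=\varrho(\blacktriangle_1)\le\cdots\le\varrho(\blacktriangle_n)=2$. $\Omega$: the $\sigma\in\mathfrak S_n$ such that for each density the stones of that density appear in the same cyclic order in $\blacktriangle_{\sigma^{-1}(1)},\dots,\blacktriangle_{\sigma^{-1}(n)}$ as in $\blacktriangle_1,\dots,\blacktriangle_n$ (stone $\blacktriangle_j$ sits on site $\sigma(j)$ of a ring $\mathbb Z/n\mathbb Z$). $\mathfrak K(\sigma)=\#\{i:\varrho(\blacktriangle_{\sigma^{-1}(i)})<\varrho(\blacktriangle_{\sigma^{-1}(i+1)})\}$. For each $j$ with $\varrho(\blacktriangle_j)=1$ fix $p(j)\in[0,1)$, with $p(j)>0$ for at least one such $j$. For real $R>1$ let $\boldsymbol\chi=(\chi_1,\dots,\chi_n)$ with $\chi_j=1/p(j)$ if $\varrho(\blacktriangle_j)=1$ and $p(j)>0$, and $\chi_j=R$ otherwise. $\blacktriangle\mathrm{iTASEP}_\lambda$ is the Markov chain on $S_\lambda\times\Omega$: if $\varrho(\blacktriangle_{\sigma^{-1}(i)})<\varrho(\blacktriangle_{\sigma^{-1}(i+1)})$ and $\mu_i>\mu_{i+1}$, then $\mathbb P((\mu,\sigma)\to(\overline s_i\mu,\overline s_i\sigma))=\frac1np(\sigma^{-1}(i))a_{\mu_i}$ and $\mathbb P((\mu,\sigma)\to(\mu,\overline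 s_i\sigma))=\frac1n[1-p(\sigma^{-1}(i))a_{\mu_i}]$; if the density condition holds and $\mu_i\le\mu_{i+1}$, $\mathbb P((\mu,\sigma)\to(\mu,\overline s_i\sigma))=\frac1n$; $\mathbb P((\mu,\sigma)\to(\mu,\sigma))=1-\mathfrak K(\sigma)/n$; all other probabilities $0$. This chain is irreducible. (Its stone marginal, the auxiliary TASEP, is uniform on $\Omega$.)
   Formalization: The chain is not irreducible when the numbers of stones of the two densities share a factor, so the formal claim is that the formula gives a stationary distribution; the Ψ_μ are taken as a nonzero polynomial solution of minimal degree, as the relations alone fix them only up to a symmetric factor. *)

theory Defs
  imports Complex_Main "HOL-Library.Multiset" "HOL-Combinatorics.Permutations"
begin

(* Conventions: sites and stones are indexed 0..n-1 (0-based); site indices mod n.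
   Tuples mu are lists of length n; variable vectors x are functions nat => real
   (only x 0 .. x (n-1) matter). *)

definition nxt :: "nat \<Rightarrow> nat \<Rightarrow> nat" where
  "nxt n i = (i + 1) mod n"

definition swp :: "nat \<Rightarrow> nat \<Rightarrow> nat \<Rightarrow> nat" where
  "swp n i j = (if j = i then nxt n i else if j = nxt n i then i else j)"

definition cyc_inv :: "nat \<Rightarrow> nat \<Rightarrow> nat" where
  "cyc_inv n j = (if j < n then (j + n - 1) mod n else j)"

(* w mu = (mu_{w^{-1}(1)}, ..., mu_{w^{-1}(n)}) for w = s_i and w = c *)
definition swap_list :: "nat \<Rightarrow> nat \<Rightarrow> nat list \<Rightarrow> nat list" where
  "swap_list n i mu = map (\<lambda>j. mu ! swp n i j) [0..<n]"

definition cyc_list :: "nat \<Rightarrow> nat list \<Rightarrow> nat list" where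
  "cyc_list n mu = map (\<lambda>j. mu ! cyc_inv n j) [0..<n]"

definition rearr :: "nat list \<Rightarrow> nat list set" where
  "rearr lam = {mu. mset mu = mset lam}"

definition poly_deg_le :: "nat \<Rightarrow> nat \<Rightarrow> ((nat \<Rightarrow> real) \<Rightarrow> real) \<Rightarrow> bool" where
  "poly_deg_le n d f \<longleftrightarrow>
     (\<exists>c :: (nat \<Rightarrow> nat) \<Rightarrow> real.
        finite {\<alpha>. c \<alpha> \<noteq> 0} \<and>
        (\<forall>\<alpha>. c \<alpha> \<noteq> 0 \<longrightarrow> (\<forall>i\<ge>n. \<alpha> i = 0) \<and> (\<Sum>i<n. \<alpha> i) \<le> d) \<and>
        (\<forall>x. f x = (\<Sum>\<alpha>\<in>{\<alpha>. c \<alpha> \<noteq> 0}. c \<alpha> * (\<Prod>i<n. x i ^ \<alpha> i))))"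

(* Cantini's exchange relations (the first one multiplied out by the denominator) *)
definition tasep_rel :: "nat \<Rightarrow> (nat \<Rightarrow> real) \<Rightarrow> nat list \<Rightarrow> (nat list \<Rightarrow> (nat \<Rightarrow> real) \<Rightarrow> real) \<Rightarrow> bool" where
  "tasep_rel n a lam Psi \<longleftrightarrow>
     (\<forall>mu\<in>rearr lam. \<forall>i<n.
        (mu ! i < mu ! nxt n i \<longrightarrow>
           (\<forall>x. x i * (x (nxt n i) - a (mu ! nxt n i)) * (Psi mu x - Psi mu (x \<circ> swp n i))
                 = a (mu ! nxt n i) * (x i - x (nxt n i)) * Psi (swap_list n i mu) x)) \<and>
        (mu ! i = mu ! nxt n i \<longrightarrow> (\<forall>x. Psi mu (x \<circ> swp n i) = Psi mu x))) \<and>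
     (\<forall>mu\<in>rearr lam. \<forall>x. Psi (cyc_list n mu) (x \<circ> cyc_inv n) = Psi mu x)"

(* A family of inhomogeneous TASEP polynomials: a nonzero polynomial solution of the
   relations of minimal total degree (this pins it down up to a common scalar). *)
definition is_tasep_family :: "nat \<Rightarrow> (nat \<Rightarrow> real) \<Rightarrow> nat list \<Rightarrow> (nat list \<Rightarrow> (nat \<Rightarrow> real) \<Rightarrow> real) \<Rightarrow> bool" where
  "is_tasep_family n a lam Psi \<longleftrightarrow>
     tasep_rel n a lam Psi \<and> (\<exists>mu\<in>rearr lam. Psi mu \<noteq> (\<lambda>x. 0)) \<and>
     (\<exists>d. (\<forall>mu\<in>rearr lam. poly_deg_le n d (Psi mu)) \<and>
          (\<forall>Phi d'. tasep_rel n a lam Phi \<and> (\<exists>mu\<in>rearr lam. Phi mu \<noteq> (\<lambda>x. 0)) \<and>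
                    (\<forall>mu\<in>rearr lam. poly_deg_le n d' (Phi mu)) \<longrightarrow> d \<le> d'))"

definition Pi_poly :: "nat list \<Rightarrow> (nat list \<Rightarrow> (nat \<Rightarrow> real) \<Rightarrow> real) \<Rightarrow> (nat \<Rightarrow> real) \<Rightarrow> real" where
  "Pi_poly lam Psi x = (\<Sum>mu\<in>rearr lam. Psi mu x)"

(* Omega: stone j sits on site sigma j; stones of each density keep their cyclic order *)
definition stone_Omega :: "nat \<Rightarrow> (nat \<Rightarrow> nat) \<Rightarrow> (nat \<Rightarrow> nat) set" where
  "stone_Omega n rho = {sigma. sigma permutes {..<n} \<and>
     (\<forall>d. \<exists>k. filter (\<lambda>j. rho j = d) (map (inv sigma) [0..<n])
              = rotate k (filter (\<lambda>j. rho j = d) [0..<n]))}"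

definition Kfun :: "nat \<Rightarrow> (nat \<Rightarrow> nat) \<Rightarrow> (nat \<Rightarrow> nat) \<Rightarrow> nat" where
  "Kfun n rho sigma = card {i. i < n \<and> rho (inv sigma i) < rho (inv sigma (nxt n i))}"

definition itasep_trans :: "nat \<Rightarrow> (nat \<Rightarrow> real) \<Rightarrow> (nat \<Rightarrow> nat) \<Rightarrow> (nat \<Rightarrow> real)
    \<Rightarrow> nat list \<times> (nat \<Rightarrow> nat) \<Rightarrow> nat list \<times> (nat \<Rightarrow> nat) \<Rightarrow> real" where
  "itasep_trans n a rho p s t =
     (case s of (mu, sigma) \<Rightarrow>
       (if t = (mu, sigma) then 1 - real (Kfun n rho sigma) / real n else 0) +
       (\<Sum>i<n. if rho (inv sigma i) < rho (inv sigma (nxt n i)) then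
          (if mu ! nxt n i < mu ! i then
             (if t = (swap_list n i mu, swp n i \<circ> sigma)
                then p (inv sigma i) * a (mu ! i) / real n else 0) +
             (if t = (mu, swp n i \<circ> sigma)
                then (1 - p (inv sigma i) * a (mu ! i)) / real n else 0)
           else (if t = (mu, swp n i \<circ> sigma) then 1 / real n else 0))
        else 0))"

definition is_stationary :: "'s set \<Rightarrow> ('s \<Rightarrow> 's \<Rightarrow> real) \<Rightarrow> ('s \<Rightarrow> real) \<Rightarrow> bool" where
  "is_stationary S P \<pi> \<longleftrightarrow>
     (\<forall>s\<in>S. 0 \<le> \<pi> s) \<and> (\<Sum>s\<in>S. \<pi> s) = 1 \<and> (\<forall>t\<in>S. \<pi> t = (\<Sum>s\<in>S. \<pi> s * P s t))"

definition chi :: "(nat \<Rightarrow> nat) \<Rightarrow> (nat \<Rightarrow> real) \<Rightarrow> real \<Rightarrow> nat \<Rightarrow> real" where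
  "chi rho p R j = (if rho j = 1 \<and> p j > 0 then 1 / p j else R)"

end

theory Submission
  imports Defs "Jordan_Normal_Form.Determinant"
begin

unbundle no m_inv_syntax

text \<open>
  Carrying one variable once around the ring expresses the vector of all \<open>\<Psi>\<^sub>\<mu>(x)\<close> as a
  fixed vector of an explicit matrix. If all variables exceed 1 and the variable carried is the smallest
  one, this matrix is, up to a scalar, stochastic with a single recurrent class. Hence all
  \<open>\<Psi>\<^sub>\<mu>(x)\<close> have the same sign, and by Cramer's rule they are multiples of their
  sum \<open>\<Pi>\<close> in the local ring at \<open>x\<close>. Real polynomials in \<open>n\<close> variables have
  greatest common divisors; the greatest common divisor \<open>G\<close> of all \<open>\<Psi>\<^sub>\<mu> \<circ> w\<close>
  with \<open>w\<close> a permutation is therefore divisible by \<open>\<Pi>\<close> in that local ring. Since \<open>G\<close>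
  is symmetric, dividing by it gives another solution of the exchange relations, so \<open>G\<close> is
  constant by minimality of the degree, and \<open>\<Pi>(x) \<noteq> 0\<close>.

  The ratios \<open>\<Psi>\<^sub>\<mu>(\<sigma>\<chi>) / \<Pi>(\<chi>)\<close> are thus rational functions of \<open>R\<close> with values
  in \<open>[0, 1]\<close>, which converge as \<open>R \<rightarrow> \<infinity>\<close>. In the limit the exchange relations
  become the transition rule across a single edge, and stationarity follows because a cyclic word has as
  many ascents as descents. The stone chain need not be irreducible (for two stones of each density it is
  not), so positivity is not deduced from uniqueness of the stationary distribution.
\<close>

section \<open>The ring of real polynomial functions\<close>

text \<open>Equal signs alone only show that a zero of the sum at an admissible point is a common
  zero of all \<open>Psi mu\<close>, and polynomials without common factor can still have common
  zeros. Cramer's rule closes this gap: since the sum divides every summand locally, its cofactor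
  with respect to the common divisor is a unit at that point. The greatest common divisor is taken
  over all permuted copies so that each swap maps it to a scalar multiple of itself. The scalar is a
  sign, and minus is impossible: the cofactor would then be antisymmetric and vanish on a diagonal,
  although every diagonal contains an admissible point. The carried variable has to be the smallest
  because the coefficient that moves weight between states has the sign of \<open>w - u\<close>,
  with \<open>u\<close> the carried and \<open>w\<close> the passed variable; values above 1 make
  all factors \<open>w - a l\<close> and \<open>u - a l\<close> positive. Other points are reached
  by rotating the ring.\<close>

inductive_set polyfun :: "((nat \<Rightarrow> real) \<Rightarrow> real) set" where
  polyfun_const: "(\<lambda>x. c) \<in> polyfun"
| polyfun_var: "(\<lambda>x. x i) \<in> polyfun"
| polyfun_add: "f \<in> polyfun \<Longrightarrow> g \<in> polyfun \<Longrightarrow> (\<lambda>x. f x + g x) \<in> polyfun"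
| polyfun_mult: "f \<in> polyfun \<Longrightarrow> g \<in> polyfun \<Longrightarrow> (\<lambda>x. f x * g x) \<in> polyfun"

lemma polyfun_sum: "(\<And>i. i \<in> I \<Longrightarrow> f i \<in> polyfun) \<Longrightarrow> (\<lambda>x. \<Sum>i\<in>I. f i x) \<in> polyfun"
  by (induction I rule: infinite_finite_induct) (auto intro: polyfun.intros)

lemma polyfun_prod: "(\<And>i. i \<in> I \<Longrightarrow> f i \<in> polyfun) \<Longrightarrow> (\<lambda>x. \<Prod>i\<in>I. f i x) \<in> polyfun"
  by (induction I rule: infinite_finite_induct) (auto intro: polyfun.intros)

lemma polyfun_power: "f \<in> polyfun \<Longrightarrow> (\<lambda>x. f x ^ k) \<in> polyfun"
  by (induction k) (auto intro: polyfun.intros)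

lemma polyfun_comp:
  assumes "f \<in> polyfun" "\<And>i. (\<lambda>x. g x i) \<in> polyfun"
  shows "(\<lambda>x. f (g x)) \<in> polyfun"
  using assms(1) by (induction rule: polyfun.induct) (auto intro: polyfun.intros assms(2))

typedef mpol = polyfun
  morphisms ev Abs_mpol
  by (auto intro: polyfun_const)

setup_lifting type_definition_mpol

lemma mpol_eqI: "(\<And>x. ev f x = ev g x) \<Longrightarrow> f = g"
  by (metis ev_inject ext)

lemma polyfun_obtain: "f \<in> polyfun \<Longrightarrow> \<exists>p. ev p = f"
  by (metis Abs_mpol_inverse)

text \<open>Restriction to lines reduces questions in many variables to univariate polynomials:
  absence of zero divisors, total degree, and the dependence of the ratios on \<open>R\<close> all
  come from it.\<close>

lemma polyfun_on_line:
  assumes "f \<in> polyfun"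
  shows "\<exists>p::real poly. \<forall>t. poly p t = f (\<lambda>i. x i + t * y i)"
  using assms
proof (induction rule: polyfun.induct)
  case (polyfun_const c)
  then show ?case by (intro exI[of _ "[:c:]"]) auto
next
  case (polyfun_var i)
  then show ?case by (intro exI[of _ "[:x i, y i:]"]) auto
next
  case (polyfun_add f g)
  then show ?case by (metis poly_add)
next
  case (polyfun_mult f g)
  then show ?case by (metis poly_mult)
qed

lemma polyfun_mult_eq_0:
  assumes "f \<in> polyfun" "g \<in> polyfun" "f x \<noteq> 0" "g y \<noteq> 0"
  shows "\<exists>z. f z * g z \<noteq> 0"
proof -
  obtain p where p: "\<And>t. poly p t = f (\<lambda>i. x i + t * (y i - x i))"
    using polyfun_on_line[OF assms(1), of x "\<lambda>i. y i - x i"] by auto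
  obtain q where q: "\<And>t. poly q t = g (\<lambda>i. x i + t * (y i - x i))"
    using polyfun_on_line[OF assms(2), of x "\<lambda>i. y i - x i"] by auto
  have "poly p 0 \<noteq> 0" "poly q 1 \<noteq> 0" using p[of 0] q[of 1] assms by auto
  hence "p * q \<noteq> 0" by auto
  then obtain t where "poly (p * q) t \<noteq> 0" using poly_all_0_iff_0 by blast
  thus ?thesis using p q by (metis poly_mult)
qed

instantiation mpol :: idom
begin

lift_definition zero_mpol :: mpol is "\<lambda>x. 0" by (rule polyfun_const)
lift_definition one_mpol :: mpol is "\<lambda>x. 1" by (rule polyfun_const)
lift_definition plus_mpol :: "mpol \<Rightarrow> mpol \<Rightarrow> mpol" is "\<lambda>f g x. f x + g x" by (rule polyfun_add)
lift_definition times_mpol :: "mpol \<Rightarrow> mpol \<Rightarrow> mpol" is "\<lambda>f g x. f x * g x" by (rule polyfun_mult)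
lift_definition uminus_mpol :: "mpol \<Rightarrow> mpol" is "\<lambda>f x. - f x"
  using polyfun_mult[OF polyfun_const[of "-1"]] by simp
lift_definition minus_mpol :: "mpol \<Rightarrow> mpol \<Rightarrow> mpol" is "\<lambda>f g x. f x - g x"
  using polyfun_add[OF _ polyfun_mult[OF polyfun_const[of "-1"]]] by simp

instance
proof
  fix a b c :: mpol
  show "a \<noteq> 0 \<Longrightarrow> b \<noteq> 0 \<Longrightarrow> a * b \<noteq> 0"
    by transfer (metis polyfun_mult_eq_0)
qed (transfer, simp add: fun_eq_iff algebra_simps)+

end

lemmas ev_simps [simp] =
  zero_mpol.rep_eq one_mpol.rep_eq plus_mpol.rep_eq times_mpol.rep_eq uminus_mpol.rep_eq minus_mpol.rep_eq

lift_definition C :: "real \<Rightarrow> mpol" is "\<lambda>c x. c" by (rule polyfun_const)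
lift_definition X :: "nat \<Rightarrow> mpol" is "\<lambda>i x. x i" by (rule polyfun_var)
lift_definition psub :: "(nat \<Rightarrow> nat) \<Rightarrow> mpol \<Rightarrow> mpol" is "\<lambda>w f x. f (x \<circ> w)"
  unfolding comp_def by (rule polyfun_comp) (auto intro: polyfun_var)

lemmas ev_simps' [simp] = C.rep_eq X.rep_eq psub.rep_eq

lemma ev_hom: "comm_ring_hom (\<lambda>f. ev f x)"
  by unfold_locales auto

lemma ev_sum [simp]: "ev (\<Sum>i\<in>I. f i) x = (\<Sum>i\<in>I. ev (f i) x)"
  by (induction I rule: infinite_finite_induct) auto

lemma ev_prod [simp]: "ev (\<Prod>i\<in>I. f i) x = (\<Prod>i\<in>I. ev (f i) x)"
  by (induction I rule: infinite_finite_induct) auto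

lemma ev_power [simp]: "ev (f ^ k) x = ev f x ^ k"
  by (induction k) auto

lemma mpol_neq_0D: "f \<noteq> 0 \<Longrightarrow> \<exists>x. ev f x \<noteq> 0"
  by (metis mpol_eqI ev_simps(1))

lemma mpol_induct [case_names const var add mult]:
  assumes "\<And>c. P (C c)" "\<And>i. P (X i)" "\<And>f g. P f \<Longrightarrow> P g \<Longrightarrow> P (f + g)" "\<And>f g. P f \<Longrightarrow> P g \<Longrightarrow> P (f * g)"
  shows "P f"
proof -
  have "g \<in> polyfun \<Longrightarrow> \<exists>f. ev f = g \<and> P f" for g
  proof (induction rule: polyfun.induct)
    case (polyfun_const c)
    then show ?case by (intro exI[of _ "C c"]) (auto simp: assms)
  next
    case (polyfun_var i)
    then show ?case by (intro exI[of _ "X i"]) (auto simp: assms)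
  next
    case (polyfun_add f g)
    then obtain f' g' where "ev f' = f" "P f'" "ev g' = g" "P g'" by blast
    then show ?case by (intro exI[of _ "f' + g'"]) (auto simp: assms)
  next
    case (polyfun_mult f g)
    then obtain f' g' where "ev f' = f" "P f'" "ev g' = g" "P g'" by blast
    then show ?case by (intro exI[of _ "f' * g'"]) (auto simp: assms)
  qed
  from this[OF ev] show ?thesis by (metis ev_inject)
qed

subsection \<open>Total degree\<close>

text \<open>The restriction of \<open>f\<close> to the ray through \<open>y\<close>. The choice is
  harmless, since a real polynomial is determined by its values.\<close>

definition lin :: "mpol \<Rightarrow> (nat \<Rightarrow> real) \<Rightarrow> real poly" where
  "lin f y = (SOME p. \<forall>t. poly p t = ev f (\<lambda>i. t * y i))"

lemma poly_lin [simp]: "poly (lin f y) t = ev f (\<lambda>i. t * y i)"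
  using someI_ex[OF polyfun_on_line[OF ev, of f "\<lambda>_. 0" y]] unfolding lin_def by auto

lemma real_poly_eqI: "(\<And>t. poly p t = poly q t) \<Longrightarrow> p = (q :: real poly)"
  by (metis poly_eq_poly_eq_iff ext)

lemma lin_simps [simp]:
  "lin (f + g) y = lin f y + lin g y" "lin (f * g) y = lin f y * lin g y"
  "lin (C c) y = [:c:]" "lin (X i) y = [:0, y i:]" "lin 0 y = 0"
  by (rule real_poly_eqI; simp)+

text \<open>As a function of the direction, the coefficient of \<open>t^k\<close> is the homogeneous
  component of degree \<open>k\<close>, hence again a polynomial. This provides leading forms
  without a monomial expansion.\<close>

lemma coeff_lin_mpol: "\<exists>g. \<forall>y. ev g y = coeff (lin f y) k"
proof (induction f arbitrary: k rule: mpol_induct)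
  case (const c)
  then show ?case by (intro exI[of _ "C (coeff [:c:] k)"]) auto
next
  case (var i)
  then show ?case
    by (intro exI[of _ "if k = 1 then X i else 0"]) (auto simp: coeff_pCons split: nat.splits)
next
  case (add f g)
  then show ?case by (metis coeff_add ev_simps(3) lin_simps(1))
next
  case (mult f g)
  from mult(1) obtain F where "\<And>k y. ev (F k) y = coeff (lin f y) k" by metis
  moreover from mult(2) obtain G where "\<And>k y. ev (G k) y = coeff (lin g y) k" by metis
  ultimately show ?case
    by (intro exI[of _ "\<Sum>i\<le>k. F i * G (k - i)"]) (simp add: coeff_mult)
qed

lemma degree_lin_bounded: "\<exists>d. \<forall>y. degree (lin f y) \<le> d"
proof (induction f rule: mpol_induct)
  case (add f g)
  then show ?case using degree_add_le by (metis le_cases lin_simps(1) order_trans)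
next
  case (mult f g)
  then obtain d e where "\<And>y. degree (lin f y) \<le> d" "\<And>y. degree (lin g y) \<le> e" by blast
  then show ?case
    by (intro exI[of _ "d + e"]) (metis add_mono degree_mult_le lin_simps(2) order_trans)
qed (auto intro!: exI[of _ 1])

definition tdeg :: "mpol \<Rightarrow> nat" where
  "tdeg f = (LEAST d. \<forall>y. degree (lin f y) \<le> d)"

lemma degree_lin_le_tdeg: "degree (lin f y) \<le> tdeg f"
  using LeastI_ex[OF degree_lin_bounded[of f]] unfolding tdeg_def by blast

lemma tdeg_leI: "(\<And>y. degree (lin f y) \<le> d) \<Longrightarrow> tdeg f \<le> d"
  unfolding tdeg_def by (rule Least_le) blast

lemma tdeg_attained:
  assumes "f \<noteq> 0"
  shows "\<exists>y. coeff (lin f y) (tdeg f) \<noteq> 0"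
proof (cases "tdeg f = 0")
  case True
  obtain y where "ev f y \<noteq> 0" using mpol_neq_0D[OF assms] by blast
  hence "poly (lin f y) 1 \<noteq> 0" by simp
  hence "lin f y \<noteq> 0" by (metis poly_0)
  hence "lead_coeff (lin f y) \<noteq> 0" by simp
  moreover have "degree (lin f y) = tdeg f" using degree_lin_le_tdeg[of f y] True by simp
  ultimately show ?thesis by metis
next
  case False
  have "\<exists>y. degree (lin f y) = tdeg f"
  proof (rule ccontr)
    assume no: "\<not> ?thesis"
    have "degree (lin f y) \<le> tdeg f - 1" for y
    proof -
      have "degree (lin f y) \<noteq> tdeg f" using no by blast
      thus ?thesis using degree_lin_le_tdeg[of f y] by linarith
    qed
    from tdeg_leI[OF this] False show False by simp
  qed
  then obtain y where y: "degree (lin f y) = tdeg f" by blast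
  hence "lin f y \<noteq> 0" using False by auto
  hence "lead_coeff (lin f y) \<noteq> 0" by simp
  thus ?thesis using y by metis
qed

text \<open>The two leading forms are nonzero, so their product is nonzero; along a direction where
  it does not vanish both degrees are attained at once and add up.\<close>

lemma tdeg_mult:
  assumes "f \<noteq> 0" "g \<noteq> 0"
  shows "tdeg (f * g) = tdeg f + tdeg g"
proof (rule antisym)
  show "tdeg (f * g) \<le> tdeg f + tdeg g"
  proof (rule tdeg_leI)
    fix y
    show "degree (lin (f * g) y) \<le> tdeg f + tdeg g"
      using degree_mult_le[of "lin f y" "lin g y"] degree_lin_le_tdeg[of f y] degree_lin_le_tdeg[of g y]
      by simp
  qed
  obtain F where F: "\<And>y. ev F y = coeff (lin f y) (tdeg f)" using coeff_lin_mpol by metis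
  obtain G where G: "\<And>y. ev G y = coeff (lin g y) (tdeg g)" using coeff_lin_mpol by metis
  have "F \<noteq> 0" "G \<noteq> 0"
    using tdeg_attained[OF assms(1)] tdeg_attained[OF assms(2)] F G by auto
  hence "F * G \<noteq> 0" by simp
  then obtain y where y: "ev F y \<noteq> 0" "ev G y \<noteq> 0" using mpol_neq_0D[of "F * G"] by auto
  hence "tdeg f \<le> degree (lin f y)" "tdeg g \<le> degree (lin g y)" "lin f y \<noteq> 0" "lin g y \<noteq> 0"
    unfolding F G by (auto intro: le_degree)
  thus "tdeg f + tdeg g \<le> tdeg (f * g)"
    using degree_lin_le_tdeg[of "f * g" y] degree_mult_eq[of "lin f y" "lin g y"] by simp
qed

lemma tdeg_eq_0D:
  assumes "tdeg f = 0"
  shows "\<exists>c. f = C c"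
proof (intro exI[of _ "ev f (\<lambda>_. 0)"] mpol_eqI)
  fix y
  have "degree (lin f y) = 0" using degree_lin_le_tdeg[of f y] assms by simp
  then obtain c where "lin f y = [:c:]" by (metis degree_eq_zeroE)
  hence "poly (lin f y) 1 = poly (lin f y) 0" by simp
  thus "ev f y = ev (C (ev f (\<lambda>_. 0))) y" by (simp only: poly_lin) simp
qed

lemma tdeg_C [simp]: "tdeg (C c) = 0"
  using tdeg_leI[of "C c" 0] by simp

lemma tdeg_psub_le: "tdeg (psub w f) \<le> tdeg f"
proof (rule tdeg_leI)
  fix y
  have "lin (psub w f) y = lin f (y \<circ> w)" by (rule real_poly_eqI) (simp add: comp_def)
  thus "degree (lin (psub w f) y) \<le> tdeg f" by (simp add: degree_lin_le_tdeg)
qed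

lemma C_dvd_1: "c \<noteq> 0 \<Longrightarrow> C c dvd 1"
  by (intro dvdI[of _ _ "C (1 / c)"]) (auto intro: mpol_eqI)

lemma is_unit_mpol_iff: "f dvd 1 \<longleftrightarrow> f \<noteq> 0 \<and> tdeg f = 0"
proof
  assume "f dvd 1"
  then obtain g where g: "1 = f * g" by (auto elim: dvdE)
  hence nz: "f \<noteq> 0" "g \<noteq> 0" by auto
  have "1 = C 1" by (rule mpol_eqI) simp
  hence "tdeg (1 :: mpol) = 0" by (metis tdeg_C)
  thus "f \<noteq> 0 \<and> tdeg f = 0" using tdeg_mult[OF nz] g nz by simp
next
  assume "f \<noteq> 0 \<and> tdeg f = 0"
  then obtain c where "f = C c" "f \<noteq> 0" using tdeg_eq_0D by blast
  moreover have "c \<noteq> 0" using calculation by (metis mpol_eqI ev_simps(1) ev_simps'(1))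
  ultimately show "f dvd 1" using C_dvd_1 by blast
qed

lemma mpol_irreducible_divisor:
  assumes "f \<noteq> 0" "\<not> f dvd 1"
  shows "\<exists>p. irreducible p \<and> p dvd (f :: mpol)"
  using assms
proof (induction "tdeg f" arbitrary: f rule: less_induct)
  case less
  show ?case
  proof (cases "irreducible f")
    case False
    then obtain a b where ab: "f = a * b" "\<not> a dvd 1" "\<not> b dvd 1"
      using less.prems unfolding irreducible_def by blast
    hence nz: "a \<noteq> 0" "b \<noteq> 0" using less.prems by auto
    have "tdeg f = tdeg a + tdeg b" "tdeg b > 0"
      using tdeg_mult[OF nz] ab nz is_unit_mpol_iff by auto
    then obtain p where "irreducible p" "p dvd a" using less.hyps[of a] nz ab by auto
    thus ?thesis using ab by auto
  qed (use dvd_refl in blast)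
qed

subsection \<open>Irreducible polynomials are prime\<close>

text \<open>The subring of polynomials in the first \<open>n\<close> variables, described by values
  so that all these rings live in one type and induction on \<open>n\<close> is possible.\<close>

definition dep :: "nat \<Rightarrow> mpol set" where
  "dep n = {f. \<forall>x y. (\<forall>i<n. x i = y i) \<longrightarrow> ev f x = ev f y}"

lemma dep_cong: "f \<in> dep n \<Longrightarrow> (\<And>i. i < n \<Longrightarrow> x i = y i) \<Longrightarrow> ev f x = ev f y"
  unfolding dep_def by auto

lemma dep_mono: "m \<le> n \<Longrightarrow> dep m \<subseteq> dep n"
  unfolding dep_def by fastforce

lemma dep_0: "0 \<in> dep n" and dep_1: "1 \<in> dep n" and dep_C: "C c \<in> dep n"
  and dep_X: "i < n \<Longrightarrow> X i \<in> dep n"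
  unfolding dep_def by auto

lemma dep_add: "f \<in> dep n \<Longrightarrow> g \<in> dep n \<Longrightarrow> f + g \<in> dep n"
  and dep_diff: "f \<in> dep n \<Longrightarrow> g \<in> dep n \<Longrightarrow> f - g \<in> dep n"
  and dep_mult: "f \<in> dep n \<Longrightarrow> g \<in> dep n \<Longrightarrow> f * g \<in> dep n"
  unfolding dep_def by (auto, metis+)

lemma dep_sum: "(\<And>i. i \<in> I \<Longrightarrow> f i \<in> dep n) \<Longrightarrow> (\<Sum>i\<in>I. f i) \<in> dep n"
  by (induction I rule: infinite_finite_induct) (auto intro: dep_0 dep_add)

lemma dep_exists: "\<exists>n. f \<in> dep n"
proof (induction f rule: mpol_induct)
  case (var i)
  then show ?case using dep_X[of i "Suc i"] by auto
next
  case (add f g)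
  then obtain a b where "f \<in> dep a" "g \<in> dep b" by blast
  hence "f + g \<in> dep (max a b)"
    by (intro dep_add) (meson dep_mono max.cobounded1 max.cobounded2 subsetD)+
  then show ?case by blast
next
  case (mult f g)
  then obtain a b where "f \<in> dep a" "g \<in> dep b" by blast
  hence "f * g \<in> dep (max a b)"
    by (intro dep_mult) (meson dep_mono max.cobounded1 max.cobounded2 subsetD)+
  then show ?case by blast
qed (use dep_C in blast)

definition pdep :: "nat \<Rightarrow> mpol poly set" where
  "pdep n = {F. \<forall>k. coeff F k \<in> dep n}"

lemma pdep_0: "0 \<in> pdep n" and pdep_add: "F \<in> pdep n \<Longrightarrow> G \<in> pdep n \<Longrightarrow> F + G \<in> pdep n"
  and pdep_diff: "F \<in> pdep n \<Longrightarrow> G \<in> pdep n \<Longrightarrow> F - G \<in> pdep n"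
  and pdep_mult: "F \<in> pdep n \<Longrightarrow> G \<in> pdep n \<Longrightarrow> F * G \<in> pdep n"
  and pdep_smult: "c \<in> dep n \<Longrightarrow> F \<in> pdep n \<Longrightarrow> smult c F \<in> pdep n"
  and pdep_monom: "c \<in> dep n \<Longrightarrow> monom c k \<in> pdep n"
  unfolding pdep_def by (auto simp: coeff_mult intro: dep_0 dep_add dep_diff dep_mult dep_sum)

lemma pdep_const: "c \<in> dep n \<Longrightarrow> [:c:] \<in> pdep n"
  using pdep_monom[of c n 0] by (simp add: monom_0)

lemma pdep_coeff: "F \<in> pdep n \<Longrightarrow> coeff F k \<in> dep n"
  unfolding pdep_def by auto

lemma poly_X_dep: "F \<in> pdep n \<Longrightarrow> poly F (X n) \<in> dep (Suc n)"
  unfolding poly_altdef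
  by (intro dep_sum dep_mult) (use pdep_coeff dep_mono[of n "Suc n"] in \<open>auto simp: dep_def\<close>)

lemma ev_poly: "ev (poly F g) x = poly (map_poly (\<lambda>c. ev c x) F) (ev g x)"
  by (induction F) (auto simp: map_poly_pCons)

text \<open>An expression for \<open>f\<close> may pass through variables beyond \<open>n\<close>
  that cancel in the end. The induction therefore treats all polynomials, with the later coordinates
  set to 0 by \<open>r\<close>; the hypothesis on \<open>f\<close> enters only afterwards.\<close>

lemma dep_poly_exists:
  assumes "f \<in> dep (Suc n)"
  shows "\<exists>F\<in>pdep n. poly F (X n) = f"
proof -
  define r where "r = (\<lambda>(x :: nat \<Rightarrow> real) i. if i < Suc n then x i else 0)"
  have "\<exists>F\<in>pdep n. \<forall>x. ev (poly F (X n)) x = ev g (r x)" for g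
  proof (induction g rule: mpol_induct)
    case (const c)
    then show ?case by (intro bexI[of _ "[:C c:]"]) (auto intro: pdep_const dep_C)
  next
    case (var i)
    consider "i < n" | "i = n" | "i > n" by linarith
    then show ?case
    proof cases
      case 1
      then show ?thesis by (intro bexI[of _ "[:X i:]"]) (auto intro: pdep_const dep_X simp: r_def)
    next
      case 2
      then show ?thesis
        by (intro bexI[of _ "monom 1 1"]) (auto intro!: pdep_monom dep_1 simp: r_def poly_monom)
    next
      case 3
      then show ?thesis by (intro bexI[of _ 0]) (auto intro: pdep_0 simp: r_def)
    qed
  next
    case (add f g)
    then obtain F G where "F \<in> pdep n" "\<And>x. ev (poly F (X n)) x = ev f (r x)"
      "G \<in> pdep n" "\<And>x. ev (poly G (X n)) x = ev g (r x)" by auto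
    then show ?case by (intro bexI[of _ "F + G"]) (auto intro: pdep_add)
  next
    case (mult f g)
    then obtain F G where "F \<in> pdep n" "\<And>x. ev (poly F (X n)) x = ev f (r x)"
      "G \<in> pdep n" "\<And>x. ev (poly G (X n)) x = ev g (r x)" by auto
    then show ?case by (intro bexI[of _ "F * G"]) (auto intro: pdep_mult)
  qed
  moreover have "ev f (r x) = ev f x" for x
    by (rule dep_cong[OF assms]) (auto simp: r_def)
  ultimately show ?thesis by (metis mpol_eqI)
qed

lemma poly_X_eq_0D:
  assumes "F \<in> pdep n" "poly F (X n) = 0"
  shows "F = 0"
proof (rule poly_eqI, rule mpol_eqI)
  fix k x
  define p where "p = map_poly (\<lambda>c. ev c x) F"
  have "poly p t = 0" for t
  proof -
    have "ev (coeff F k) (x(n := t)) = ev (coeff F k) x" for k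
      by (rule dep_cong[OF pdep_coeff[OF assms(1)]]) auto
    hence "p = map_poly (\<lambda>c. ev c (x(n := t))) F"
      unfolding p_def by (intro poly_eqI) (simp add: coeff_map_poly)
    thus ?thesis using ev_poly[of F "X n" "x(n := t)"] assms(2) by simp
  qed
  hence "p = 0" using poly_all_0_iff_0 by blast
  thus "ev (coeff F k) x = ev (coeff 0 k) x"
    unfolding p_def by (metis coeff_0 coeff_map_poly ev_simps(1))
qed

lemma poly_X_inj:
  assumes "F \<in> pdep n" "G \<in> pdep n" "poly F (X n) = poly G (X n)"
  shows "F = G"
  using poly_X_eq_0D[of "F - G" n] pdep_diff assms by simp

text \<open>Degrees in \<open>X n\<close> add under multiplication, so a product of degree 0 has
  both factors of degree 0.\<close>

lemma dep_factor_Suc: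
  assumes "f * g \<in> dep n" "f \<noteq> 0" "g \<noteq> 0" "f \<in> dep (Suc n)" "g \<in> dep (Suc n)"
  shows "f \<in> dep n"
proof -
  obtain F where F: "F \<in> pdep n" "poly F (X n) = f" using dep_poly_exists assms by blast
  obtain G where G: "G \<in> pdep n" "poly G (X n) = g" using dep_poly_exists assms by blast
  have "F * G = [:f * g:]"
    by (rule poly_X_inj[of _ n]) (use F G assms pdep_mult pdep_const in auto)
  hence "degree (F * G) = 0" by simp
  hence "degree F = 0" using F G assms by (subst (asm) degree_mult_eq) auto
  then obtain c where "F = [:c:]" by (metis degree_eq_zeroE)
  thus ?thesis using F pdep_coeff[OF F(1), of 0] by auto
qed

lemma dep_factor:
  assumes "f * g \<in> dep n" "f \<noteq> 0" "g \<noteq> 0"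
  shows "f \<in> dep n"
proof -
  obtain a b where "f \<in> dep a" "g \<in> dep b" using dep_exists by metis
  hence "f \<in> dep (n + (a + b))" "g \<in> dep (n + (a + b))"
    using dep_mono[of a "n + (a + b)"] dep_mono[of b "n + (a + b)"] by auto
  thus ?thesis
  proof (induction "a + b" arbitrary: a b)
    case (Suc k)
    have *: "f * g \<in> dep (n + k)" using assms(1) dep_mono[of n "n + k"] by auto
    have "f \<in> dep (n + k)"
      using dep_factor_Suc[OF * assms(2,3)] Suc by (metis add_Suc_right)
    moreover have "g \<in> dep (n + k)"
      using dep_factor_Suc[of g f "n + k"] * assms(2,3) Suc by (metis add_Suc_right mult.commute)
    ultimately show ?case using Suc(1)[of k 0] by simp
  qed simp
qed

lemma dep_dvd: "g dvd f \<Longrightarrow> f \<in> dep n \<Longrightarrow> f \<noteq> 0 \<Longrightarrow> g \<in> dep n"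
  by (auto elim!: dvdE intro: dep_factor)

text \<open>Divisibility in \<open>dep n\<close> is divisibility of polynomials, because factors of an element of
  \<open>dep n\<close> lie in \<open>dep n\<close>; so \<open>dprime n\<close> expresses primality in this subring.\<close>

definition dprime :: "nat \<Rightarrow> mpol \<Rightarrow> bool" where
  "dprime n p \<longleftrightarrow> (\<forall>f\<in>dep n. \<forall>g\<in>dep n. p dvd f * g \<longrightarrow> p dvd f \<or> p dvd g)"

lemma dvd_poly_X_iff:
  assumes "p \<in> dep n" "F \<in> pdep n"
  shows "p dvd poly F (X n) \<longleftrightarrow> (\<forall>k. p dvd coeff F k)"
proof
  assume "p dvd poly F (X n)"
  then obtain h where h: "poly F (X n) = p * h" by (auto elim: dvdE)
  show "\<forall>k. p dvd coeff F k"
  proof (cases "poly F (X n) = 0")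
    case True
    then show ?thesis using poly_X_eq_0D[OF assms(2)] by simp
  next
    case False
    hence "h \<in> dep (Suc n)"
      using poly_X_dep[OF assms(2)] h dep_dvd[of h "poly F (X n)" "Suc n"] by simp
    then obtain H where H: "H \<in> pdep n" "poly H (X n) = h" using dep_poly_exists by blast
    have "F = smult p H"
      by (rule poly_X_inj[of _ n]) (use assms H h pdep_smult in auto)
    thus ?thesis by simp
  qed
next
  assume "\<forall>k. p dvd coeff F k"
  thus "p dvd poly F (X n)" unfolding poly_altdef by (auto intro: dvd_sum)
qed

text \<open>Gauss's lemma: if \<open>p\<close> divided neither factor, take in each the lowest
  coefficient not divisible by \<open>p\<close>. In the product coefficient of the summed index all
  other terms are divisible by \<open>p\<close>, so the product of these two would be as
  well.\<close>

lemma dprime_Suc: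
  assumes "p \<in> dep n" "dprime n p"
  shows "dprime (Suc n) p"
  unfolding dprime_def
proof (intro ballI impI)
  fix f g assume fg: "f \<in> dep (Suc n)" "g \<in> dep (Suc n)" "p dvd f * g"
  obtain F where F: "F \<in> pdep n" "poly F (X n) = f" using dep_poly_exists fg by blast
  obtain G where G: "G \<in> pdep n" "poly G (X n) = g" using dep_poly_exists fg by blast
  have FG: "p dvd coeff (F * G) k" for k
    using dvd_poly_X_iff[OF assms(1) pdep_mult[OF F(1) G(1)]] fg F G by simp
  show "p dvd f \<or> p dvd g"
  proof (rule ccontr)
    assume "\<not> ?thesis"
    hence ex: "\<exists>i. \<not> p dvd coeff F i" "\<exists>j. \<not> p dvd coeff G j"
      using dvd_poly_X_iff[OF assms(1) F(1)] dvd_poly_X_iff[OF assms(1) G(1)] F G by auto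
    define i where "i = (LEAST i. \<not> p dvd coeff F i)"
    define j where "j = (LEAST j. \<not> p dvd coeff G j)"
    have i: "\<not> p dvd coeff F i" "\<And>k. k < i \<Longrightarrow> p dvd coeff F k"
      using LeastI_ex[OF ex(1)] not_less_Least unfolding i_def by blast+
    have j: "\<not> p dvd coeff G j" "\<And>k. k < j \<Longrightarrow> p dvd coeff G k"
      using LeastI_ex[OF ex(2)] not_less_Least unfolding j_def by blast+
    have "coeff (F * G) (i + j) = (\<Sum>k\<le>i + j. coeff F k * coeff G (i + j - k))"
      by (simp add: coeff_mult)
    also have "\<dots> = coeff F i * coeff G j + (\<Sum>k\<in>{..i + j} - {i}. coeff F k * coeff G (i + j - k))"
      by (subst sum.remove[of _ i]) auto
    finally have eq: "coeff F i * coeff G j =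
        coeff (F * G) (i + j) - (\<Sum>k\<in>{..i + j} - {i}. coeff F k * coeff G (i + j - k))" by simp
    have "p dvd (\<Sum>k\<in>{..i + j} - {i}. coeff F k * coeff G (i + j - k))"
    proof (rule dvd_sum)
      fix k assume "k \<in> {..i + j} - {i}"
      hence "k < i \<or> i + j - k < j" by auto
      thus "p dvd coeff F k * coeff G (i + j - k)" using i(2) j(2) by auto
    qed
    hence "p dvd coeff F i * coeff G j" unfolding eq using FG by (intro dvd_diff) auto
    thus False using assms(2) i(1) j(1) pdep_coeff F G unfolding dprime_def by blast
  qed
qed

text \<open>Division with remainder that stays inside the ring: the multiplier \<open>c\<close>
  collects the powers of the leading coefficient of \<open>H\<close> by which a field would
  divide.\<close>

lemma pseudo_division_dep:
  assumes "H \<in> pdep n" "H \<noteq> 0" "K \<in> pdep n"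
  shows "\<exists>c U R. c \<in> dep n \<and> c \<noteq> 0 \<and> U \<in> pdep n \<and> R \<in> pdep n \<and>
           smult c K = H * U + R \<and> (R = 0 \<or> degree R < degree H)"
  using assms(3)
\<comment> \<open>The measure separates the zero polynomial from nonzero constants, as both have
  degree 0.\<close>
proof (induction "if K = 0 then 0 else Suc (degree K)" arbitrary: K rule: less_induct)
  case less
  show ?case
  proof (cases "K = 0 \<or> degree K < degree H")
    case True
    then show ?thesis
      by (intro exI[of _ 1] exI[of _ 0] exI[of _ K]) (auto intro: dep_1 pdep_0 less.prems)
  next
    case False
    define M where "M = monom (lead_coeff K) (degree K - degree H)"
    define K' where "K' = smult (lead_coeff H) K - M * H"
    have M: "M \<in> pdep n" unfolding M_def using less.prems pdep_coeff pdep_monom by blast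
    have K': "K' \<in> pdep n" unfolding K'_def
      using M assms less.prems pdep_coeff pdep_mult pdep_diff pdep_smult by meson
    have nz: "M \<noteq> 0" "M * H \<noteq> 0" using False assms by (auto simp: M_def)
    have deg: "degree (M * H) = degree K"
      using nz assms False by (subst degree_mult_eq) (auto simp: M_def degree_monom_eq)
    have "coeff K' (degree K) = lead_coeff H * lead_coeff K - coeff (M * H) (degree (M * H))"
      unfolding K'_def deg by simp
    also have "coeff (M * H) (degree (M * H)) = lead_coeff M * lead_coeff H"
      by (rule lead_coeff_mult)
    also have "lead_coeff M = lead_coeff K" using False by (simp add: M_def degree_monom_eq)
    finally have "coeff K' (degree K) = 0" by simp
    moreover have "degree K' \<le> degree K" unfolding K'_def
      by (intro degree_diff_le) (use deg degree_smult_le in auto)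
    ultimately have "K' = 0 \<or> degree K' < degree K"
      by (metis leading_coeff_0_iff le_neq_implies_less)
    hence "(if K' = 0 then 0 else Suc (degree K')) < (if K = 0 then 0 else Suc (degree K))"
      using False by auto
    from less.hyps[OF this K'] obtain c U R where cUR:
      "c \<in> dep n" "c \<noteq> 0" "U \<in> pdep n" "R \<in> pdep n" "smult c K' = H * U + R" "R = 0 \<or> degree R < degree H"
      by blast
    have "smult (c * lead_coeff H) K = smult c K' + smult c (M * H)"
      unfolding K'_def by (simp add: smult_diff_right)
    also have "\<dots> = H * (U + smult c M) + R"
      using cUR(5) by (simp add: algebra_simps)
    finally show ?thesis
      using cUR assms M
      by (intro exI[of _ "c * lead_coeff H"] exI[of _ "U + smult c M"] exI[of _ R])
        (auto intro: dep_mult pdep_coeff pdep_add pdep_smult)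
  qed
qed

lemma dep_irreducible_factor:
  assumes "c \<in> dep n" "c \<noteq> 0" "tdeg c > 0"
  obtains p c' where "irreducible p" "p \<in> dep n" "c' \<in> dep n" "c' \<noteq> 0" "c = p * c'" "tdeg c' < tdeg c"
proof -
  have "\<not> c dvd 1" using assms is_unit_mpol_iff by auto
  then obtain p where p: "irreducible p" "p dvd c" using mpol_irreducible_divisor assms by blast
  then obtain c' where c': "c = p * c'" by (auto elim: dvdE)
  have nz: "p \<noteq> 0" "c' \<noteq> 0" using c' assms by auto
  have "tdeg p > 0" using p nz is_unit_mpol_iff irreducible_not_unit by auto
  moreover have "p \<in> dep n" "c' \<in> dep n"
    using dep_dvd[of p c n] dep_dvd[of c' c n] assms c' by auto
  ultimately show ?thesis using that[of p c'] p c' nz tdeg_mult[OF nz] by auto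
qed

lemma irreducible_not_dvd_lower:
  assumes "irreducible q" "q \<notin> dep n" "irreducible p" "p \<in> dep n"
  shows "\<not> p dvd q"
proof
  assume "p dvd q"
  then obtain r where r: "q = p * r" by (auto elim: dvdE)
  hence "r dvd 1" using assms irreducibleD[OF assms(1) r] irreducible_not_unit by blast
  then obtain c where "r = C c" using is_unit_mpol_iff tdeg_eq_0D by blast
  thus False using assms r dep_mult dep_C by blast
qed

context
  fixes n :: nat
  assumes dprime: "\<And>p. irreducible p \<Longrightarrow> p \<in> dep n \<Longrightarrow> dprime n p"
begin

text \<open>The factor \<open>c\<close> is removed one irreducible \<open>p\<close> at a time. Such
  a \<open>p\<close> remains prime with one more variable and cannot divide \<open>q\<close>, which
  involves the new variable; so it divides the cofactor and cancels.\<close>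

lemma irreducible_dvd_cancel_lower:
  assumes q: "irreducible q" "q \<in> dep (Suc n)" "q \<notin> dep n"
    and "c \<in> dep n" "c \<noteq> 0" "f \<in> dep (Suc n)" "q dvd c * f"
  shows "q dvd f"
  using assms(4-)
proof (induction "tdeg c" arbitrary: c rule: less_induct)
  case less
  show ?case
  proof (cases "f = 0 \<or> tdeg c = 0")
    case True
    then show ?thesis
      using less.prems is_unit_mpol_iff[of c] by (metis dvd_0_right dvd_mult_unit_iff')
  next
    case False
    then obtain p c' where p: "irreducible p" "p \<in> dep n" "c' \<in> dep n" "c' \<noteq> 0" "c = p * c'" "tdeg c' < tdeg c"
      using dep_irreducible_factor less.prems by (metis neq0_conv)
    obtain w where w: "c * f = q * w" using less.prems by (auto elim: dvdE)
    have cf: "c * f \<in> dep (Suc n)" "c * f \<noteq> 0"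
      using less.prems False dep_mono[of n "Suc n"] by (auto intro: dep_mult)
    hence wd: "w \<in> dep (Suc n)" using w dep_dvd[of w "c * f"] by simp
    have "p dvd q * w" using w p by (metis dvd_mult2 dvd_triv_left)
    hence "p dvd q \<or> p dvd w"
      using dprime_Suc[OF p(2) dprime[OF p(1,2)]] wd q unfolding dprime_def by blast
    hence "p dvd w" using irreducible_not_dvd_lower[OF q(1,3) p(1,2)] by blast
    then obtain w' where "w = p * w'" by (auto elim: dvdE)
    hence "p * (c' * f) = p * (q * w')" using w p by (simp add: algebra_simps)
    moreover have "p \<noteq> 0" using p by auto
    ultimately have "c' * f = q * w'" by simp
    thus ?thesis using less.hyps[OF p(6) p(3,4)] less.prems by auto
  qed
qed

text \<open>Each prime factor of \<open>c\<close> divides \<open>h\<close> or \<open>u\<close> and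
  is removed there. This turns a factorisation of \<open>q\<close> up to lower-variable denominators
  into a genuine one.\<close>

lemma split_lower_factor:
  assumes "c \<in> dep n" "c \<noteq> 0" "c * q = h * u" "q \<noteq> 0" "h \<in> dep (Suc n)" "u \<in> dep (Suc n)"
  shows "\<exists>c1 c2 h' u'. c1 \<in> dep n \<and> c1 \<noteq> 0 \<and> h = c1 * h' \<and> u = c2 * u' \<and> q = h' * u'"
  using assms
proof (induction "tdeg c" arbitrary: c h u rule: less_induct)
  case less
  show ?case
  proof (cases "tdeg c = 0")
    case True
    hence "c dvd 1" using less.prems is_unit_mpol_iff by auto
    then obtain d where d: "1 = c * d" by (auto elim: dvdE)
    hence "q = h * (d * u)" using less.prems
      by (metis (no_types, opaque_lifting) mult.assoc mult.commute mult_1)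
    moreover have "u = c * (d * u)" using d by (metis mult.assoc mult_1)
    ultimately show ?thesis using dep_1
      by (intro exI[of _ 1] exI[of _ c] exI[of _ h] exI[of _ "d * u"]) auto
  next
    case False
    then obtain p c' where p: "irreducible p" "p \<in> dep n" "c' \<in> dep n" "c' \<noteq> 0" "c = p * c'" "tdeg c' < tdeg c"
      using dep_irreducible_factor less.prems by (metis neq0_conv)
    have p0: "p \<noteq> 0" using p by auto
    have "p dvd h * u" using less.prems(3) p(5) by (metis dvd_mult2 dvd_triv_left)
    hence "p dvd h \<or> p dvd u"
      using dprime_Suc[OF p(2) dprime[OF p(1,2)]] less.prems unfolding dprime_def by blast
    thus ?thesis
    proof
      assume "p dvd h"
      then obtain h0 where h0: "h = p * h0" by (auto elim: dvdE)
      have "h \<noteq> 0" using less.prems by auto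
      hence "h0 \<in> dep (Suc n)" using h0 less.prems dep_dvd[of h0 h] by simp
      moreover have "c' * q = h0 * u" using less.prems(3) p(5) h0 p0 by (simp add: mult.assoc)
      ultimately obtain c1 c2 h' u' where
        "c1 \<in> dep n" "c1 \<noteq> 0" "h0 = c1 * h'" "u = c2 * u'" "q = h' * u'"
        using less.hyps[OF p(6) p(3,4), of h0 u] less.prems by auto
      thus ?thesis using h0 p p0
        by (intro exI[of _ "p * c1"] exI[of _ c2] exI[of _ h'] exI[of _ u']) (auto intro: dep_mult)
    next
      assume "p dvd u"
      then obtain u0 where u0: "u = p * u0" by (auto elim: dvdE)
      have "u \<noteq> 0" using less.prems by auto
      hence "u0 \<in> dep (Suc n)" using u0 less.prems dep_dvd[of u0 u] by simp
      moreover have "c' * q = h * u0" using less.prems(3) p(5) u0 p0 by (simp add: mult.left_commute mult.assoc)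
      ultimately obtain c1 c2 h' u' where
        "c1 \<in> dep n" "c1 \<noteq> 0" "h = c1 * h'" "u0 = c2 * u'" "q = h' * u'"
        using less.hyps[OF p(6) p(3,4), of h u0] less.prems by auto
      thus ?thesis using u0
        by (intro exI[of _ c1] exI[of _ "p * c2"] exI[of _ h'] exI[of _ u']) auto
    qed
  qed
qed

text \<open>Over the fraction field of the lower ring, the polynomials \<open>H\<close> with
  \<open>q dvd H * g\<close> form a principal ideal, generated by an element of least degree. The
  proof follows that argument with explicit denominators: \<open>h\<close> is the generator, and
  irreducibility of \<open>q\<close> makes it either a lower element, so that
  \<open>q dvd g\<close>, or \<open>q\<close> up to lower factors, so that
  \<open>q dvd f\<close>.\<close>

lemma irreducible_dprime_Suc:
  assumes q: "irreducible q" "q \<in> dep (Suc n)"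
  shows "dprime (Suc n) q"
proof (cases "q \<in> dep n")
  case True
  then show ?thesis using dprime_Suc dprime q by blast
next
  case qn: False
  show ?thesis unfolding dprime_def
  proof (intro ballI impI)
    fix f g assume fg: "f \<in> dep (Suc n)" "g \<in> dep (Suc n)" "q dvd f * g"
    obtain Q where Q: "Q \<in> pdep n" "poly Q (X n) = q" using dep_poly_exists q by blast
    obtain F where F: "F \<in> pdep n" "poly F (X n) = f" using dep_poly_exists fg by blast
    have q0: "q \<noteq> 0" using q by auto
    define J where "J = {H \<in> pdep n. H \<noteq> 0 \<and> q dvd poly H (X n) * g}"
    have "Q \<in> J" unfolding J_def using Q q0 by auto
    then obtain H where H: "H \<in> J" "\<And>K. K \<in> J \<Longrightarrow> degree H \<le> degree K"
      using ex_has_least_nat[of "\<lambda>H. H \<in> J" Q degree] by blast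
    define h where "h = poly H (X n)"
    have Hp: "H \<in> pdep n" "H \<noteq> 0" "q dvd h * g" using H unfolding J_def h_def by auto
    have hd: "h \<in> dep (Suc n)" "h \<noteq> 0"
      unfolding h_def using Hp poly_X_dep poly_X_eq_0D by blast+
    have div: "\<exists>c u. c \<in> dep n \<and> c \<noteq> 0 \<and> u \<in> dep (Suc n) \<and> c * poly K (X n) = h * u"
      if K: "K \<in> pdep n" "q dvd poly K (X n) * g" for K
    proof -
      obtain c U R where cUR: "c \<in> dep n" "c \<noteq> 0" "U \<in> pdep n" "R \<in> pdep n"
        "smult c K = H * U + R" "R = 0 \<or> degree R < degree H"
        using pseudo_division_dep[OF Hp(1,2) K(1)] by blast
      have e: "c * poly K (X n) = h * poly U (X n) + poly R (X n)"
        using arg_cong[OF cUR(5), of "\<lambda>p. poly p (X n)"] by (simp add: h_def)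
      have "poly R (X n) = c * poly K (X n) - h * poly U (X n)" unfolding e by simp
      hence "poly R (X n) * g = (c * poly K (X n) - h * poly U (X n)) * g" by (rule arg_cong)
      also have "\<dots> = c * (poly K (X n) * g) - poly U (X n) * (h * g)"
        by (simp add: algebra_simps)
      finally have "poly R (X n) * g = c * (poly K (X n) * g) - poly U (X n) * (h * g)" .
      hence "q dvd poly R (X n) * g" using K(2) Hp(3) by simp
      hence "R = 0" using H(2)[of R] cUR(4,6) unfolding J_def by fastforce
      thus ?thesis using e cUR poly_X_dep by auto
    qed
    obtain c u where cu: "c \<in> dep n" "c \<noteq> 0" "u \<in> dep (Suc n)" "c * q = h * u"
      using div[OF Q(1)] Q by auto
    obtain c' u' where cu': "c' \<in> dep n" "c' \<noteq> 0" "c' * f = h * u'"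
      using div[OF F(1)] F fg by auto
    obtain c1 c2 h' v where s: "c1 \<in> dep n" "c1 \<noteq> 0" "h = c1 * h'" "u = c2 * v" "q = h' * v"
      using split_lower_factor[OF cu(1,2,4) q0 hd(1) cu(3)] by blast
    have "h' dvd 1 \<or> v dvd 1" using irreducibleD[OF q(1) s(5)] .
    thus "q dvd f \<or> q dvd g"
    proof
      assume "h' dvd 1"
      then obtain c3 where "h' = C c3" using is_unit_mpol_iff tdeg_eq_0D by blast
      hence "h \<in> dep n" using s dep_mult dep_C by blast
      thus ?thesis using irreducible_dvd_cancel_lower[OF q qn _ hd(2) fg(2) Hp(3)] by blast
    next
      assume "v dvd 1"
      hence "q dvd h'" using s(5) by (metis dvd_refl mult_unit_dvd_iff)
      hence "q dvd c' * f" using s(3) cu'(3) by simp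
      thus ?thesis using irreducible_dvd_cancel_lower[OF q qn cu'(1,2) fg(1)] by blast
    qed
  qed
qed

end

lemma irreducible_dprime: "irreducible q \<Longrightarrow> q \<in> dep n \<Longrightarrow> dprime n q"
proof (induction n arbitrary: q)
  case 0
  have "q = C (ev q (\<lambda>_. 0))"
    using dep_cong[OF 0(2)] by (intro mpol_eqI) auto
  hence "tdeg q = 0" by (metis tdeg_C)
  hence False using 0 is_unit_mpol_iff irreducible_not_unit by auto
  thus ?case ..
next
  case (Suc n)
  show ?case by (rule irreducible_dprime_Suc) (use Suc in auto)
qed

lemma irreducible_dvd_mult_mpol:
  assumes "irreducible q" "q dvd f * (g :: mpol)"
  shows "q dvd f \<or> q dvd g"
proof -
  obtain a b c where "q \<in> dep a" "f \<in> dep b" "g \<in> dep c" using dep_exists by metis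
  hence "q \<in> dep (a + b + c)" "f \<in> dep (a + b + c)" "g \<in> dep (a + b + c)"
    using dep_mono[of a "a + b + c"] dep_mono[of b "a + b + c"] dep_mono[of c "a + b + c"] by auto
  thus ?thesis using irreducible_dprime[OF assms(1)] assms(2) unfolding dprime_def by blast
qed

section \<open>Greatest common divisors of families\<close>

lemma dvd_mult_cancel_coprime_family:
  assumes "\<And>p. irreducible p \<Longrightarrow> \<exists>b\<in>B. \<not> p dvd b"
    and "h \<noteq> 0" "\<And>b. b \<in> B \<Longrightarrow> h dvd g * (b :: mpol)"
  shows "h dvd g"
  using assms(2,3)
proof (induction "tdeg h" arbitrary: h g rule: less_induct)
  case less
  show ?case
  proof (cases "tdeg h = 0")
    case True
    then show ?thesis using less.prems is_unit_mpol_iff unit_imp_dvd by blast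
  next
    case False
    hence "\<not> h dvd 1" unfolding is_unit_mpol_iff by simp
    from mpol_irreducible_divisor[OF less.prems(1) this] obtain p where p: "irreducible p" "p dvd h"
      by (elim exE conjE)
    then obtain h' where h': "h = p * h'" by (auto elim: dvdE)
    have nz: "p \<noteq> 0" "h' \<noteq> 0" using h' less.prems by auto
    \<comment> \<open>Some member of the family escapes \<open>p\<close>, so primality forces
      \<open>p\<close> into \<open>g\<close>; it is then cancelled from both \<open>h\<close> and
      \<open>g\<close>.\<close>
    obtain b where "b \<in> B" "\<not> p dvd b" using assms(1) p by blast
    moreover have "p dvd g * b" using less.prems(2)[OF \<open>b \<in> B\<close>] p dvd_trans by blast
    ultimately have "p dvd g" using irreducible_dvd_mult_mpol p by blast
    then obtain g' where g': "g = p * g'" by (auto elim: dvdE)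
    have "h' dvd g' * b" if "b \<in> B" for b
    proof -
      have "p * h' dvd p * (g' * b)" using less.prems(2)[OF that] unfolding h' g' mult.assoc .
      thus ?thesis using nz dvd_mult_cancel_left by blast
    qed
    moreover have "tdeg h' < tdeg h"
      using tdeg_mult[OF nz] h' p nz is_unit_mpol_iff irreducible_not_unit by auto
    ultimately have "h' dvd g'" using less.hyps nz by blast
    thus ?thesis using h' g' by simp
  qed
qed

text \<open>A common divisor of maximal total degree has cofactors without common irreducible
  factor. The multiplier \<open>k\<close> in the last property is what local divisibility requires:
  there a denominator \<open>k\<close> appears that cannot be cancelled.\<close>

lemma mpol_strong_gcd:
  fixes F :: "mpol set"
  assumes "f0 \<in> F" "f0 \<noteq> 0"
  obtains G where "G \<noteq> 0" "\<And>f. f \<in> F \<Longrightarrow> G dvd f"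
    "\<And>h k. h \<noteq> 0 \<Longrightarrow> (\<And>f. f \<in> F \<Longrightarrow> h dvd k * f) \<Longrightarrow> h dvd k * G"
proof -
  define D where "D = {g. \<forall>f\<in>F. g dvd f}"
  have bound: "tdeg g \<le> tdeg f0" "g \<noteq> 0" if "g \<in> D" for g
  proof -
    have "g dvd f0" using that assms by (auto simp: D_def)
    then obtain h where "f0 = g * h" by (auto elim: dvdE)
    thus "tdeg g \<le> tdeg f0" "g \<noteq> 0" using tdeg_mult[of g h] assms by auto
  qed
  have "1 \<in> D" by (auto simp: D_def)
  hence "\<exists>G. G \<in> D \<and> (\<forall>g. g \<in> D \<longrightarrow> tdeg g \<le> tdeg G)"
    by (rule ex_has_greatest_nat[where b = "Suc (tdeg f0)"]) (simp add: bound(1) less_Suc_eq_le)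
  then obtain G where G: "G \<in> D" "\<And>g. g \<in> D \<Longrightarrow> tdeg g \<le> tdeg G" by blast
  have G0: "G \<noteq> 0" using bound G by blast
  define B where "B = {b. G * b \<in> F}"
  have F: "\<exists>b\<in>B. f = G * b" if "f \<in> F" for f
    using that G(1) unfolding D_def B_def by (auto elim!: dvdE)
  have copr: "\<exists>b\<in>B. \<not> p dvd b" if p: "irreducible p" for p
  proof (rule ccontr)
    assume "\<not> ?thesis"
    hence "G * p \<in> D" unfolding D_def using F by (fastforce intro: mult_dvd_mono)
    moreover have "p \<noteq> 0" "tdeg p > 0" using p is_unit_mpol_iff irreducible_not_unit by auto
    ultimately show False using G(2)[of "G * p"] tdeg_mult[OF G0, of p] by auto
  qed
  show ?thesis
  proof (rule that[OF G0])
    show "G dvd f" if "f \<in> F" for f using that G by (auto simp: D_def)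
    show "h dvd k * G" if h: "h \<noteq> 0" "\<And>f. f \<in> F \<Longrightarrow> h dvd k * f" for h k
    proof (rule dvd_mult_cancel_coprime_family[OF copr h(1)])
      show "h dvd k * G * b" if "b \<in> B" for b
        using h(2)[of "G * b"] that unfolding B_def mult.assoc by blast
    qed
  qed
qed

subsection \<open>Polynomial functions with degree bounds\<close>

definition mnml :: "nat \<Rightarrow> (nat \<Rightarrow> nat) \<Rightarrow> (nat \<Rightarrow> real) \<Rightarrow> real" where
  "mnml n \<alpha> x = (\<Prod>i<n. x i ^ \<alpha> i)"

lemma mnml_scale: "mnml n \<alpha> (\<lambda>i. t * y i) = mnml n \<alpha> y * t ^ (\<Sum>i<n. \<alpha> i)"
  unfolding mnml_def by (simp add: power_mult_distrib prod.distrib power_sum mult.commute)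

lemma mnml_mult: "mnml n \<alpha> x * mnml n \<beta> x = mnml n (\<lambda>i. \<alpha> i + \<beta> i) x"
  unfolding mnml_def by (simp add: power_add prod.distrib)

lemma lin_monomial_sum:
  assumes "\<And>x. ev p x = (\<Sum>\<alpha>\<in>S. c \<alpha> * mnml n \<alpha> x)"
  shows "lin p y = (\<Sum>\<alpha>\<in>S. monom (c \<alpha> * mnml n \<alpha> y) (\<Sum>i<n. \<alpha> i))"
  by (rule real_poly_eqI) (simp add: assms mnml_scale poly_sum poly_monom mult.assoc)

lemma poly_deg_le_imp_mpol:
  assumes "poly_deg_le n d f"
  shows "\<exists>p\<in>dep n. ev p = f \<and> tdeg p \<le> d"
proof -
  obtain c where c: "finite {\<alpha>. c \<alpha> \<noteq> 0}"
    "\<And>\<alpha>. c \<alpha> \<noteq> 0 \<Longrightarrow> (\<forall>i\<ge>n. \<alpha> i = 0) \<and> (\<Sum>i<n. \<alpha> i) \<le> d"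
    "\<And>x. f x = (\<Sum>\<alpha>\<in>{\<alpha>. c \<alpha> \<noteq> 0}. c \<alpha> * mnml n \<alpha> x)"
    using assms unfolding poly_deg_le_def mnml_def by blast
  have "f \<in> polyfun"
    unfolding c(3)[abs_def] mnml_def
    by (intro polyfun_sum polyfun_mult polyfun_const polyfun_prod polyfun_power polyfun_var)
  then obtain p where p: "ev p = f" using polyfun_obtain by blast
  have "ev p x = ev p y" if "\<forall>i<n. x i = y i" for x y
    unfolding p c(3) mnml_def using that by (auto intro!: sum.cong prod.cong)
  hence "p \<in> dep n" unfolding dep_def by blast
  moreover have "tdeg p \<le> d"
    by (rule tdeg_leI, subst lin_monomial_sum[where p = p and n = n])
      (use c p in \<open>auto intro!: degree_sum_le intro: order_trans[OF degree_monom_le]\<close>)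
  ultimately show ?thesis using p by blast
qed

text \<open>The index set may contain exponents with coefficient 0. Closure under sums thus needs no
  tracking of the exact support, which is restored only in the final conversion.\<close>

definition mspan :: "nat \<Rightarrow> ((nat \<Rightarrow> real) \<Rightarrow> real) \<Rightarrow> bool" where
  "mspan n f \<longleftrightarrow> (\<exists>S c. finite S \<and> (\<forall>\<alpha>\<in>S. \<forall>i\<ge>n. \<alpha> i = 0) \<and> (\<forall>x. f x = (\<Sum>\<alpha>\<in>S. c \<alpha> * mnml n \<alpha> x)))"

lemma mspan_0: "mspan n (\<lambda>x. 0)"
  unfolding mspan_def by (intro exI[of _ "{}"]) auto

lemma mspan_add_mnml:
  assumes "mspan n f" "\<forall>i\<ge>n. \<beta> i = 0"
  shows "mspan n (\<lambda>x. b * mnml n \<beta> x + f x)"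
proof -
  obtain S c where S: "finite S" "\<forall>\<alpha>\<in>S. \<forall>i\<ge>n. \<alpha> i = 0" "\<And>x. f x = (\<Sum>\<alpha>\<in>S. c \<alpha> * mnml n \<alpha> x)"
    using assms(1) unfolding mspan_def by blast
  define c' where "c' = c(\<beta> := (if \<beta> \<in> S then c \<beta> else 0) + b)"
  have "b * mnml n \<beta> x + f x = (\<Sum>\<alpha>\<in>insert \<beta> S. c' \<alpha> * mnml n \<alpha> x)" for x
  proof -
    have "(\<Sum>\<alpha>\<in>S - {\<beta>}. c' \<alpha> * mnml n \<alpha> x) = (\<Sum>\<alpha>\<in>S - {\<beta>}. c \<alpha> * mnml n \<alpha> x)"
      by (rule sum.cong) (auto simp: c'_def)
    moreover have "(\<Sum>\<alpha>\<in>S. c \<alpha> * mnml n \<alpha> x) =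
        (if \<beta> \<in> S then c \<beta> else 0) * mnml n \<beta> x + (\<Sum>\<alpha>\<in>S - {\<beta>}. c \<alpha> * mnml n \<alpha> x)"
      using S(1) by (auto simp: sum.remove)
    ultimately show ?thesis
      by (simp add: sum.insert_remove[OF S(1)] S(3) c'_def algebra_simps)
  qed
  thus ?thesis unfolding mspan_def using S(1,2) assms(2)
    by (intro exI[of _ "insert \<beta> S"] exI[of _ c']) auto
qed

lemma mspan_induct [consumes 1, case_names zero add_mnml]:
  assumes "mspan n f" "P (\<lambda>x. 0)"
    "\<And>f b \<beta>. mspan n f \<Longrightarrow> P f \<Longrightarrow> \<forall>i\<ge>n. \<beta> i = 0 \<Longrightarrow> P (\<lambda>x. b * mnml n \<beta> x + f x)"
  shows "P f"
proof -
  obtain S c where S: "finite S" "\<forall>\<alpha>\<in>S. \<forall>i\<ge>n. \<alpha> i = 0" "f = (\<lambda>x. \<Sum>\<alpha>\<in>S. c \<alpha> * mnml n \<alpha> x)"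
    using assms(1) unfolding mspan_def by blast
  have "mspan n (\<lambda>x. \<Sum>\<alpha>\<in>S. c \<alpha> * mnml n \<alpha> x) \<and> P (\<lambda>x. \<Sum>\<alpha>\<in>S. c \<alpha> * mnml n \<alpha> x)"
    using S(1,2)
  proof (induction S rule: finite_induct)
    case empty
    show ?case using assms(2) mspan_0 by simp
  next
    case (insert \<beta> S)
    then show ?case
      using assms(3)[of "\<lambda>x. \<Sum>\<alpha>\<in>S. c \<alpha> * mnml n \<alpha> x" \<beta> "c \<beta>"] mspan_add_mnml[of n _ \<beta> "c \<beta>"] by simp
  qed
  thus ?thesis using S(3) by simp
qed

lemma mspan_add: "mspan n f \<Longrightarrow> mspan n g \<Longrightarrow> mspan n (\<lambda>x. f x + g x)"
proof (induction rule: mspan_induct)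
  case (add_mnml f b \<beta>)
  then show ?case using mspan_add_mnml[of n "\<lambda>x. f x + g x" \<beta> b] by (simp add: add.assoc)
qed simp

lemma mspan_mult_mnml: "mspan n f \<Longrightarrow> \<forall>i\<ge>n. \<beta> i = 0 \<Longrightarrow> mspan n (\<lambda>x. b * mnml n \<beta> x * f x)"
proof (induction rule: mspan_induct)
  case (add_mnml f c \<gamma>)
  have "b * mnml n \<beta> x * (c * mnml n \<gamma> x + f x) = (b * c) * mnml n (\<lambda>i. \<beta> i + \<gamma> i) x + b * mnml n \<beta> x * f x" for x
    by (simp add: mnml_mult[symmetric] algebra_simps)
  then show ?case using mspan_add_mnml[of n "\<lambda>x. b * mnml n \<beta> x * f x" "\<lambda>i. \<beta> i + \<gamma> i" "b * c"] add_mnml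
    by simp
qed (simp add: mspan_0)

lemma mspan_mult: "mspan n f \<Longrightarrow> mspan n g \<Longrightarrow> mspan n (\<lambda>x. f x * g x)"
proof (induction rule: mspan_induct)
  case (add_mnml f b \<beta>)
  then show ?case using mspan_add[OF mspan_mult_mnml[of n g \<beta> b]] by (simp add: distrib_right)
qed (simp add: mspan_0)

lemma mspan_mpol:
  assumes "p \<in> dep n"
  shows "mspan n (ev p)"
proof -
  define r where "r = (\<lambda>(x :: nat \<Rightarrow> real) i. if i < n then x i else 0)"
  have "mspan n (\<lambda>x. ev q (r x))" for q
  proof (induction q rule: mpol_induct)
    case (const c)
    then show ?case using mspan_add_mnml[OF mspan_0, of n "\<lambda>_. 0" c] by (simp add: mnml_def)
  next
    case (var i)
    have "mnml n (\<lambda>j. if j = i then 1 else 0) x = x i" if "i < n" for x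
    proof -
      have "mnml n (\<lambda>j. if j = i then 1 else 0) x = (\<Prod>j<n. if j = i then x i else 1)"
        unfolding mnml_def by (intro prod.cong) auto
      also have "\<dots> = x i" using that by (subst prod.delta) auto
      finally show ?thesis .
    qed
    then show ?case
      using mspan_add_mnml[OF mspan_0, of n "\<lambda>j. if j = i then 1 else 0" 1]
      by (cases "i < n") (auto simp: r_def mspan_0)
  qed (auto intro: mspan_add mspan_mult)
  moreover have "ev p (r x) = ev p x" for x
    by (rule dep_cong[OF assms]) (auto simp: r_def)
  ultimately show ?thesis using ext[of "\<lambda>x. ev p (r x)" "ev p"] by metis
qed

lemma mpol_imp_poly_deg_le:
  assumes "p \<in> dep n" "tdeg p \<le> d"
  shows "poly_deg_le n d (ev p)"
proof -
  obtain S c where S: "finite S" "\<forall>\<alpha>\<in>S. \<forall>i\<ge>n. \<alpha> i = 0" "\<And>x. ev p x = (\<Sum>\<alpha>\<in>S. c \<alpha> * mnml n \<alpha> x)"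
    using mspan_mpol[OF assms(1)] unfolding mspan_def by blast
  define T where "T = {\<alpha>\<in>S. (\<Sum>i<n. \<alpha> i) \<le> d}"
  have T: "finite T" "T \<subseteq> S" using S by (auto simp: T_def)
  have trunc: "ev p y = (\<Sum>\<alpha>\<in>T. c \<alpha> * mnml n \<alpha> y)" for y
  proof -
    let ?m = "\<lambda>\<alpha>. monom (c \<alpha> * mnml n \<alpha> y) (\<Sum>i<n. \<alpha> i)"
    have "lin p y = (\<Sum>\<alpha>\<in>S. ?m \<alpha>)" by (rule lin_monomial_sum[OF S(3)])
    also have "\<dots> = (\<Sum>\<alpha>\<in>S - T. ?m \<alpha>) + (\<Sum>\<alpha>\<in>T. ?m \<alpha>)" by (rule sum.subset_diff[OF T(2) S(1)])
    finally have split: "lin p y = (\<Sum>\<alpha>\<in>S - T. ?m \<alpha>) + (\<Sum>\<alpha>\<in>T. ?m \<alpha>)" .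
    have "(\<Sum>\<alpha>\<in>S - T. ?m \<alpha>) = 0"
    proof (rule poly_eqI)
      fix k
      show "coeff (\<Sum>\<alpha>\<in>S - T. ?m \<alpha>) k = coeff 0 k"
      proof (cases "k \<le> d")
        case True
        then show ?thesis unfolding coeff_sum by (auto intro!: sum.neutral simp: T_def split: if_splits)
      next
        case False
        hence "coeff (lin p y) k = 0"
          using degree_lin_le_tdeg[of p y] assms(2) by (intro coeff_eq_0) linarith
        moreover have "coeff (\<Sum>\<alpha>\<in>T. ?m \<alpha>) k = 0"
          unfolding coeff_sum using False by (auto intro!: sum.neutral simp: T_def)
        ultimately show ?thesis unfolding split by simp
      qed
    qed
    hence "lin p y = (\<Sum>\<alpha>\<in>T. ?m \<alpha>)" using split by simp
    hence "poly (lin p y) 1 = (\<Sum>\<alpha>\<in>T. c \<alpha> * mnml n \<alpha> y)"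
      by (simp only: poly_sum) (simp add: poly_monom)
    thus ?thesis by simp
  qed
  define b where "b = (\<lambda>\<alpha>. if \<alpha> \<in> T then c \<alpha> else 0)"
  have b: "{\<alpha>. b \<alpha> \<noteq> 0} \<subseteq> T" by (auto simp: b_def)
  have "ev p x = (\<Sum>\<alpha>\<in>{\<alpha>. b \<alpha> \<noteq> 0}. b \<alpha> * (\<Prod>i<n. x i ^ \<alpha> i))" for x
  proof -
    have "ev p x = (\<Sum>\<alpha>\<in>T. b \<alpha> * (\<Prod>i<n. x i ^ \<alpha> i))"
      unfolding trunc mnml_def by (intro sum.cong) (auto simp: b_def)
    also have "\<dots> = (\<Sum>\<alpha>\<in>{\<alpha>. b \<alpha> \<noteq> 0}. b \<alpha> * (\<Prod>i<n. x i ^ \<alpha> i))"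
      using b T(1) by (intro sum.mono_neutral_right) auto
    finally show ?thesis .
  qed
  moreover have "finite {\<alpha>. b \<alpha> \<noteq> 0}" using b T(1) finite_subset by blast
  moreover have "(\<forall>i\<ge>n. \<alpha> i = 0) \<and> (\<Sum>i<n. \<alpha> i) \<le> d" if "b \<alpha> \<noteq> 0" for \<alpha>
    using that b S(2) T(2) by (auto simp: T_def)
  ultimately show ?thesis unfolding poly_deg_le_def by (intro exI[of _ b]) blast
qed

section \<open>Rearrangements and permutations of the sites\<close>

lemma nxt_less: "i < n \<Longrightarrow> nxt n i < n"
  by (auto simp: nxt_def)

lemma nxt_Suc: "Suc i < n \<Longrightarrow> nxt n i = Suc i"
  by (simp add: nxt_def)

lemma swp_transpose: "swp n i = transpose i (nxt n i)"
  by (auto simp: swp_def transpose_def)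

lemma swp_permutes: "i < n \<Longrightarrow> swp n i permutes {..<n}"
  unfolding swp_transpose by (rule permutes_swap_id) (auto simp: nxt_less)

lemma swp_swp [simp]: "swp n i (swp n i j) = j"
  by (simp add: swp_transpose)

lemma swp_comp_swp [simp]: "swp n i \<circ> swp n i = id"
  by auto

lemma swp_simps [simp]: "swp n i i = nxt n i" "swp n i (nxt n i) = i"
  by (auto simp: swp_def)

lemma swp_less: "i < n \<Longrightarrow> j < n \<Longrightarrow> swp n i j < n"
  by (auto simp: swp_def nxt_less)

lemma cyc_inv_permutes: "cyc_inv n permutes {..<n}"
proof (rule bij_imp_permutes)
  have inj: "inj_on (cyc_inv n) {..<n}"
  proof (rule inj_onI)
    fix i j assume "i \<in> {..<n}" "j \<in> {..<n}" "cyc_inv n i = cyc_inv n j"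
    thus "i = j"
      by (cases i; cases j) (auto simp: cyc_inv_def)
  qed
  moreover have "cyc_inv n ` {..<n} \<subseteq> {..<n}" by (auto simp: cyc_inv_def)
  ultimately show "bij_betw (cyc_inv n) {..<n} {..<n}"
    by (simp add: bij_betw_def endo_inj_surj)
qed (auto simp: cyc_inv_def)

lemma swap_list_permute: "length mu = n \<Longrightarrow> swap_list n i mu = permute_list (swp n i) mu"
  by (simp add: swap_list_def permute_list_def)

lemma cyc_list_permute: "length mu = n \<Longrightarrow> cyc_list n mu = permute_list (cyc_inv n) mu"
  by (simp add: cyc_list_def permute_list_def)

lemma swap_list_nth: "j < n \<Longrightarrow> swap_list n i mu ! j = mu ! swp n i j"
  by (simp add: swap_list_def)

lemma cyc_list_nth: "j < n \<Longrightarrow> cyc_list n mu ! j = mu ! cyc_inv n j"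
  by (simp add: cyc_list_def)

lemma swap_list_swap_list:
  assumes "i < n" "length mu = n"
  shows "swap_list n i (swap_list n i mu) = mu"
  by (rule nth_equalityI)
    (use assms swp_less in \<open>auto simp: swap_list_def\<close>)

lemma rearr_length: "mu \<in> rearr lam \<Longrightarrow> length mu = length lam"
  unfolding rearr_def using mset_eq_length by auto

lemma rearr_swap: "mu \<in> rearr lam \<Longrightarrow> length lam = n \<Longrightarrow> i < n \<Longrightarrow> swap_list n i mu \<in> rearr lam"
  using rearr_length[of mu lam] swp_permutes[of i n]
  by (simp add: rearr_def swap_list_permute mset_permute_list)

lemma rearr_cyc: "mu \<in> rearr lam \<Longrightarrow> length lam = n \<Longrightarrow> cyc_list n mu \<in> rearr lam"
  using rearr_length[of mu lam] cyc_inv_permutes[of n]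
  by (simp add: rearr_def cyc_list_permute mset_permute_list)

lemma finite_rearr: "finite (rearr lam)"
  unfolding rearr_def by (rule mset_eq_finite)

lemma rearr_nth_set: "mu \<in> rearr lam \<Longrightarrow> i < length lam \<Longrightarrow> mu ! i \<in> set lam"
  using nth_mem[of i mu] rearr_length[of mu lam] mset_eq_setD[of mu lam] by (auto simp: rearr_def)

lemma cyc_list_inj:
  assumes "length mu = n" "length nu = n" "cyc_list n mu = cyc_list n nu"
  shows "mu = nu"
proof (rule nth_equalityI)
  fix j assume "j < length mu"
  then obtain k where "k < n" "j = cyc_inv n k"
    using permutes_image[OF cyc_inv_permutes[of n]] assms(1) by auto
  thus "mu ! j = nu ! j" using cyc_list_nth[of k n mu] cyc_list_nth[of k n nu] assms(3) by simp
qed (use assms in simp)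

lemma rearr_cyc_bij:
  assumes "length lam = n"
  shows "bij_betw (cyc_list n) (rearr lam) (rearr lam)"
proof -
  have "inj_on (cyc_list n) (rearr lam)"
    by (rule inj_onI) (rule cyc_list_inj[of _ n], simp_all add: rearr_length assms)
  moreover have "cyc_list n ` rearr lam \<subseteq> rearr lam" using rearr_cyc[OF _ assms] by auto
  ultimately show ?thesis by (simp add: bij_betw_def endo_inj_surj finite_rearr)
qed

lemma rearr_swap_bij:
  assumes "length lam = n" "i < n"
  shows "bij_betw (swap_list n i) (rearr lam) (rearr lam)"
  by (rule bij_betw_byWitness[of _ "swap_list n i"])
    (use assms rearr_swap swap_list_swap_list rearr_length in auto)

text \<open>The swap stands on the right because the exchange relation relates \<open>v\<close> to
  \<open>v \<circ> swp n i\<close>. A distant transposition is reached by conjugation: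
  \<open>(a, b+1)\<close> is \<open>(a, b)\<close> conjugated by \<open>(b, b+1)\<close>.\<close>

lemma permutes_adjacent_induct [consumes 1, case_names id swp]:
  assumes w: "w permutes {..<n}" and "P id"
    and step: "\<And>v i. v permutes {..<n} \<Longrightarrow> P v \<Longrightarrow> Suc i < n \<Longrightarrow> P (v \<circ> swp n i)"
  shows "P w"
proof -
  have tr: "P (v \<circ> transpose a b)" if "v permutes {..<n}" "P v" "a < b" "b < n" for v a b
    using that(3,4,1,2)
  proof (induction b arbitrary: v)
    case (Suc b)
    have s: "transpose b (Suc b) = swp n b" using Suc.prems by (simp add: swp_transpose nxt_Suc)
    show ?case
    proof (cases "a = b")
      case True
      then show ?thesis using step[of v b] Suc.prems unfolding s[symmetric] by blast
    next
      case False
      have bn: "Suc b < n" "a < b" using Suc.prems False by auto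
      let ?u = "v \<circ> swp n b" and ?u' = "v \<circ> swp n b \<circ> transpose a b"
      have p1: "?u permutes {..<n}"
        by (rule permutes_compose[OF swp_permutes]) (use bn Suc.prems in auto)
      have p2: "?u' permutes {..<n}"
        by (rule permutes_compose[OF permutes_swap_id p1]) (use bn in auto)
      have Pu: "P ?u" using step Suc.prems bn by blast
      have "P ?u'" by (rule Suc.IH[OF bn(2) _ p1 Pu]) (use bn in auto)
      hence "P (?u' \<circ> swp n b)" using step[OF p2] bn by blast
      moreover have "?u' \<circ> swp n b = v \<circ> transpose a (Suc b)"
        unfolding s[symmetric] using bn by (auto simp: fun_eq_iff transpose_def)
      ultimately show ?thesis by metis
    qed
  qed simp
  show ?thesis
    using finite_lessThan w
  proof (induction rule: permutes_rev_induct)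
    case (swap a b p)
    consider "a < b" | "b < a" using swap by linarith
    thus ?case
    proof cases
      case 1
      show ?thesis by (rule tr) (use 1 swap in auto)
    next
      case 2
      have "P (p \<circ> transpose b a)" by (rule tr) (use 2 swap in auto)
      thus ?thesis by (subst transpose_commute)
    qed
  qed fact
qed

section \<open>Carrying one variable around the ring\<close>

text \<open>One exchange across edge \<open>i\<close>: a word with a descent there sends weight
  \<open>al\<close> to its swapped word and keeps \<open>ga - al\<close>, all other words keep
  \<open>ga\<close>. The ring is left open, since Cramer's rule uses this over polynomials and the
  sign argument over the reals.\<close>

definition stp :: "nat \<Rightarrow> nat \<Rightarrow> (nat \<Rightarrow> 'a) \<Rightarrow> 'a::comm_ring_1 \<Rightarrow> (nat list \<Rightarrow> 'a) \<Rightarrow> nat list \<Rightarrow> 'a" where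
  "stp n i al ga v nu =
     (if nu ! i < nu ! nxt n i then ga * v nu + al (nu ! nxt n i) * v (swap_list n i nu)
      else if nu ! nxt n i < nu ! i then (ga - al (nu ! i)) * v nu
      else ga * v nu)"

primrec walk :: "nat \<Rightarrow> (nat \<Rightarrow> nat \<Rightarrow> 'a) \<Rightarrow> (nat \<Rightarrow> 'a::comm_ring_1) \<Rightarrow> nat \<Rightarrow> (nat list \<Rightarrow> 'a) \<Rightarrow> nat list \<Rightarrow> 'a" where
  "walk n al ga 0 v = v"
| "walk n al ga (Suc k) v = stp n k (al k) (ga k) (walk n al ga k v)"

lemma walk_add: "walk n al ga k (\<lambda>nu. v nu + w nu) nu = walk n al ga k v nu + walk n al ga k w nu"
  by (induction k arbitrary: nu) (auto simp: stp_def algebra_simps)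

lemma walk_cmult: "walk n al ga k (\<lambda>nu. c * v nu) nu = c * walk n al ga k v nu"
  by (induction k arbitrary: nu) (auto simp: stp_def algebra_simps)

lemma walk_zero: "walk n al ga k (\<lambda>nu. 0) nu = 0"
  by (induction k arbitrary: nu) (auto simp: stp_def)

lemma walk_sum: "walk n al ga k (\<lambda>nu. \<Sum>\<kappa>\<in>S. v \<kappa> nu) nu = (\<Sum>\<kappa>\<in>S. walk n al ga k (v \<kappa>) nu)"
  by (induction S rule: infinite_finite_induct) (simp_all add: walk_zero walk_add)

lemma ev_walk:
  "ev (walk n al ga k v nu) x =
     walk n (\<lambda>i l. ev (al i l) x) (\<lambda>i. ev (ga i) x) k (\<lambda>nu. ev (v nu) x) nu"
  by (induction k arbitrary: nu) (auto simp: stp_def)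

context
  fixes n :: nat and lam :: "nat list"
  assumes len: "length lam = n" and n2: "2 \<le> n"
begin

lemma walk_cong:
  assumes "\<And>nu. nu \<in> rearr lam \<Longrightarrow> v nu = w nu" "k < n" "nu \<in> rearr lam"
  shows "walk n al ga k v nu = walk n al ga k w nu"
  using assms(2,3)
proof (induction k arbitrary: nu)
  case (Suc k)
  have "swap_list n k nu \<in> rearr lam" using rearr_swap[OF Suc.prems(2) len] Suc.prems by simp
  thus ?case using Suc.IH Suc.prems unfolding walk.simps stp_def by simp
qed (use assms in simp)

text \<open>The values on indicator functions are the matrix entries of the walk; in this form it
  enters the linear system for Cramer's rule.\<close>

lemma walk_expand:
  assumes "k < n" "nu \<in> rearr lam"
  shows "walk n al ga k v nu =
    (\<Sum>\<kappa>\<in>rearr lam. v \<kappa> * walk n al ga k (\<lambda>nu. if nu = \<kappa> then 1 else 0) nu)"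
proof -
  have "walk n al ga k v nu =
      walk n al ga k (\<lambda>nu. \<Sum>\<kappa>\<in>rearr lam. v \<kappa> * (if nu = \<kappa> then 1 else 0)) nu"
  proof (rule walk_cong[OF _ assms])
    fix nu assume "nu \<in> rearr lam"
    thus "v nu = (\<Sum>\<kappa>\<in>rearr lam. v \<kappa> * (if nu = \<kappa> then 1 else 0))"
      using finite_rearr[of lam] by (simp add: if_distrib[where f = "\<lambda>x. _ * x"] cong: if_cong)
  qed
  thus ?thesis by (simp add: walk_sum walk_cmult)
qed

text \<open>What a descent loses its swapped word gains, so every column sum is \<open>ga\<close>.
  Besides making the walk stochastic up to scale, this yields the symmetry of the sum of all
  \<open>Psi mu\<close>.\<close>

lemma sum_stp:
  assumes "i < n"
  shows "(\<Sum>nu\<in>rearr lam. stp n i al ga v nu) = ga * (\<Sum>nu\<in>rearr lam. v nu)"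
proof -
  define f where "f = (\<lambda>nu. if nu ! nxt n i < nu ! i then al (nu ! i) * v nu else 0)"
  have "stp n i al ga v nu = ga * v nu + f (swap_list n i nu) - f nu" if "nu \<in> rearr lam" for nu
    using swap_list_swap_list[OF assms, of nu] rearr_length[OF that] len assms nxt_less[OF assms]
    by (auto simp: stp_def f_def swap_list_nth algebra_simps)
  hence "(\<Sum>nu\<in>rearr lam. stp n i al ga v nu)
      = (\<Sum>nu\<in>rearr lam. ga * v nu) + (\<Sum>nu\<in>rearr lam. f (swap_list n i nu)) - (\<Sum>nu\<in>rearr lam. f nu)"
    by (simp add: sum.distrib sum_subtractf)
  also have "(\<Sum>nu\<in>rearr lam. f (swap_list n i nu)) = (\<Sum>nu\<in>rearr lam. f nu)"
    using sum.reindex_bij_betw[OF rearr_swap_bij[OF len assms]] .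
  finally show ?thesis by (simp add: sum_distrib_left)
qed

lemma sum_walk:
  "k < n \<Longrightarrow> (\<Sum>nu\<in>rearr lam. walk n al ga k v nu) = (\<Prod>j<k. ga j) * (\<Sum>nu\<in>rearr lam. v nu)"
  by (induction k) (simp_all add: sum_stp mult_ac)

text \<open>Rotation conjugates the swap at one edge into the swap at the next; information about a
  single edge thereby spreads around the ring.\<close>

lemma cyc_swap_list:
  assumes "i < n" "length mu = n"
  shows "cyc_list n (swap_list n i mu) = swap_list n (nxt n i) (cyc_list n mu)"
proof (rule nth_equalityI)
  fix j assume "j < length (cyc_list n (swap_list n i mu))"
  hence j: "j < n" by (simp add: cyc_list_def)
  have inv: "cyc_inv n (nxt n k) = k" if "k < n" for k
    using that by (cases "Suc k = n") (auto simp: cyc_inv_def nxt_def)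
  have cj: "cyc_inv n j < n" using permutes_in_image[OF cyc_inv_permutes[of n], of j] j by simp
  have "swp n i (cyc_inv n j) = cyc_inv n (swp n (nxt n i) j)"
  proof -
    have inj: "cyc_inv n x = cyc_inv n y \<longleftrightarrow> x = y" for x y
      using permutes_inj[OF cyc_inv_permutes[of n]] by (auto dest: injD)
    have "cyc_inv n j = i \<longleftrightarrow> j = nxt n i" "cyc_inv n j = nxt n i \<longleftrightarrow> j = nxt n (nxt n i)"
      using inv assms(1) nxt_less inj by metis+
    thus ?thesis using inv assms(1) nxt_less[of i n] by (auto simp: swp_def)
  qed
  thus "cyc_list n (swap_list n i mu) ! j = swap_list n (nxt n i) (cyc_list n mu) ! j"
    using j cj swp_less[OF nxt_less[OF assms(1)] j] by (simp add: cyc_list_nth swap_list_nth)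
qed (simp add: cyc_list_def swap_list_def)

text \<open>The weight \<open>\<Sum>j. j * mu ! j\<close> strictly increases when a descent is
  swapped, so a word of maximal weight in \<open>A\<close> has no descent.\<close>

lemma rearr_descent_closed_sorted:
  assumes "A \<subseteq> rearr lam" "A \<noteq> {}" "sorted lam"
    and closed: "\<And>mu i. mu \<in> A \<Longrightarrow> Suc i < n \<Longrightarrow> mu ! Suc i < mu ! i \<Longrightarrow> swap_list n i mu \<in> A"
  shows "lam \<in> A"
proof -
  define W where "W = (\<lambda>mu :: nat list. \<Sum>j<n. j * mu ! j)"
  have "finite A" using assms(1) finite_rearr finite_subset by blast
  then obtain mu where mu: "mu \<in> A" "\<And>nu. nu \<in> A \<Longrightarrow> W nu \<le> W mu"
    using Max_in[of "W ` A"] Max_ge[of "W ` A"] assms(2) by fastforce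
  have lmu: "length mu = n" using mu assms(1) rearr_length len by auto
  have "mu ! i \<le> mu ! Suc i" if i: "Suc i < n" for i
  proof (rule ccontr)
    assume "\<not> ?thesis"
    hence d: "mu ! Suc i < mu ! i" by simp
    have nx: "nxt n i = Suc i" using i nxt_Suc by blast
    let ?s = "swp n i"
    have "W (swap_list n i mu) = (\<Sum>j<n. j * mu ! ?s j)"
      unfolding W_def by (intro sum.cong) (auto simp: swap_list_nth)
    also have "\<dots> = (\<Sum>j<n. ?s j * mu ! j)"
      using sum.reindex_bij_betw[OF permutes_imp_bij[OF swp_permutes[of i n]], of "\<lambda>j. ?s j * mu ! j"] i
      by simp
    also have "\<dots> = Suc i * mu ! i + (i * mu ! Suc i + (\<Sum>j\<in>{..<n} - {i} - {Suc i}. ?s j * mu ! j))"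
      using i nx by (subst sum.remove[of _ i], simp, simp, subst sum.remove[of _ "Suc i"])
        (auto simp: swp_def)
    also have "(\<Sum>j\<in>{..<n} - {i} - {Suc i}. ?s j * mu ! j) = (\<Sum>j\<in>{..<n} - {i} - {Suc i}. j * mu ! j)"
      by (intro sum.cong) (auto simp: swp_def nx)
    finally have 1: "W (swap_list n i mu) =
        Suc i * mu ! i + (i * mu ! Suc i + (\<Sum>j\<in>{..<n} - {i} - {Suc i}. j * mu ! j))" .
    have "W mu = i * mu ! i + (Suc i * mu ! Suc i + (\<Sum>j\<in>{..<n} - {i} - {Suc i}. j * mu ! j))"
      unfolding W_def using i
      by (subst sum.remove[of _ i], simp, simp, subst sum.remove[of _ "Suc i"]) auto
    hence "W mu < W (swap_list n i mu)" using 1 d by simp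
    thus False using mu(2)[OF closed[OF mu(1) i d]] by simp
  qed
  hence "sorted mu" by (simp add: sorted_iff_nth_Suc lmu)
  moreover have "mset mu = mset lam" using mu assms(1) by (auto simp: rearr_def)
  ultimately have "mu = lam" using assms(3) properties_for_sort by metis
  thus ?thesis using mu by simp
qed

section \<open>Perron-Frobenius argument for the walk with nonnegative coefficients\<close>

context
  fixes al :: "nat \<Rightarrow> nat \<Rightarrow> real" and ga :: "nat \<Rightarrow> real"
  assumes srt: "sorted lam"
    and ga: "\<And>k. Suc k < n \<Longrightarrow> 0 < ga k"
    and al: "\<And>k l. Suc k < n \<Longrightarrow> l \<in> set lam \<Longrightarrow> 0 \<le> al k l \<and> al k l < ga k"
    and move: "n = 2 \<or> (\<exists>k. Suc k < n \<and> (\<forall>l\<in>set lam. 0 < al k l))"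
begin

text \<open>Divided by the product of the \<open>ga\<close>, the walk is a column-stochastic matrix;
  its fixed vectors are meant here, up to the relabelling by \<open>cyc_list\<close>. There are
  \<open>n - 1\<close> steps because the carried variable passes all the others.\<close>

definition fixed :: "(nat list \<Rightarrow> real) \<Rightarrow> bool" where
  "fixed v \<longleftrightarrow> (\<forall>mu\<in>rearr lam. (\<Prod>k<n - 1. ga k) * v (cyc_list n mu) = walk n al ga (n - 1) v mu)"

lemma nth_in_set: "nu \<in> rearr lam \<Longrightarrow> i < n \<Longrightarrow> nu ! i \<in> set lam"
  using rearr_nth_set len by blast

lemma abs_walk_le:
  "k < n \<Longrightarrow> nu \<in> rearr lam \<Longrightarrow> \<bar>walk n al ga k v nu\<bar> \<le> walk n al ga k (\<lambda>nu. \<bar>v nu\<bar>) nu"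
proof (induction k arbitrary: nu)
  case (Suc k)
  have k: "k < n" "Suc k < n" using Suc.prems by auto
  have IH: "\<bar>walk n al ga k v mu\<bar> \<le> walk n al ga k (\<lambda>nu. \<bar>v nu\<bar>) mu" if "mu \<in> rearr lam" for mu
    using Suc.IH k that by blast
  have s: "swap_list n k nu \<in> rearr lam" using rearr_swap[OF Suc.prems(2) len k(1)] .
  have l: "nu ! k \<in> set lam" "nu ! nxt n k \<in> set lam"
    using nth_in_set[OF Suc.prems(2)] k nxt_less by auto
  have "\<bar>stp n k (al k) (ga k) f nu\<bar> \<le> stp n k (al k) (ga k) g nu"
    if "\<bar>f nu\<bar> \<le> g nu" "\<bar>f (swap_list n k nu)\<bar> \<le> g (swap_list n k nu)" for f g :: "nat list \<Rightarrow> real"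
  proof -
    have m: "\<bar>c * x\<bar> \<le> c * y" if "0 \<le> c" "\<bar>x\<bar> \<le> y" for c x y :: real
      using that by (simp add: abs_mult mult_left_mono)
    have "\<bar>ga k * f nu\<bar> \<le> ga k * g nu" using m ga[OF k(2)] that by simp
    moreover have "\<bar>al k (nu ! nxt n k) * f (swap_list n k nu)\<bar> \<le> al k (nu ! nxt n k) * g (swap_list n k nu)"
      using m al[OF k(2) l(2)] that by simp
    moreover have "\<bar>(ga k - al k (nu ! k)) * f nu\<bar> \<le> (ga k - al k (nu ! k)) * g nu"
      using m al[OF k(2) l(1)] that by simp
    ultimately show ?thesis unfolding stp_def by auto
  qed
  thus ?case using IH[OF Suc.prems(2)] IH[OF s] by simp
qed simp

text \<open>The triangle inequality gives one direction at every state. Both sides have the same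
  total because the column sums are constant, hence equality holds everywhere.\<close>

lemma fixed_abs:
  assumes "fixed v"
  shows "fixed (\<lambda>nu. \<bar>v nu\<bar>)"
proof -
  let ?D = "\<Prod>k<n - 1. ga k" and ?f = "\<lambda>mu. (\<Prod>k<n - 1. ga k) * \<bar>v (cyc_list n mu)\<bar>"
  let ?g = "walk n al ga (n - 1) (\<lambda>nu. \<bar>v nu\<bar>)"
  have D: "0 < ?D" by (rule prod_pos) (use ga n2 in auto)
  have "sum ?f (rearr lam) = ?D * (\<Sum>nu\<in>rearr lam. \<bar>v nu\<bar>)"
    using sum.reindex_bij_betw[OF rearr_cyc_bij[OF len], of "\<lambda>nu. \<bar>v nu\<bar>"] by (simp add: sum_distrib_left[symmetric])
  also have "\<dots> = sum ?g (rearr lam)" using n2 by (subst sum_walk) auto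
  finally have "sum ?f (rearr lam) = sum ?g (rearr lam)" .
  moreover have "?f mu \<le> ?g mu" if "mu \<in> rearr lam" for mu
  proof -
    have "?f mu = \<bar>?D * v (cyc_list n mu)\<bar>" using D by (simp add: abs_mult)
    also have "\<dots> = \<bar>walk n al ga (n - 1) v mu\<bar>" using assms that unfolding fixed_def by simp
    also have "\<dots> \<le> ?g mu" using abs_walk_le n2 that by simp
    finally show ?thesis .
  qed
  ultimately have "?f mu = ?g mu" if "mu \<in> rearr lam" for mu
    using sum_mono_inv[of ?f "rearr lam" ?g mu] that finite_rearr by blast
  thus ?thesis unfolding fixed_def by blast
qed

lemma fixed_add: "fixed v \<Longrightarrow> fixed w \<Longrightarrow> fixed (\<lambda>nu. v nu + w nu)"
  unfolding fixed_def by (simp add: walk_add distrib_left)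

lemma fixed_cmult: "fixed v \<Longrightarrow> fixed (\<lambda>nu. c * v nu)"
  unfolding fixed_def by (simp add: walk_cmult mult.left_commute)

lemma stp_pos:
  assumes "\<And>nu. nu \<in> rearr lam \<Longrightarrow> 0 \<le> v nu" "Suc k < n" "nu \<in> rearr lam"
  shows "0 \<le> stp n k (al k) (ga k) v nu" "0 < v nu \<Longrightarrow> 0 < stp n k (al k) (ga k) v nu"
proof -
  have s: "swap_list n k nu \<in> rearr lam" using rearr_swap[OF assms(3) len] assms(2) by simp
  have l: "nu ! k \<in> set lam" "nu ! nxt n k \<in> set lam"
    using nth_in_set[OF assms(3)] assms(2) nxt_less by auto
  show "0 \<le> stp n k (al k) (ga k) v nu"
    using assms(1)[OF s] assms(1)[OF assms(3)] ga[OF assms(2)] al[OF assms(2) l(1)] al[OF assms(2) l(2)]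
    by (auto simp: stp_def)
  show "0 < stp n k (al k) (ga k) v nu" if "0 < v nu"
    using assms(1)[OF s] that ga[OF assms(2)] al[OF assms(2) l(1)] al[OF assms(2) l(2)]
    by (auto simp: stp_def intro!: add_pos_nonneg)
qed

lemma walk_nonneg:
  assumes "\<And>nu. nu \<in> rearr lam \<Longrightarrow> 0 \<le> v nu"
  shows "k < n \<Longrightarrow> nu \<in> rearr lam \<Longrightarrow> 0 \<le> walk n al ga k v nu"
  by (induction k arbitrary: nu) (use assms in \<open>auto intro: stp_pos\<close>)

text \<open>All diagonal coefficients are positive by \<open>al < ga\<close>, so weight once present
  at a state never disappears completely.\<close>

lemma walk_pos:
  assumes "\<And>nu. nu \<in> rearr lam \<Longrightarrow> 0 \<le> v nu" "nu \<in> rearr lam" "j \<le> k" "k < n"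
    and "0 < walk n al ga j v nu"
  shows "0 < walk n al ga k v nu"
  using assms(3,4)
proof (induction k rule: dec_induct)
  case (step k)
  then show ?case using stp_pos(2)[of "walk n al ga k v" k nu] walk_nonneg[OF assms(1)] assms(2) by simp
qed (use assms in simp)

text \<open>The support \<open>A\<close> turns out to be closed under rotation and under swapping
  any descent, hence it contains the sorted word. Thus \<open>lam\<close> lies in every support,
  which replaces a discussion of recurrent classes.\<close>

lemma fixed_pos_sorted:
  assumes "fixed v" and nn: "\<And>nu. nu \<in> rearr lam \<Longrightarrow> 0 \<le> v nu" and "mu \<in> rearr lam" "0 < v mu"
  shows "0 < v lam"
proof -
  define A where "A = {nu\<in>rearr lam. 0 < v nu}"
  have D: "0 < (\<Prod>k<n - 1. ga k)" by (rule prod_pos) (use ga n2 in auto)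
  have cyc: "cyc_list n nu \<in> A" if nu: "nu \<in> rearr lam" "0 < walk n al ga (n - 1) v nu" for nu
  proof -
    have "0 < (\<Prod>k<n - 1. ga k) * v (cyc_list n nu)" using assms(1) nu unfolding fixed_def by simp
    thus ?thesis using D rearr_cyc[OF nu(1) len] by (simp add: A_def zero_less_mult_iff)
  qed
  have cycA: "cyc_list n nu \<in> A" if "nu \<in> A" for nu
  proof (rule cyc)
    show "0 < walk n al ga (n - 1) v nu"
      by (rule walk_pos[OF nn, where j = 0]) (use that n2 in \<open>auto simp: A_def\<close>)
  qed (use that in \<open>auto simp: A_def\<close>)
  have fin: "finite A" unfolding A_def using finite_rearr[of lam] by simp
  have inj: "inj_on (cyc_list n) A"
    using rearr_cyc_bij[OF len] unfolding A_def bij_betw_def by (auto intro: inj_on_subset)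
  \<comment> \<open>An injective self-map of a finite set is onto, so membership in \<open>A\<close>
    can also be pulled back along a rotation.\<close>
  have surj: "cyc_list n ` A = A" by (rule endo_inj_surj[OF fin _ inj]) (use cycA in auto)
  have cyc_iff: "nu \<in> A" if "cyc_list n nu \<in> A" "nu \<in> rearr lam" for nu
  proof -
    have "cyc_list n nu \<in> cyc_list n ` A" using that(1) surj by simp
    then obtain nu' where nu': "nu' \<in> A" "cyc_list n nu = cyc_list n nu'" by (elim imageE)
    moreover have "nu' \<in> rearr lam" using nu' by (simp add: A_def)
    ultimately have "nu = nu'"
      using cyc_list_inj[of nu n nu'] rearr_length[of nu lam] rearr_length[of nu' lam] that len by simp
    thus ?thesis using nu' by simp
  qed
  define cl where "cl = (\<lambda>i. \<forall>nu\<in>A. nu ! nxt n i < nu ! i \<longrightarrow> swap_list n i nu \<in> A)"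
  have cl_nxt: "cl (nxt n i)" if i: "i < n" "cl i" for i
    unfolding cl_def
  proof (intro ballI impI)
    fix nu assume nu: "nu \<in> A" "nu ! nxt n (nxt n i) < nu ! nxt n i"
    then obtain nu' where nu': "nu' \<in> A" "nu = cyc_list n nu'" using surj by blast
    have l': "length nu' = n" using nu' rearr_length[of nu' lam] len by (simp add: A_def)
    have inv: "cyc_inv n (nxt n k) = k" if "k < n" for k
      using that by (cases "Suc k = n") (auto simp: cyc_inv_def nxt_def)
    have "nu' ! nxt n i < nu' ! i"
      using nu(2) i nxt_less[of i n] nxt_less[of "nxt n i" n] unfolding nu'(2) by (simp add: cyc_list_nth inv)
    hence "swap_list n i nu' \<in> A" using i nu' unfolding cl_def by blast
    hence "cyc_list n (swap_list n i nu') \<in> A" by (rule cycA)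
    thus "swap_list n (nxt n i) nu \<in> A" using cyc_swap_list[OF i(1) l'] nu' by simp
  qed
  have cl_any: "cl i" if "i < n" for i
  proof (cases "n = 2")
    case True
    \<comment> \<open>On two sites the swap is the rotation, so closure follows even if all
      \<open>al\<close> vanish.\<close>
    have "swap_list n i nu = cyc_list n nu" if "nu \<in> A" for nu
    proof (rule nth_equalityI)
      fix j assume "j < length (swap_list n i nu)"
      hence "j < n" by (simp add: swap_list_def)
      moreover have "swp n i j = cyc_inv n j"
        using True \<open>i < n\<close> \<open>j < n\<close> by (auto simp: swp_def cyc_inv_def nxt_def less_2_cases_iff)
      ultimately show "swap_list n i nu ! j = cyc_list n nu ! j"
        by (simp add: swap_list_nth cyc_list_nth)
    qed (simp add: swap_list_def cyc_list_def)
    thus ?thesis unfolding cl_def using cycA by simp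
  next
    case False
    then obtain k where k: "Suc k < n" "\<And>l. l \<in> set lam \<Longrightarrow> 0 < al k l" using move by blast
    have kn: "k < n" using k by simp
    \<comment> \<open>At step \<open>k\<close> a positive amount passes from the descent
      \<open>nu\<close> to its swapped word and survives the remaining steps. The rotated swapped
      word then lies in \<open>A\<close>, and the rotation is undone by
      \<open>cyc_iff\<close>.\<close>
    have base: "cl k" unfolding cl_def
    proof (intro ballI impI)
      fix nu assume nu: "nu \<in> A" "nu ! nxt n k < nu ! k"
      hence nur: "nu \<in> rearr lam" "0 < v nu" by (auto simp: A_def)
      define nu' where "nu' = swap_list n k nu"
      have nu': "nu' \<in> rearr lam" unfolding nu'_def using rearr_swap[OF nur(1) len kn] .
      have bk: "swap_list n k nu' = nu" unfolding nu'_def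
        using swap_list_swap_list[OF kn] rearr_length[OF nur(1)] len by simp
      have vals: "nu' ! k = nu ! nxt n k" "nu' ! nxt n k = nu ! k"
        unfolding nu'_def using kn nxt_less by (simp_all add: swap_list_nth)
      have w: "0 < walk n al ga k v nu"
        by (rule walk_pos[OF nn, where j = 0]) (use nur kn in auto)
      have "0 < al k (nu ! k) * walk n al ga k v nu" using w k(2) nth_in_set[OF nur(1) kn] by simp
      moreover have "0 \<le> ga k * walk n al ga k v nu'"
        using walk_nonneg[OF nn kn nu'] ga[OF k(1)] by simp
      ultimately have wk: "0 < walk n al ga (Suc k) v nu'"
        using nu(2) vals bk by (simp add: stp_def)
      have "0 < walk n al ga (n - 1) v nu'"
        by (rule walk_pos[OF nn nu' _ _ wk]) (use k(1) in auto)
      hence "cyc_list n nu' \<in> A" using cyc nu' by blast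
      thus "swap_list n k nu \<in> A" using cyc_iff nu' unfolding nu'_def by blast
    qed
    have "cl ((k + m) mod n)" for m
    proof (induction m)
      case (Suc m)
      have "(k + m) mod n < n" using kn by simp
      moreover have "nxt n ((k + m) mod n) = (k + Suc m) mod n" by (simp add: nxt_def mod_Suc_eq)
      ultimately show ?case using cl_nxt[OF _ Suc] by simp
    qed (use base kn in simp)
    \<comment> \<open>The witness is chosen so that \<open>k + (n - k + i)\<close> is
      \<open>i\<close> modulo \<open>n\<close>.\<close>
    from this[of "n - k + i"] show ?thesis using that kn by simp
  qed
  have "lam \<in> A"
  proof (rule rearr_descent_closed_sorted)
    show "A \<noteq> {}" using assms by (auto simp: A_def)
    show "swap_list n i nu \<in> A" if "nu \<in> A" "Suc i < n" "nu ! Suc i < nu ! i" for nu i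
      using cl_any[of i] that nxt_Suc[of i n] unfolding cl_def by simp
  qed (use srt in \<open>auto simp: A_def\<close>)
  thus ?thesis by (simp add: A_def)
qed

text \<open>If both signs occurred, \<open>|v| + v\<close> and \<open>|v| - v\<close> would be
  nonzero nonnegative fixed vectors and hence both positive at \<open>lam\<close>; but at every
  state one of them is 0.\<close>

lemma fixed_sign:
  assumes "fixed v"
  shows "(\<forall>mu\<in>rearr lam. 0 \<le> v mu) \<or> (\<forall>mu\<in>rearr lam. v mu \<le> 0)"
proof (rule ccontr)
  assume "\<not> ?thesis"
  then obtain mu nu where mu: "mu \<in> rearr lam" "v mu < 0" and nu: "nu \<in> rearr lam" "0 < v nu"
    by (auto simp: not_le)
  have "fixed (\<lambda>x. \<bar>v x\<bar> + v x)" "fixed (\<lambda>x. \<bar>v x\<bar> + (-1) * v x)"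
    using fixed_add[OF fixed_abs[OF assms] assms] fixed_add[OF fixed_abs[OF assms] fixed_cmult[OF assms]]
    by blast+
  hence "0 < \<bar>v lam\<bar> + v lam" "0 < \<bar>v lam\<bar> + (-1) * v lam"
    using fixed_pos_sorted[of "\<lambda>x. \<bar>v x\<bar> + v x" nu] fixed_pos_sorted[of "\<lambda>x. \<bar>v x\<bar> + (-1) * v x" mu] mu nu
    by auto
  thus False by linarith
qed

lemma fixed_sum_zero:
  assumes "fixed v" "(\<Sum>mu\<in>rearr lam. v mu) = 0" "mu \<in> rearr lam"
  shows "v mu = 0"
  using fixed_sign[OF assms(1)]
proof
  assume "\<forall>mu\<in>rearr lam. 0 \<le> v mu"
  thus ?thesis using sum_nonneg_eq_0_iff[OF finite_rearr[of lam], of v] assms by auto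
next
  assume "\<forall>mu\<in>rearr lam. v mu \<le> 0"
  thus ?thesis using sum_nonneg_eq_0_iff[OF finite_rearr[of lam], of "\<lambda>x. - v x"] assms
    by (auto simp: sum_negf)
qed

end

end

section \<open>The normalisation has no zeros\<close>

text \<open>Cramer's rule in the local ring at \<open>x\<close>; the factor \<open>d\<close> is the determinant.\<close>

lemma cramer_dvd:
  fixes M :: "'s \<Rightarrow> 's \<Rightarrow> mpol" and f :: "'s \<Rightarrow> mpol"
  assumes fin: "finite S" and sys: "\<And>s. s \<in> S \<Longrightarrow> (\<Sum>t\<in>S. M s t * f t) = P"
    and inj: "\<And>v t. (\<And>s. s \<in> S \<Longrightarrow> (\<Sum>t\<in>S. ev (M s t) x * v t) = 0) \<Longrightarrow> t \<in> S \<Longrightarrow> v t = 0"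
  shows "\<exists>d. ev d x \<noteq> 0 \<and> (\<forall>t\<in>S. P dvd d * f t)"
proof -
  define N where "N = card S"
  obtain e where e: "bij_betw e {0..<N} S"
    using ex_bij_betw_nat_finite[OF fin] unfolding N_def by blast
  have eS: "e i \<in> S" if "i < N" for i using bij_betwE[OF e] that by simp
  have re: "(\<Sum>j = 0..<N. g (e j)) = (\<Sum>t\<in>S. g t)" for g :: "'s \<Rightarrow> 'c::comm_monoid_add"
    by (rule sum.reindex_bij_betw[OF e])
  define A where "A = mat N N (\<lambda>(i, j). M (e i) (e j))"
  have A: "A \<in> carrier_mat N N" by (simp add: A_def)
  define b where "b = vec N (\<lambda>j. f (e j))"
  have b: "b \<in> carrier_vec N" by (simp add: b_def)
  have Ab: "A *\<^sub>v b = vec N (\<lambda>_. P)"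
  proof (rule eq_vecI)
    fix i assume "i < dim_vec (vec N (\<lambda>_. P))"
    hence i: "i < N" by simp
    have "(A *\<^sub>v b) $ i = (\<Sum>j = 0..<N. M (e i) (e j) * f (e j))"
      using i by (simp add: A_def b_def scalar_prod_def)
    also have "\<dots> = P" using re[of "\<lambda>t. M (e i) t * f t"] sys[OF eS[OF i]] by simp
    finally show "(A *\<^sub>v b) $ i = vec N (\<lambda>_. P) $ i" using i by simp
  qed (simp add: A_def)
  have adj: "adj_mat A \<in> carrier_mat N N" "adj_mat A * A = det A \<cdot>\<^sub>m 1\<^sub>m N"
    using adj_mat[OF A] by auto
  have "det A \<cdot>\<^sub>v b = adj_mat A *\<^sub>v vec N (\<lambda>_. P)"
  proof -
    have "adj_mat A *\<^sub>v (A *\<^sub>v b) = (adj_mat A * A) *\<^sub>v b"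
      using assoc_mult_mat_vec[OF adj(1) A b] by simp
    also have "\<dots> = det A \<cdot>\<^sub>v b"
      unfolding adj(2) using b by (intro eq_vecI) (auto simp: row_smult)
    finally show ?thesis using Ab by simp
  qed
  hence dvd: "P dvd det A * f (e j)" if "j < N" for j
  proof -
    have "det A * f (e j) = (det A \<cdot>\<^sub>v b) $ j" using that by (simp add: b_def)
    also have "\<dots> = (\<Sum>k = 0..<N. adj_mat A $$ (j, k) * P)"
      unfolding \<open>det A \<cdot>\<^sub>v b = _\<close> using that adj(1) by (simp add: scalar_prod_def)
    finally show ?thesis by (simp add: dvd_sum)
  qed
  interpret comm_ring_hom "\<lambda>f. ev f x" by (rule ev_hom)
  have "det (map_mat (\<lambda>f. ev f x) A) \<noteq> 0"
  proof
    assume "det (map_mat (\<lambda>f. ev f x) A) = 0"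
    then obtain w where w: "w \<in> carrier_vec N" "w \<noteq> 0\<^sub>v N" "map_mat (\<lambda>f. ev f x) A *\<^sub>v w = 0\<^sub>v N"
      using det_0_iff_vec_prod_zero_field[of "map_mat (\<lambda>f. ev f x) A" N] A by auto
    define v where "v = (\<lambda>t. w $ (inv_into {0..<N} e t))"
    have ve: "v (e j) = w $ j" if "j < N" for j
      using that bij_betw_inv_into_left[OF e, of j] by (simp add: v_def)
    have "(\<Sum>t\<in>S. ev (M s t) x * v t) = 0" if s: "s \<in> S" for s
    proof -
      obtain i where i: "i < N" "s = e i" using s bij_betw_imp_surj_on[OF e] by auto
      have "(\<Sum>t\<in>S. ev (M s t) x * v t) = (\<Sum>j = 0..<N. ev (M s (e j)) x * v (e j))"
        by (rule re[symmetric])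
      also have "\<dots> = (map_mat (\<lambda>f. ev f x) A *\<^sub>v w) $ i"
        using i w(1) by (simp add: A_def scalar_prod_def ve)
      finally show ?thesis using w(3) i by simp
    qed
    hence "v t = 0" if "t \<in> S" for t using inj[of v t] that by blast
    hence "w $ j = 0" if "j < N" for j using ve[OF that] eS[OF that] by metis
    hence "w = 0\<^sub>v N" using w(1) by (intro eq_vecI) auto
    thus False using w(2) by simp
  qed
  hence "ev (det A) x \<noteq> 0" by simp
  moreover have "\<forall>t\<in>S. P dvd det A * f t" using dvd bij_betw_imp_surj_on[OF e] by force
  ultimately show ?thesis by blast
qed

text \<open>The coefficients of the exchange relation for neighbouring variables \<open>u\<close>, \<open>w\<close>,
  multiplied by a common denominator for all species.\<close>

definition gam :: "nat set \<Rightarrow> (nat \<Rightarrow> 'a) \<Rightarrow> 'a \<Rightarrow> 'a \<Rightarrow> 'a::comm_ring_1" where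
  "gam V b u w = u * (\<Prod>l\<in>V. w - b l)"

definition alp :: "nat set \<Rightarrow> (nat \<Rightarrow> 'a) \<Rightarrow> 'a \<Rightarrow> 'a \<Rightarrow> nat \<Rightarrow> 'a::comm_ring_1" where
  "alp V b u w l = b l * (w - u) * (\<Prod>m\<in>V - {l}. w - b m)"

lemma ev_gam [simp]: "ev (gam V (\<lambda>l. C (a l)) u w) x = gam V a (ev u x) (ev w x)"
  by (simp add: gam_def)

lemma ev_alp [simp]: "ev (alp V (\<lambda>l. C (a l)) u w l) x = alp V a (ev u x) (ev w x) l"
  by (simp add: alp_def)

lemma gam_split: "finite V \<Longrightarrow> l \<in> V \<Longrightarrow> gam V b u w = u * (w - b l) * (\<Prod>m\<in>V - {l}. w - b m)"
  unfolding gam_def by (simp add: prod.remove mult.assoc)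

lemma gam_minus_alp:
  "finite V \<Longrightarrow> l \<in> V \<Longrightarrow> gam V b u w - alp V b u w l = w * (u - b l) * (\<Prod>m\<in>V - {l}. w - b m)"
  unfolding gam_split alp_def by (simp add: algebra_simps)

section \<open>The exchange relations as steps of the walk\<close>

locale exchange_family =
  fixes n :: nat and lam :: "nat list" and a :: "nat \<Rightarrow> real"
    and Psi :: "nat list \<Rightarrow> (nat \<Rightarrow> real) \<Rightarrow> real" and psi :: "nat list \<Rightarrow> mpol"
  assumes len: "length lam = n" and n2: "2 \<le> n" and srt: "sorted lam"
    and a01: "\<And>k. 0 < a k \<and> a k < 1"
    and rel: "tasep_rel n a lam Psi"
    and psi: "\<And>mu. mu \<in> rearr lam \<Longrightarrow> ev (psi mu) = Psi mu"
begin

abbreviation "S \<equiv> rearr lam"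
abbreviation "V \<equiv> set lam"

lemma lam_S: "lam \<in> S"
  by (simp add: rearr_def)

lemma nthV: "mu \<in> S \<Longrightarrow> i < n \<Longrightarrow> mu ! i \<in> V"
  using rearr_nth_set len by blast

lemma exchange_ascent:
  assumes "mu \<in> S" "i < n" "mu ! i < mu ! nxt n i"
  shows "y i * (y (nxt n i) - a (mu ! nxt n i)) * Psi mu (y \<circ> swp n i) =
     y i * (y (nxt n i) - a (mu ! nxt n i)) * Psi mu y
     + a (mu ! nxt n i) * (y (nxt n i) - y i) * Psi (swap_list n i mu) y"
proof -
  have "y i * (y (nxt n i) - a (mu ! nxt n i)) * (Psi mu y - Psi mu (y \<circ> swp n i))
      = a (mu ! nxt n i) * (y i - y (nxt n i)) * Psi (swap_list n i mu) y"
    using rel assms unfolding tasep_rel_def by blast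
  thus ?thesis by (simp add: algebra_simps)
qed

lemma exchange_equal:
  assumes "mu \<in> S" "i < n" "mu ! i = mu ! nxt n i"
  shows "Psi mu (y \<circ> swp n i) = Psi mu y"
  using rel assms unfolding tasep_rel_def by blast

text \<open>The ascent relation for the swapped word is read at \<open>y\<close> and at
  \<open>y\<close> with the two variables exchanged. The same difference of values occurs in both
  with opposite signs, and eliminating it links the two values of \<open>Psi mu\<close>. The
  elimination divides by \<open>w - u\<close>, so equal variables are a separate case.\<close>

lemma exchange_descent:
  assumes "mu \<in> S" "i < n" "mu ! nxt n i < mu ! i"
  shows "y i * (y (nxt n i) - a (mu ! i)) * Psi mu (y \<circ> swp n i) = y (nxt n i) * (y i - a (mu ! i)) * Psi mu y"
proof (cases "y i = y (nxt n i)")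
  case True
  hence "y \<circ> swp n i = y" by (auto simp: swp_def fun_eq_iff)
  thus ?thesis using True by simp
next
  case False
  define nu where "nu = swap_list n i mu"
  have nu: "nu \<in> S" unfolding nu_def using rearr_swap[OF assms(1) len assms(2)] .
  have bk: "swap_list n i nu = mu" unfolding nu_def
    using swap_list_swap_list[OF assms(2)] rearr_length[OF assms(1)] len by simp
  have vals: "nu ! i = mu ! nxt n i" "nu ! nxt n i = mu ! i"
    unfolding nu_def using assms(2) nxt_less by (simp_all add: swap_list_nth)
  let ?u = "y i" and ?w = "y (nxt n i)" and ?b = "a (mu ! i)" and ?s = "swp n i"
  have asc: "nu ! i < nu ! nxt n i" using vals assms by simp
  have 1: "?u * (?w - ?b) * (Psi nu y - Psi nu (y \<circ> ?s)) = ?b * (?u - ?w) * Psi mu y"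
    using exchange_ascent[OF nu assms(2) asc, of y] vals bk by (simp add: algebra_simps)
  have "(y \<circ> ?s) \<circ> ?s = y" by (simp add: comp_assoc)
  hence 2: "?w * (?u - ?b) * (Psi nu (y \<circ> ?s) - Psi nu y) = ?b * (?w - ?u) * Psi mu (y \<circ> ?s)"
    using exchange_ascent[OF nu assms(2) asc, of "y \<circ> ?s"] vals bk by (simp add: algebra_simps)
  have "?b * (?w - ?u) * (?u * (?w - ?b) * Psi mu (y \<circ> ?s)) =
      ?u * (?w - ?b) * (?w * (?u - ?b) * (Psi nu (y \<circ> ?s) - Psi nu y))"
    unfolding 2 by (simp add: ac_simps)
  also have "\<dots> = - (?w * (?u - ?b)) * (?u * (?w - ?b) * (Psi nu y - Psi nu (y \<circ> ?s)))"
    by (simp add: algebra_simps)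
  also have "\<dots> = ?b * (?w - ?u) * (?w * (?u - ?b) * Psi mu y)"
    unfolding 1 by (simp add: algebra_simps)
  finally show ?thesis using False a01[of "mu ! i"] by simp
qed

lemma exchange_stp:
  assumes "mu \<in> S" "i < n"
  shows "gam V a (y i) (y (nxt n i)) * Psi mu (y \<circ> swp n i) =
    stp n i (alp V a (y i) (y (nxt n i))) (gam V a (y i) (y (nxt n i))) (\<lambda>nu. Psi nu y) mu"
proof -
  let ?u = "y i" and ?w = "y (nxt n i)"
  let ?E = "\<lambda>l. \<Prod>m\<in>V - {l}. ?w - a m"
  have V: "finite V" "mu ! i \<in> V" "mu ! nxt n i \<in> V" using nthV[OF assms(1)] assms(2) nxt_less by auto
  consider "mu ! i < mu ! nxt n i" | "mu ! nxt n i < mu ! i" | "mu ! i = mu ! nxt n i" by linarith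
  thus ?thesis
  proof cases
    case 1
    have "gam V a ?u ?w * Psi mu (y \<circ> swp n i) =
        ?E (mu ! nxt n i) * (?u * (?w - a (mu ! nxt n i)) * Psi mu (y \<circ> swp n i))"
      unfolding gam_split[OF V(1,3)] by (simp add: ac_simps)
    also have "\<dots> = gam V a ?u ?w * Psi mu y
        + alp V a ?u ?w (mu ! nxt n i) * Psi (swap_list n i mu) y"
      unfolding exchange_ascent[OF assms 1] gam_split[OF V(1,3)] alp_def by (simp add: algebra_simps)
    finally show ?thesis using 1 by (simp add: stp_def)
  next
    case 2
    have "gam V a ?u ?w * Psi mu (y \<circ> swp n i) =
        ?E (mu ! i) * (?u * (?w - a (mu ! i)) * Psi mu (y \<circ> swp n i))"
      unfolding gam_split[OF V(1,2)] by (simp add: ac_simps)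
    also have "\<dots> = (gam V a ?u ?w - alp V a ?u ?w (mu ! i)) * Psi mu y"
      unfolding exchange_descent[OF assms 2] gam_minus_alp[OF V(1,2)] by (simp add: ac_simps)
    finally show ?thesis using 2 by (simp add: stp_def)
  next
    case 3
    then show ?thesis using exchange_equal[OF assms 3] by (simp add: stp_def)
  qed
qed

text \<open>The arrangement of variables after the one from site 0 has been carried past
  \<open>k\<close> neighbours.\<close>

definition mv :: "nat \<Rightarrow> nat \<Rightarrow> nat" where
  "mv k j = (if j < k then Suc j else if j = k then 0 else j)"

lemma walk_Psi:
  "k < n \<Longrightarrow> mu \<in> S \<Longrightarrow>
   walk n (\<lambda>i. alp V a (x 0) (x (Suc i))) (\<lambda>i. gam V a (x 0) (x (Suc i))) k (\<lambda>nu. Psi nu x) mu =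
   (\<Prod>j<k. gam V a (x 0) (x (Suc j))) * Psi mu (x \<circ> mv k)"
proof (induction k arbitrary: mu)
  case 0
  have "mv 0 = id" by (auto simp: mv_def)
  thus ?case by simp
next
  case (Suc k)
  let ?al = "\<lambda>i. alp V a (x 0) (x (Suc i))" and ?ga = "\<lambda>i. gam V a (x 0) (x (Suc i))"
  let ?D = "\<Prod>j<k. ?ga j"
  define y where "y = x \<circ> mv k"
  have k: "k < n" "nxt n k = Suc k" using Suc.prems nxt_Suc by auto
  have y: "y k = x 0" "y (nxt n k) = x (Suc k)" using k by (auto simp: mv_def y_def)
  have mv: "mv k \<circ> swp n k = mv (Suc k)" using k by (auto simp: mv_def swp_def fun_eq_iff)
  have sw: "swap_list n k mu \<in> S" using rearr_swap[OF Suc.prems(2) len k(1)] .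
  have "walk n ?al ?ga (Suc k) (\<lambda>nu. Psi nu x) mu =
      ?D * stp n k (?al k) (?ga k) (\<lambda>nu. Psi nu y) mu"
    using Suc.IH[OF k(1) Suc.prems(2), folded y_def] Suc.IH[OF k(1) sw, folded y_def] by (simp add: stp_def algebra_simps)
  also have "stp n k (?al k) (?ga k) (\<lambda>nu. Psi nu y) mu = ?ga k * Psi mu (y \<circ> swp n k)"
    using exchange_stp[OF Suc.prems(2) k(1), of y] unfolding y by simp
  also have "y \<circ> swp n k = x \<circ> mv (Suc k)" unfolding y_def comp_assoc mv ..
  finally show ?case by (simp add: ac_simps)
qed

lemma cyclic: "mu \<in> S \<Longrightarrow> Psi (cyc_list n mu) (x \<circ> cyc_inv n) = Psi mu x"
  using rel unfolding tasep_rel_def by blast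

text \<open>Once the variable has passed all the others, the arrangement is a rotation of the
  initial one, and cyclic invariance turns it back. The relation therefore closes up at the single
  point \<open>x\<close>.\<close>

lemma walk_Psi_cyc:
  assumes "mu \<in> S"
  shows "(\<Prod>j<n - 1. gam V a (x 0) (x (Suc j))) * Psi (cyc_list n mu) x =
    walk n (\<lambda>i. alp V a (x 0) (x (Suc i))) (\<lambda>i. gam V a (x 0) (x (Suc i))) (n - 1) (\<lambda>nu. Psi nu x) mu"
proof -
  have "mv (n - 1) \<circ> cyc_inv n = id"
  proof
    fix j
    show "(mv (n - 1) \<circ> cyc_inv n) j = id j"
      using n2 by (cases j) (auto simp: mv_def cyc_inv_def)
  qed
  hence "x \<circ> mv (n - 1) \<circ> cyc_inv n = x" by (simp add: comp_assoc)
  hence "Psi (cyc_list n mu) x = Psi mu (x \<circ> mv (n - 1))" using cyclic[OF assms, of "x \<circ> mv (n - 1)"] by simp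
  thus ?thesis using walk_Psi[of "n - 1" mu x] n2 assms by simp
qed

text \<open>For \<open>n = 2\<close> equal variables are admitted: then the rotation alone is transitive on
  the states. This provides a good point on every diagonal \<open>x\<^sub>i = x\<^sub>i\<^sub>+\<^sub>1\<close>.\<close>

definition good :: "(nat \<Rightarrow> real) \<Rightarrow> bool" where
  "good x \<longleftrightarrow> (\<forall>j<n. 1 < x j) \<and> (\<forall>j<n. x 0 \<le> x j) \<and> (n = 2 \<or> (\<exists>j<n. x 0 < x j))"

lemma gam_pos: "1 < u \<Longrightarrow> 1 < w \<Longrightarrow> 0 < gam V a u w"
  unfolding gam_def using a01 by (intro mult_pos_pos prod_pos) (auto intro: less_trans)

context
  fixes x :: "nat \<Rightarrow> real"
  assumes x: "good x"
begin

text \<open>Minimality of \<open>x 0\<close> makes \<open>alp\<close> nonnegative. The difference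
  \<open>gam - alp\<close> has the factor \<open>x 0 - a l\<close>, which is positive because
  \<open>x 0\<close> exceeds 1.\<close>

lemma good_params:
  shows "Suc k < n \<Longrightarrow> 0 < gam V a (x 0) (x (Suc k))"
    and "Suc k < n \<Longrightarrow> l \<in> V \<Longrightarrow> 0 \<le> alp V a (x 0) (x (Suc k)) l \<and> alp V a (x 0) (x (Suc k)) l < gam V a (x 0) (x (Suc k))"
    and "n = 2 \<or> (\<exists>k. Suc k < n \<and> (\<forall>l\<in>V. 0 < alp V a (x 0) (x (Suc k)) l))"
proof -
  have x0: "1 < x 0" using x n2 unfolding good_def by simp
  show "0 < gam V a (x 0) (x (Suc k))" if "Suc k < n" using gam_pos x0 x that unfolding good_def by simp
  have E: "0 < (\<Prod>m\<in>V - {l}. x j - a m)" if "j < n" for j l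
    using x that a01 unfolding good_def by (intro prod_pos) (auto intro: less_trans)
  show "0 \<le> alp V a (x 0) (x (Suc k)) l \<and> alp V a (x 0) (x (Suc k)) l < gam V a (x 0) (x (Suc k))"
    if k: "Suc k < n" "l \<in> V" for k l
  proof
    have xk: "x 0 \<le> x (Suc k)" "1 < x (Suc k)" using x k unfolding good_def by auto
    show "0 \<le> alp V a (x 0) (x (Suc k)) l"
      unfolding alp_def using a01[of l] xk E[OF k(1), of l] by simp
    have "0 < x (Suc k) * (x 0 - a l) * (\<Prod>m\<in>V - {l}. x (Suc k) - a m)"
      using xk x0 a01[of l] E[OF k(1), of l] by (intro mult_pos_pos) auto
    thus "alp V a (x 0) (x (Suc k)) l < gam V a (x 0) (x (Suc k))"
      using gam_minus_alp[of V l a "x 0" "x (Suc k)"] k by simp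
  qed
  show "n = 2 \<or> (\<exists>k. Suc k < n \<and> (\<forall>l\<in>V. 0 < alp V a (x 0) (x (Suc k)) l))"
  proof (cases "n = 2")
    case False
    then obtain j where j: "j < n" "x 0 < x j" using x unfolding good_def by blast
    then obtain k where k: "j = Suc k" by (cases j) auto
    have "0 < alp V a (x 0) (x (Suc k)) l" for l
      unfolding alp_def using a01[of l] j E[OF j(1), of l] k by (intro mult_pos_pos) auto
    thus ?thesis using j k by blast
  qed simp
qed

lemma Psi_fixed:
  "fixed n lam (\<lambda>i. alp V a (x 0) (x (Suc i))) (\<lambda>i. gam V a (x 0) (x (Suc i))) (\<lambda>nu. Psi nu x)"
  by (subst fixed_def[OF len n2 srt good_params]) (use walk_Psi_cyc in auto)

lemma Psi_sign: "(\<forall>mu\<in>S. 0 \<le> Psi mu x) \<or> (\<forall>mu\<in>S. Psi mu x \<le> 0)"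
  by (rule fixed_sign[OF len n2 srt good_params Psi_fixed])

lemma Pi_dvd_local: "\<exists>d. ev d x \<noteq> 0 \<and> (\<forall>mu\<in>S. (\<Sum>nu\<in>S. psi nu) dvd d * psi mu)"
proof (rule cramer_dvd)
  let ?alm = "\<lambda>i. alp V (\<lambda>l. C (a l)) (X 0) (X (Suc i))" and ?gam = "\<lambda>i. gam V (\<lambda>l. C (a l)) (X 0) (X (Suc i))"
  let ?al = "\<lambda>i. alp V a (x 0) (x (Suc i))" and ?ga = "\<lambda>i. gam V a (x 0) (x (Suc i))"
  let ?D = "\<Prod>k<n - 1. ?gam k" and ?d = "\<Prod>k<n - 1. ?ga k"
  let ?W = "\<lambda>mu \<kappa>. walk n ?alm ?gam (n - 1) (\<lambda>nu. if nu = \<kappa> then 1 else 0) mu"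
  \<comment> \<open>The fixed-vector system alone is singular, its columns having sum 0. Adding 1 to
    every entry removes the kernel and makes all right-hand sides equal to the sum of the
    \<open>psi\<close>.\<close>
  define M where "M = (\<lambda>mu \<kappa>. ?D * (if \<kappa> = cyc_list n mu then 1 else 0) - ?W mu \<kappa> + 1)"
  have n1: "n - 1 < n" using n2 by simp
  show "finite S" by (rule finite_rearr)
  show "(\<Sum>\<kappa>\<in>S. M mu \<kappa> * psi \<kappa>) = (\<Sum>nu\<in>S. psi nu)" if mu: "mu \<in> S" for mu
  proof -
    have c: "cyc_list n mu \<in> S" using rearr_cyc[OF mu len] .
    have "(\<Sum>\<kappa>\<in>S. M mu \<kappa> * psi \<kappa>) = (\<Sum>\<kappa>\<in>S. if \<kappa> = cyc_list n mu then ?D * psi \<kappa> else 0)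
        - (\<Sum>\<kappa>\<in>S. psi \<kappa> * ?W mu \<kappa>) + (\<Sum>\<kappa>\<in>S. psi \<kappa>)"
      unfolding M_def sum_subtractf[symmetric] sum.distrib[symmetric]
      by (intro sum.cong) (auto simp: algebra_simps)
    also have "(\<Sum>\<kappa>\<in>S. if \<kappa> = cyc_list n mu then ?D * psi \<kappa> else 0) = ?D * psi (cyc_list n mu)"
      using c finite_rearr[of lam] by simp
    also have "(\<Sum>\<kappa>\<in>S. psi \<kappa> * ?W mu \<kappa>) = walk n ?alm ?gam (n - 1) psi mu"
      by (rule walk_expand[OF len n2 n1 mu, symmetric])
    also have "\<dots> = ?D * psi (cyc_list n mu)"
    proof (rule mpol_eqI)
      fix z
      have "ev (walk n ?alm ?gam (n - 1) psi mu) z =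
          walk n (\<lambda>i. alp V a (z 0) (z (Suc i))) (\<lambda>i. gam V a (z 0) (z (Suc i))) (n - 1) (\<lambda>nu. ev (psi nu) z) mu"
        unfolding ev_walk by simp
      also have "\<dots> = walk n (\<lambda>i. alp V a (z 0) (z (Suc i))) (\<lambda>i. gam V a (z 0) (z (Suc i))) (n - 1) (\<lambda>nu. Psi nu z) mu"
        by (rule walk_cong[OF len n2 _ n1 mu]) (simp add: psi)
      also have "\<dots> = ev (?D * psi (cyc_list n mu)) z"
        using walk_Psi_cyc[OF mu, of z] c by (simp add: psi)
      finally show "ev (walk n ?alm ?gam (n - 1) psi mu) z = ev (?D * psi (cyc_list n mu)) z" .
    qed
    finally show ?thesis by simp
  qed
  fix v \<kappa>
  assume z: "\<And>mu. mu \<in> S \<Longrightarrow> (\<Sum>\<kappa>\<in>S. ev (M mu \<kappa>) x * v \<kappa>) = 0" and \<kappa>: "\<kappa> \<in> S"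
  have eq: "?d * v (cyc_list n mu) - walk n ?al ?ga (n - 1) v mu + (\<Sum>\<kappa>\<in>S. v \<kappa>) = 0" if mu: "mu \<in> S" for mu
  proof -
    let ?w = "\<lambda>\<kappa>. walk n ?al ?ga (n - 1) (\<lambda>nu. if nu = \<kappa> then 1 else 0) mu"
    have c: "cyc_list n mu \<in> S" using rearr_cyc[OF mu len] .
    have evW: "ev (?W mu \<kappa>) x = ?w \<kappa>" for \<kappa>
      unfolding ev_walk by (simp add: if_distrib[where f = "\<lambda>f. ev f x"] cong: if_cong)
    have "0 = (\<Sum>\<kappa>\<in>S. ev (M mu \<kappa>) x * v \<kappa>)" using z mu by simp
    also have "\<dots> = (\<Sum>\<kappa>\<in>S. if \<kappa> = cyc_list n mu then ?d * v \<kappa> else 0) - (\<Sum>\<kappa>\<in>S. v \<kappa> * ?w \<kappa>) + (\<Sum>\<kappa>\<in>S. v \<kappa>)"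
      unfolding M_def sum_subtractf[symmetric] sum.distrib[symmetric]
      by (intro sum.cong) (auto simp: algebra_simps evW[unfolded One_nat_def])
    also have "(\<Sum>\<kappa>\<in>S. if \<kappa> = cyc_list n mu then ?d * v \<kappa> else 0) = ?d * v (cyc_list n mu)"
      using c finite_rearr[of lam] by simp
    also have "(\<Sum>\<kappa>\<in>S. v \<kappa> * ?w \<kappa>) = walk n ?al ?ga (n - 1) v mu"
      by (rule walk_expand[OF len n2 n1 mu, symmetric])
    finally show ?thesis by simp
  qed
  \<comment> \<open>Adding up all equations cancels the walk against the rotation term and leaves
    \<open>card S\<close> times the total of \<open>v\<close>. So the total is 0, and
    \<open>v\<close> is a fixed vector with total 0.\<close>
  have "0 = (\<Sum>mu\<in>S. ?d * v (cyc_list n mu) - walk n ?al ?ga (n - 1) v mu + (\<Sum>\<kappa>\<in>S. v \<kappa>))"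
    using eq by simp
  also have "\<dots> = ?d * (\<Sum>mu\<in>S. v (cyc_list n mu)) - (\<Sum>mu\<in>S. walk n ?al ?ga (n - 1) v mu)
      + real (card S) * (\<Sum>\<kappa>\<in>S. v \<kappa>)"
    by (simp add: sum.distrib sum_subtractf sum_distrib_left)
  also have "(\<Sum>mu\<in>S. v (cyc_list n mu)) = (\<Sum>\<kappa>\<in>S. v \<kappa>)"
    by (rule sum.reindex_bij_betw[OF rearr_cyc_bij[OF len]])
  also have "(\<Sum>mu\<in>S. walk n ?al ?ga (n - 1) v mu) = ?d * (\<Sum>\<kappa>\<in>S. v \<kappa>)"
    by (rule sum_walk[OF len n2 n1])
  finally have sum0: "(\<Sum>\<kappa>\<in>S. v \<kappa>) = 0" using lam_S finite_rearr[of lam] by auto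
  have fx: "fixed n lam ?al ?ga v"
    by (subst fixed_def[OF len n2 srt good_params]) (use eq sum0 in auto)
  show "v \<kappa> = 0" by (rule fixed_sum_zero[OF len n2 srt good_params fx sum0 \<kappa>])
qed

end

end

section \<open>Permuting the variables, and divisibility in local rings\<close>

lemma psub_psub: "psub v (psub w f) = psub (v \<circ> w) f"
  by (rule mpol_eqI) (simp add: comp_assoc)

lemma psub_id: "psub id f = f"
  by (rule mpol_eqI) simp

lemma psub_mult: "psub w (f * g) = psub w f * psub w g"
  and psub_C: "psub w (C c) = C c"
  by (rule mpol_eqI, simp)+

lemma psub_dvd: "f dvd g \<Longrightarrow> psub w f dvd psub w g"
  by (auto elim!: dvdE simp: psub_mult)

lemma ev_stp: "ev (stp n i al ga v nu) x = stp n i (\<lambda>l. ev (al l) x) (ev ga x) (\<lambda>nu. ev (v nu) x) nu"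
  by (simp add: stp_def)

context exchange_family
begin

definition Pim :: mpol where
  "Pim = (\<Sum>mu\<in>S. psi mu)"

lemma ev_Pim: "ev Pim x = Pi_poly lam Psi x"
  unfolding Pim_def Pi_poly_def by (auto intro!: sum.cong simp: psi)

lemma ev_psi: "mu \<in> S \<Longrightarrow> ev (psi mu) x = Psi mu x"
  by (simp add: psi)

text \<open>Membership of \<open>f\<close> in the ideal generated by \<open>Pim\<close> in the local
  ring at \<open>x\<close>, with the denominator \<open>k\<close> cleared.\<close>

definition loc :: "(nat \<Rightarrow> real) \<Rightarrow> mpol \<Rightarrow> bool" where
  "loc x f \<longleftrightarrow> (\<exists>k. ev k x \<noteq> 0 \<and> Pim dvd k * f)"

lemma loc_add:
  assumes "loc x f" "loc x g"
  shows "loc x (f + g)"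
proof -
  obtain k l where "ev k x \<noteq> 0" "Pim dvd k * f" "ev l x \<noteq> 0" "Pim dvd l * g"
    using assms unfolding loc_def by blast
  moreover have "k * l * (f + g) = l * (k * f) + k * (l * g)" by (simp add: algebra_simps)
  ultimately show ?thesis unfolding loc_def by (intro exI[of _ "k * l"]) simp
qed

lemma loc_mult: "loc x f \<Longrightarrow> loc x (c * f)"
  unfolding loc_def by (metis dvd_mult mult.left_commute)

lemma loc_cancel:
  assumes "loc x (c * f)" "ev c x \<noteq> 0"
  shows "loc x f"
proof -
  obtain k where "ev k x \<noteq> 0" "Pim dvd k * (c * f)" using assms unfolding loc_def by blast
  thus ?thesis using assms(2) unfolding loc_def by (intro exI[of _ "k * c"]) (simp add: mult.assoc)
qed

lemma exchange_psub:
  assumes "mu \<in> S" "i < n"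
  shows "gam V (\<lambda>l. C (a l)) (X (v i)) (X (v (nxt n i))) * psub (v \<circ> swp n i) (psi mu) =
    stp n i (alp V (\<lambda>l. C (a l)) (X (v i)) (X (v (nxt n i)))) (gam V (\<lambda>l. C (a l)) (X (v i)) (X (v (nxt n i))))
      (\<lambda>nu. psub v (psi nu)) mu"
proof (rule mpol_eqI)
  fix x :: "nat \<Rightarrow> real"
  define y where "y = x \<circ> v"
  have y: "y i = x (v i)" "y (nxt n i) = x (v (nxt n i))" "x \<circ> (v \<circ> swp n i) = y \<circ> swp n i"
    by (auto simp: y_def)
  have sw: "swap_list n i mu \<in> S" using rearr_swap[OF assms(1) len assms(2)] .
  show "ev (gam V (\<lambda>l. C (a l)) (X (v i)) (X (v (nxt n i))) * psub (v \<circ> swp n i) (psi mu)) x =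
    ev (stp n i (alp V (\<lambda>l. C (a l)) (X (v i)) (X (v (nxt n i)))) (gam V (\<lambda>l. C (a l)) (X (v i)) (X (v (nxt n i))))
      (\<lambda>nu. psub v (psi nu)) mu) x"
    using exchange_stp[OF assms, of y] assms(1) sw
    unfolding ev_stp times_mpol.rep_eq psub.rep_eq y(3) y_def[symmetric]
    by (simp add: ev_psi y stp_def)
qed

text \<open>The exchange relation expresses \<open>gam\<close> times a swapped polynomial through
  polynomials already in the local ideal, and \<open>gam\<close> is a local unit because all
  coordinates exceed 1.\<close>

lemma loc_psub:
  assumes "good x" "w permutes {..<n}"
  shows "\<forall>mu\<in>S. loc x (psub w (psi mu))"
  using assms(2)
proof (induction rule: permutes_adjacent_induct)
  case id
  show ?case using Pi_dvd_local[OF assms(1)] unfolding loc_def psub_id Pim_def by blast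
next
  case (swp v i)
  show ?case
  proof
    fix mu assume mu: "mu \<in> S"
    let ?g = "gam V (\<lambda>l. C (a l)) (X (v i)) (X (v (nxt n i)))"
    have i: "i < n" using swp by simp
    have sw: "swap_list n i mu \<in> S" using rearr_swap[OF mu len i] .
    have "loc x (?g * psub (v \<circ> swp n i) (psi mu))"
      unfolding exchange_psub[OF mu i] stp_def using swp.IH mu sw by (auto intro!: loc_add loc_mult)
    moreover have "v i < n" "v (nxt n i) < n"
      using permutes_in_image[OF swp.hyps(1)] i nxt_less[OF i] by auto
    hence "1 < x (v i)" "1 < x (v (nxt n i))" using assms(1) unfolding good_def by auto
    hence "ev ?g x \<noteq> 0" using gam_pos[of "x (v i)" "x (v (nxt n i))"] by simp
    ultimately show "loc x (psub (v \<circ> swp n i) (psi mu))" using loc_cancel by blast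
  qed
qed

text \<open>Summed over all words, the exchange steps only multiply the total by \<open>gam\<close>,
  which cancels.\<close>

lemma Pim_swp:
  assumes "i < n"
  shows "psub (swp n i) Pim = Pim"
proof -
  let ?g = "gam V (\<lambda>l. C (a l)) (X i) (X (nxt n i))"
  have e: "?g * psub (swp n i) (psi mu) = stp n i (alp V (\<lambda>l. C (a l)) (X i) (X (nxt n i))) ?g psi mu"
    if "mu \<in> S" for mu
    using exchange_psub[OF that assms, of id] by (simp add: psub_id)
  have sum: "psub w Pim = (\<Sum>mu\<in>S. psub w (psi mu))" for w
    unfolding Pim_def by (rule mpol_eqI) simp
  have "?g * psub (swp n i) Pim = (\<Sum>mu\<in>S. stp n i (alp V (\<lambda>l. C (a l)) (X i) (X (nxt n i))) ?g psi mu)"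
    unfolding sum sum_distrib_left using e by (intro sum.cong) auto
  also have "\<dots> = ?g * Pim" unfolding Pim_def by (rule sum_stp[OF len n2 assms])
  finally have "?g * psub (swp n i) Pim = ?g * Pim" .
  moreover have "ev ?g (\<lambda>_. 2) \<noteq> 0" using gam_pos[of 2 2] by simp
  hence "?g \<noteq> 0" by (metis zero_mpol.rep_eq)
  ultimately show ?thesis by simp
qed

lemma Pim_permutes: "w permutes {..<n} \<Longrightarrow> psub w Pim = Pim"
  by (induction rule: permutes_adjacent_induct) (simp_all only: psub_id psub_psub[symmetric] Pim_swp Suc_lessD)

lemma good_exists: "good (\<lambda>j. if j = 0 then 2 else 3)"
  unfolding good_def using n2 by (auto intro!: exI[of _ 1])

text \<open>Such a point refutes antisymmetry of a polynomial known to be nonzero at good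
  points.\<close>

lemma good_diag_exists:
  assumes "i < n"
  shows "\<exists>x. good x \<and> x i = x (nxt n i)"
proof (cases "n = 2")
  case True
  then show ?thesis unfolding good_def by (intro exI[of _ "\<lambda>_. 2"]) auto
next
  case False
  let ?T = "{i, nxt n i}"
  define x where "x = (\<lambda>j :: nat. if j = 0 \<or> (0 \<in> ?T \<and> j \<in> ?T) then 2 else 3 :: real)"
  \<comment> \<open>With at least three sites, one lies outside the pair and can carry the larger
    value if the pair contains site 0.\<close>
  have "card ?T < card {..<n}" using False n2 by (simp add: card_insert_if)
  hence "\<exists>j<n. j \<notin> ?T"
    by (metis card_mono finite.emptyI finite.insertI lessThan_iff not_le subsetI)
  hence "\<exists>j<n. x 0 < x j"
  proof (cases "0 \<in> ?T")
    case True
    then show ?thesis using \<open>\<exists>j<n. j \<notin> ?T\<close> by (auto simp: x_def)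
  next
    case False
    then show ?thesis using assms by (intro exI[of _ i]) (auto simp: x_def)
  qed
  thus ?thesis by (intro exI[of _ x]) (auto simp: good_def x_def)
qed

end

lemma finite_permutes_lessThan: "finite {w. w permutes {..<n::nat}}"
  by (rule finite_permutations) simp

theorem (in exchange_family) Pi_nonzero:
  assumes dep: "\<And>mu. mu \<in> S \<Longrightarrow> psi mu \<in> dep n" and deg: "\<And>mu. mu \<in> S \<Longrightarrow> tdeg (psi mu) \<le> d"
    and nz: "mu0 \<in> S" "psi mu0 \<noteq> 0"
    and minimal: "\<And>Phi d'. tasep_rel n a lam Phi \<Longrightarrow> \<exists>mu\<in>S. Phi mu \<noteq> (\<lambda>x. 0) \<Longrightarrow>
       (\<And>mu. mu \<in> S \<Longrightarrow> poly_deg_le n d' (Phi mu)) \<Longrightarrow> d \<le> d'"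
    and x: "good x"
  shows "Pi_poly lam Psi x \<noteq> 0"
proof -
  \<comment> \<open>The family is closed under permuting variables, so a swap maps common divisors
    of \<open>F\<close> to common divisors of \<open>F\<close>.\<close>
  define F where "F = {psub w (psi mu) | w mu. w permutes {..<n} \<and> mu \<in> S}"
  have F: "psub w (psi mu) \<in> F" if "w permutes {..<n}" "mu \<in> S" for w mu
    using that unfolding F_def by blast
  have idF: "psi mu \<in> F" if "mu \<in> S" for mu using F[OF permutes_id that] by (simp add: psub_id)
  have finF: "finite F"
  proof -
    have "F = (\<lambda>(w, mu). psub w (psi mu)) ` ({w. w permutes {..<n}} \<times> S)" unfolding F_def by auto
    thus ?thesis using finite_permutes_lessThan finite_rearr by simp
  qed
  obtain G where G: "G \<noteq> 0" "\<And>f. f \<in> F \<Longrightarrow> G dvd f"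
    "\<And>h k. h \<noteq> 0 \<Longrightarrow> (\<And>f. f \<in> F \<Longrightarrow> h dvd k * f) \<Longrightarrow> h dvd k * G"
    using mpol_strong_gcd[OF idF[OF nz(1)] nz(2)] by metis
  have "G dvd Pim" unfolding Pim_def using G(2) idF by (intro dvd_sum) auto
  then obtain P where P: "Pim = G * P" by (auto elim: dvdE)
  have Pim0: "Pim \<noteq> 0"
  proof
    assume "Pim = 0"
    moreover obtain k where "ev k (\<lambda>j. if j = 0 then 2 else 3) \<noteq> 0" "Pim dvd k * psi mu0"
      using Pi_dvd_local[OF good_exists] nz unfolding Pim_def by blast
    ultimately show False using nz by auto
  qed
  have Pgood: "ev P y \<noteq> 0" if y: "good y" for y
  proof -
    have "\<forall>f\<in>F. \<exists>k. ev k y \<noteq> 0 \<and> Pim dvd k * f"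
      using loc_psub[OF y] unfolding F_def loc_def by blast
    then obtain k where k: "\<And>f. f \<in> F \<Longrightarrow> ev (k f) y \<noteq> 0" "\<And>f. f \<in> F \<Longrightarrow> Pim dvd k f * f" by metis
    \<comment> \<open>One denominator for the whole finite family. As \<open>K\<close> is a multiple
      of \<open>P\<close> and does not vanish at \<open>y\<close>, neither does
      \<open>P\<close>.\<close>
    define K where "K = (\<Prod>f\<in>F. k f)"
    have "Pim dvd K * f" if "f \<in> F" for f
    proof -
      have e: "K * f = (\<Prod>g\<in>F - {f}. k g) * (k f * f)"
        unfolding K_def prod.remove[OF finF that] by (simp add: ac_simps)
      show ?thesis unfolding e by (rule dvd_mult[OF k(2)[OF that]])
    qed
    hence "Pim dvd K * G" using G(3)[OF Pim0] by blast
    then obtain c where "K * G = Pim * c" by (auto elim: dvdE)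
    hence "G * K = G * (P * c)" using P by (simp add: ac_simps)
    hence "K = P * c" using G(1) by simp
    moreover have "ev K y \<noteq> 0" unfolding K_def using k(1) finF by simp
    ultimately show ?thesis by auto
  qed
  have Gs: "psub (swp n i) G = G" if i: "i < n" for i
  proof -
    let ?s = "swp n i"
    have dvdF: "psub ?s G dvd f" if f: "f \<in> F" for f
    proof -
      obtain w mu where w: "f = psub w (psi mu)" "w permutes {..<n}" "mu \<in> S" using f unfolding F_def by blast
      have "G dvd psub (?s \<circ> w) (psi mu)"
        by (rule G(2)[OF F[OF permutes_compose[OF w(2) swp_permutes[OF i]] w(3)]])
      hence "psub ?s G dvd psub ?s (psub (?s \<circ> w) (psi mu))" by (rule psub_dvd)
      thus ?thesis unfolding w(1) by (simp only: psub_psub comp_assoc[symmetric] swp_comp_swp id_comp)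
    qed
    have inv: "psub ?s (psub ?s G) = G" unfolding psub_psub swp_comp_swp psub_id ..
    have s0: "psub ?s G \<noteq> 0"
    proof
      assume "psub ?s G = 0"
      hence "ev (psub ?s (psub ?s G)) y = 0" for y by simp
      hence "G = 0" unfolding inv by (intro mpol_eqI) simp
      thus False using G(1) by simp
    qed
    have "psub ?s G dvd 1 * G" by (rule G(3)[OF s0]) (use dvdF in simp)
    then obtain h where h: "G = psub ?s G * h" by (auto elim: dvdE)
    have h0: "h \<noteq> 0" using h G(1) by auto
    \<comment> \<open>The swap does not raise degrees and is its own inverse, so it preserves them;
      the cofactor \<open>h\<close> is thus constant, and applying the swap twice gives
      \<open>c^2 = 1\<close>.\<close>
    have "tdeg (psub ?s G) = tdeg G" using tdeg_psub_le[of ?s G] tdeg_psub_le[of ?s "psub ?s G"] unfolding inv by simp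
    hence "tdeg h = 0" using tdeg_mult[OF s0 h0] h by simp
    then obtain c where c: "h = C c" using tdeg_eq_0D by blast
    have 1: "G = C c * psub ?s G" using h c by (simp add: mult.commute)
    have 2: "psub ?s G = C c * G"
      using arg_cong[OF 1, of "psub ?s"] unfolding psub_mult psub_C inv .
    have "C c * C c * G = 1 * G" using 1 2 by (metis mult.assoc mult_1)
    hence "C c * C c = 1" using G(1) by (metis mult_right_cancel)
    hence "ev (C c * C c) y = 1" for y by simp
    hence "c = 1 \<or> c = -1" by (simp add: square_eq_1_iff)
    thus ?thesis
    proof
      assume "c = 1"
      moreover have "C 1 = 1" by (rule mpol_eqI) simp
      ultimately show ?thesis using 2 by simp
    next
      assume cm: "c = -1"
      obtain y where y: "good y" "y i = y (nxt n i)" using good_diag_exists[OF i] by blast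
      \<comment> \<open>Since \<open>Pim\<close> is symmetric, an antisymmetric \<open>G\<close>
        would make \<open>P\<close> antisymmetric as well, so \<open>P\<close> would vanish at the
        good point \<open>y\<close> on the diagonal.\<close>
      have "G * P = psub ?s G * psub ?s P" using Pim_swp[OF i] P psub_mult by metis
      hence "G * P = G * (C c * psub ?s P)" unfolding 2 by (simp add: ac_simps)
      hence "P = C c * psub ?s P" using G(1) by simp
      hence "ev P y = c * ev P (y \<circ> ?s)" by (metis ev_simps(4) ev_simps'(1) ev_simps'(3))
      moreover have "y \<circ> ?s = y" using y(2) by (auto simp: swp_def fun_eq_iff)
      ultimately have "ev P y = 0" using cm by simp
      thus ?thesis using Pgood[OF y(1)] by simp
    qed
  qed
  have Gw: "psub w G = G" if "w permutes {..<n}" for w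
    using that
    by (induction rule: permutes_adjacent_induct) (simp_all only: psub_id psub_psub[symmetric] Gs Suc_lessD)
  have "\<forall>mu\<in>S. \<exists>b. psi mu = G * b" using G(2) idF by (auto elim!: dvdE)
  then obtain B where B: "\<And>mu. mu \<in> S \<Longrightarrow> psi mu = G * B mu" by metis
  have relB: "tasep_rel n a lam (\<lambda>mu. ev (B mu))"
    unfolding tasep_rel_def
  proof (intro conjI ballI allI impI)
    fix mu i y assume mu: "mu \<in> S" and i: "i < n"
    let ?s = "swp n i" and ?b = "a (mu ! nxt n i)"
    have sw: "swap_list n i mu \<in> S" using rearr_swap[OF mu len i] .
    have ps: "psub ?s (psi mu) = G * psub ?s (B mu)" unfolding B[OF mu] psub_mult Gs[OF i] ..
    show "y i * (y (nxt n i) - ?b) * (ev (B mu) y - ev (B mu) (y \<circ> ?s))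
        = ?b * (y i - y (nxt n i)) * ev (B (swap_list n i mu)) y" if "mu ! i < mu ! nxt n i"
    proof -
      have "X i * (X (nxt n i) - C ?b) * (psi mu - psub ?s (psi mu))
          = C ?b * (X i - X (nxt n i)) * psi (swap_list n i mu)"
      proof (rule mpol_eqI)
        fix z
        show "ev (X i * (X (nxt n i) - C ?b) * (psi mu - psub ?s (psi mu))) z
          = ev (C ?b * (X i - X (nxt n i)) * psi (swap_list n i mu)) z"
          using rel mu i that sw unfolding tasep_rel_def by (simp add: ev_psi)
      qed
      hence "G * (X i * (X (nxt n i) - C ?b) * (B mu - psub ?s (B mu)))
          = G * (C ?b * (X i - X (nxt n i)) * B (swap_list n i mu))"
        unfolding ps unfolding B[OF mu] B[OF sw] by (simp add: algebra_simps)
      hence "X i * (X (nxt n i) - C ?b) * (B mu - psub ?s (B mu)) = C ?b * (X i - X (nxt n i)) * B (swap_list n i mu)"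
        using G(1) mult_left_cancel by blast
      from arg_cong[OF this, of "\<lambda>f. ev f y"] show ?thesis by simp
    qed
    show "ev (B mu) (y \<circ> ?s) = ev (B mu) y" if "mu ! i = mu ! nxt n i"
    proof -
      have "psub ?s (psi mu) = psi mu"
        by (rule mpol_eqI) (use exchange_equal[OF mu i that] mu in \<open>simp add: ev_psi\<close>)
      hence "psub ?s (B mu) = B mu" using ps B[OF mu] G(1) by simp
      from arg_cong[OF this, of "\<lambda>f. ev f y"] show ?thesis by simp
    qed
  next
    fix mu y assume mu: "mu \<in> S"
    have c: "cyc_list n mu \<in> S" using rearr_cyc[OF mu len] .
    have "psub (cyc_inv n) (psi (cyc_list n mu)) = psi mu"
      by (rule mpol_eqI) (use cyclic[OF mu] mu c in \<open>simp add: ev_psi\<close>)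
    hence "psub (cyc_inv n) (B (cyc_list n mu)) = B mu"
      unfolding B[OF mu] B[OF c] psub_mult Gw[OF cyc_inv_permutes] using G(1) by simp
    from arg_cong[OF this, of "\<lambda>f. ev f y"] show "ev (B (cyc_list n mu)) (y \<circ> cyc_inv n) = ev (B mu) y" by simp
  qed
  have B0: "B mu0 \<noteq> 0" using B[OF nz(1)] nz(2) by auto
  \<comment> \<open>This includes \<open>tdeg G \<le> d\<close>, so the natural-number difference
    \<open>d - tdeg G\<close> is not truncated and minimality forces
    \<open>tdeg G = 0\<close>.\<close>
  have "tdeg G + tdeg (B mu0) \<le> d" using tdeg_mult[OF G(1) B0] B[OF nz(1)] deg[OF nz(1)] by simp
  moreover have "d \<le> d - tdeg G"
  proof (rule minimal[OF relB])
    show "\<exists>mu\<in>S. ev (B mu) \<noteq> (\<lambda>x. 0)"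
      using nz(1) B0 mpol_neq_0D by (intro bexI[of _ mu0]) (auto dest: fun_cong)
    show "poly_deg_le n (d - tdeg G) (ev (B mu))" if mu: "mu \<in> S" for mu
    proof (rule mpol_imp_poly_deg_le)
      show "B mu \<in> dep n"
      proof (cases "B mu = 0")
        case False
        then show ?thesis using dep_factor[of "B mu" G n] dep[OF mu] G(1) B[OF mu] by (simp add: mult.commute)
      qed (simp add: dep_0)
      show "tdeg (B mu) \<le> d - tdeg G"
      proof (cases "B mu = 0")
        case False
        then show ?thesis using tdeg_mult[OF G(1) False] deg[OF mu] B[OF mu] by simp
      next
        case True
        have "C 0 = 0" by (rule mpol_eqI) simp
        then show ?thesis using True tdeg_C[of 0] by simp
      qed
    qed
  qed
  ultimately have "tdeg G = 0" by simp
  then obtain c where c: "G = C c" using tdeg_eq_0D by blast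
  hence "c \<noteq> 0" using G(1) by (metis mpol_eqI ev_simps(1) ev_simps'(1))
  hence "ev Pim x \<noteq> 0" using Pgood[OF x] P c by simp
  thus ?thesis by (simp add: ev_Pim)
qed

section \<open>Sign and size of the ratios at general points\<close>

context exchange_family
begin

lemma Pi_permutes: "w permutes {..<n} \<Longrightarrow> Pi_poly lam Psi (x \<circ> w) = Pi_poly lam Psi x"
  using arg_cong[OF Pim_permutes, of w "\<lambda>f. ev f x"] by (simp add: ev_Pim)

text \<open>The property \<open>sgd\<close> is invariant under rotation, so the smallest coordinate
  may be brought to site 0. Two distinct coordinates ensure that some coordinate is strictly larger
  than it.\<close>

lemma Psi_ratio_bounds:
  assumes nonzero: "\<And>z. good z \<Longrightarrow> Pi_poly lam Psi z \<noteq> 0"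
    and y: "\<And>j. j < n \<Longrightarrow> 1 < y j" "k < n" "l < n" "y k \<noteq> y l"
  shows "Pi_poly lam Psi y \<noteq> 0" "mu \<in> S \<Longrightarrow> 0 \<le> Psi mu y / Pi_poly lam Psi y"
    "mu \<in> S \<Longrightarrow> Psi mu y / Pi_poly lam Psi y \<le> 1"
proof -
  define sgd where "sgd = (\<lambda>y. Pi_poly lam Psi y \<noteq> 0 \<and> ((\<forall>mu\<in>S. 0 \<le> Psi mu y) \<or> (\<forall>mu\<in>S. Psi mu y \<le> 0)))"
  have good_sgd: "sgd z" if "good z" for z
    using nonzero[OF that] Psi_sign[OF that] unfolding sgd_def by blast
  have rot: "sgd z" if "sgd (z \<circ> cyc_inv n)" for z
  proof -
    have "Psi mu z = Psi (cyc_list n mu) (z \<circ> cyc_inv n)" if "mu \<in> S" for mu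
      using cyclic[OF that] by simp
    thus ?thesis using that rearr_cyc[OF _ len] Pi_permutes[OF cyc_inv_permutes, of z]
      unfolding sgd_def by auto
  qed
  have main: "sgd z" if "m < n" "\<And>j. j < n \<Longrightarrow> 1 < z j" "\<And>j. j < n \<Longrightarrow> z m \<le> z j" "\<exists>j<n. z m < z j" for m z
    using that
  \<comment> \<open>\<open>n - m\<close> is the number of rotations that take the smallest
    coordinate past the last site to site 0.\<close>
  proof (induction "n - m" arbitrary: m z rule: less_induct)
    case less
    show ?case
    proof (cases "m = 0")
      case True
      then show ?thesis using less.prems by (intro good_sgd) (auto simp: good_def)
    next
      case False
      define z' where "z' = z \<circ> cyc_inv n"
      have ci: "cyc_inv n j < n" if "j < n" for j
        using permutes_in_image[OF cyc_inv_permutes[of n], of j] that by simp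
      have inv: "cyc_inv n (nxt n j) = j" if "j < n" for j
        using that by (cases "Suc j = n") (auto simp: cyc_inv_def nxt_def)
      have z'm: "z' (nxt n m) = z m" using inv less.prems(1) by (simp add: z'_def)
      obtain j where j: "j < n" "z m < z j" using less.prems by blast
      have z': "\<And>j. j < n \<Longrightarrow> 1 < z' j" "\<And>j. j < n \<Longrightarrow> z' (nxt n m) \<le> z' j" "\<exists>j<n. z' (nxt n m) < z' j"
        unfolding z'm using less.prems(2,3) ci inv[OF j(1)] j nxt_less[OF j(1)]
        by (auto simp: z'_def intro!: exI[of _ "nxt n j"])
      have "sgd z'"
      proof (cases "Suc m = n")
        case True
        hence "nxt n m = 0" by (simp add: nxt_def)
        thus ?thesis using z' by (intro good_sgd) (auto simp: good_def)
      next
        case False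
        show ?thesis
          by (rule less.hyps[OF _ _ z']) (use False less.prems(1) nxt_Suc[of m n] in auto)
      qed
      thus ?thesis using rot unfolding z'_def by blast
    qed
  qed
  have "finite {..<n}" "{..<n} \<noteq> {}" using y(2) by auto
  then obtain m where m: "m < n" "\<And>j. j < n \<Longrightarrow> y m \<le> y j"
    using Min_in[of "y ` {..<n}"] Min_le[of "y ` {..<n}"] by fastforce
  have "\<exists>j<n. y m < y j"
    using m(2)[OF y(2)] m(2)[OF y(3)] y(2-4) by (metis antisym_conv2 le_less)
  hence sgd: "sgd y" using main[of m y] m y(1) by blast
  thus nz: "Pi_poly lam Psi y \<noteq> 0" unfolding sgd_def by blast
  assume mu: "mu \<in> S"
  have P: "Pi_poly lam Psi y = Psi mu y + (\<Sum>nu\<in>S - {mu}. Psi nu y)"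
    unfolding Pi_poly_def by (rule sum.remove[OF finite_rearr mu])
  from sgd have "(\<forall>mu\<in>S. 0 \<le> Psi mu y) \<or> (\<forall>mu\<in>S. Psi mu y \<le> 0)" unfolding sgd_def by blast
  hence "0 \<le> Psi mu y / Pi_poly lam Psi y \<and> Psi mu y / Pi_poly lam Psi y \<le> 1"
  proof
    assume p: "\<forall>mu\<in>S. 0 \<le> Psi mu y"
    hence "0 \<le> Psi mu y" "Psi mu y \<le> Pi_poly lam Psi y" using mu P by (auto intro: sum_nonneg)
    thus ?thesis using nz by (auto simp: divide_le_eq_1)
  next
    assume p: "\<forall>mu\<in>S. Psi mu y \<le> 0"
    hence "Psi mu y \<le> 0" "Pi_poly lam Psi y \<le> Psi mu y" using mu P by (auto intro: sum_nonpos)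
    thus ?thesis using nz by (auto simp: divide_le_eq_1 divide_nonpos_nonpos)
  qed
  thus "0 \<le> Psi mu y / Pi_poly lam Psi y" "Psi mu y / Pi_poly lam Psi y \<le> 1" by auto
qed

end

section \<open>Limits of bounded rational functions\<close>

text \<open>Reflected polynomials at \<open>1/x\<close> turn the behaviour at infinity into values
  at 0, which are the leading coefficients.\<close>

lemma bounded_rational_tendsto:
  fixes P Q :: "real poly"
  assumes Q: "Q \<noteq> 0" and bd: "eventually (\<lambda>x. 0 \<le> poly P x / poly Q x \<and> poly P x / poly Q x \<le> 1) at_top"
  shows "\<exists>L. ((\<lambda>x. poly P x / poly Q x) \<longlongrightarrow> L) at_top"
proof (cases "P = 0")
  case False
  define r where "r = (\<lambda>x. poly (reflect_poly P) (inverse x) / poly (reflect_poly Q) (inverse x))"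
  have inv0: "(inverse \<longlongrightarrow> (0::real)) at_top" by (rule tendsto_inverse_0_at_top) (rule filterlim_ident)
  have "(r \<longlongrightarrow> poly (reflect_poly P) 0 / poly (reflect_poly Q) 0) at_top"
    unfolding r_def using Q by (intro tendsto_divide isCont_tendsto_compose[OF poly_isCont inv0]) auto
  hence r: "(r \<longlongrightarrow> lead_coeff P / lead_coeff Q) at_top" by simp
  have pos: "eventually (\<lambda>x :: real. 0 < x) at_top" by (rule eventually_gt_at_top)
  have refl: "poly p x = x ^ degree p * poly (reflect_poly p) (inverse x)" if "0 < x" for p and x :: real
    using poly_reflect_poly_nz[of "inverse x" p] that by (simp add: power_inverse field_simps)
  show ?thesis
  proof (cases "degree P \<le> degree Q")
    case True
    have "((\<lambda>x. inverse x ^ (degree Q - degree P) * r x) \<longlongrightarrow> 0 ^ (degree Q - degree P) * (lead_coeff P / lead_coeff Q)) at_top"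
      by (intro tendsto_mult tendsto_power inv0 r)
    moreover have "eventually (\<lambda>x. inverse x ^ (degree Q - degree P) * r x = poly P x / poly Q x) at_top"
      using pos
    proof eventually_elim
      case (elim x)
      have "x ^ degree Q = x ^ (degree Q - degree P) * x ^ degree P"
        using True by (simp add: power_add[symmetric])
      thus ?case using elim unfolding r_def refl[OF elim, of P] refl[OF elim, of Q]
        by (simp add: power_inverse divide_simps)
    qed
    ultimately have "((\<lambda>x. poly P x / poly Q x) \<longlongrightarrow> 0 ^ (degree Q - degree P) * (lead_coeff P / lead_coeff Q)) at_top"
      by (rule Lim_transform_eventually)
    thus ?thesis by blast
  next
    \<comment> \<open>With a numerator of larger degree, the rescaled quotient would tend to 0 by
      boundedness and also to the nonzero quotient of leading coefficients.\<close>
    case deg: False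
    have "((\<lambda>x. inverse x ^ (degree P - degree Q) * (poly P x / poly Q x)) \<longlongrightarrow> 0) at_top"
    proof (rule tendsto_sandwich[of "\<lambda>_. 0"])
      have "((\<lambda>x :: real. inverse x ^ (degree P - degree Q)) \<longlongrightarrow> 0 ^ (degree P - degree Q)) at_top"
        by (intro tendsto_power inv0)
      thus "((\<lambda>x :: real. inverse x ^ (degree P - degree Q)) \<longlongrightarrow> 0) at_top" using deg by (simp add: power_0_left)
      show "eventually (\<lambda>x. 0 \<le> inverse x ^ (degree P - degree Q) * (poly P x / poly Q x)) at_top"
        using bd pos by eventually_elim (rule mult_nonneg_nonneg, auto)
      show "eventually (\<lambda>x. inverse x ^ (degree P - degree Q) * (poly P x / poly Q x) \<le> inverse x ^ (degree P - degree Q)) at_top"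
        using bd pos by eventually_elim (rule mult_left_le, auto)
    qed simp
    moreover have "eventually (\<lambda>x. inverse x ^ (degree P - degree Q) * (poly P x / poly Q x) = r x) at_top"
      using pos
    proof eventually_elim
      case (elim x)
      have "x ^ degree P = x ^ (degree P - degree Q) * x ^ degree Q"
        using deg by (simp add: power_add[symmetric])
      thus ?case using elim unfolding r_def refl[OF elim, of P] refl[OF elim, of Q]
        by (simp add: power_inverse divide_simps)
    qed
    ultimately have "(r \<longlongrightarrow> 0) at_top" by (rule Lim_transform_eventually)
    hence "lead_coeff P / lead_coeff Q = 0" using r tendsto_unique trivial_limit_at_top_linorder by blast
    thus ?thesis using False Q by simp
  qed
qed (auto intro!: exI[of _ 0])

section \<open>The stones\<close>

lemma swp_inv: "inv (swp n i) = swp n i"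
  by (rule inv_unique_comp) simp_all

lemma inv_swp_comp:
  assumes "sigma permutes {..<n}" "i < n"
  shows "inv (swp n i \<circ> sigma) = inv sigma \<circ> swp n i"
  using o_inv_distrib[OF permutes_bij[OF swp_permutes[OF assms(2)]] permutes_bij[OF assms(1)]]
  by (simp only: swp_inv)

lemma stone_Omega_permutes: "sigma \<in> stone_Omega n rho \<Longrightarrow> sigma permutes {..<n}"
  unfolding stone_Omega_def by blast

lemma finite_stone_Omega: "finite (stone_Omega n rho)"
  by (rule finite_subset[OF _ finite_permutes_lessThan[of n]]) (auto simp: stone_Omega_def)

lemma id_stone_Omega: "id \<in> stone_Omega n rho"
  unfolding stone_Omega_def using permutes_id by (auto intro!: exI[of _ 0] simp: inv_id)

text \<open>Exchanging stones of different density leaves the list of each density unchanged, except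
  across the seam between last and first site, where one stone moves from one end of its list to the
  other. That is a rotation.\<close>

lemma stone_Omega_swp:
  assumes s: "sigma \<in> stone_Omega n rho" and i: "i < n" "2 \<le> n"
    and neq: "rho (inv sigma i) \<noteq> rho (inv sigma (nxt n i))"
  shows "swp n i \<circ> sigma \<in> stone_Omega n rho"
proof -
  have perm: "sigma permutes {..<n}" using s stone_Omega_permutes by blast
  define f where "f = inv sigma"
  have "\<exists>k. filter (\<lambda>j. rho j = d) (map (f \<circ> swp n i) [0..<n]) = rotate k (filter (\<lambda>j. rho j = d) [0..<n])" for d
  proof -
    let ?F = "filter (\<lambda>j. rho j = d)"
    obtain k where k: "?F (map f [0..<n]) = rotate k (?F [0..<n])"
      using s unfolding stone_Omega_def f_def by blast
    show ?thesis
    proof (cases "Suc i < n")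
      case True
      hence nx: "nxt n i = Suc i" by (rule nxt_Suc)
      have upt: "[0..<n] = [0..<i] @ i # Suc i # [Suc (Suc i)..<n]"
        using True upt_add_eq_append[of 0 i "n - i"] by (simp add: upt_conv_Cons)
      have "map (f \<circ> swp n i) [0..<i] = map f [0..<i]" "map (f \<circ> swp n i) [Suc (Suc i)..<n] = map f [Suc (Suc i)..<n]"
        using nx by (auto simp: swp_def)
      hence "map (f \<circ> swp n i) [0..<n] = map f [0..<i] @ f (Suc i) # f i # map f [Suc (Suc i)..<n]"
        unfolding upt map_append list.map using nx by (simp add: swp_def)
      moreover have "map f [0..<n] = map f [0..<i] @ f i # f (Suc i) # map f [Suc (Suc i)..<n]"
        unfolding upt by simp
      ultimately have "?F (map (f \<circ> swp n i) [0..<n]) = ?F (map f [0..<n])"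
        using neq nx by (auto simp: f_def)
      thus ?thesis using k by metis
    next
      case False
      hence n: "n = Suc i" using i by simp
      have nx: "nxt n i = 0" using n by (simp add: nxt_def)
      have upt: "[0..<n] = 0 # [1..<i] @ [i]" using n i by (simp add: upt_conv_Cons)
      have "map (f \<circ> swp n i) [1..<i] = map f [1..<i]" using nx by (auto simp: swp_def)
      hence 1: "map (f \<circ> swp n i) [0..<n] = f i # map f [1..<i] @ [f 0]"
        unfolding upt list.map map_append using nx n i by (simp add: swp_def)
      have 2: "map f [0..<n] = f 0 # map f [1..<i] @ [f i]" unfolding upt by simp
      let ?m = "?F (map f [1..<i])"
      consider "rho (f 0) = d" "rho (f i) \<noteq> d" | "rho (f i) = d" "rho (f 0) \<noteq> d" | "rho (f i) \<noteq> d" "rho (f 0) \<noteq> d"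
        using neq nx by (auto simp: f_def)
      thus ?thesis
      proof cases
        case 1
        have "?F (map (f \<circ> swp n i) [0..<n]) = rotate 1 (?F (map f [0..<n]))"
          unfolding \<open>map (f \<circ> swp n i) [0..<n] = _\<close> 2 using 1 by simp
        thus ?thesis unfolding k rotate_rotate by blast
      next
        case 2
        have "?F (map f [0..<n]) = ?m @ [f i]" unfolding \<open>map f [0..<n] = _\<close> using 2 by simp
        moreover have "?F (map (f \<circ> swp n i) [0..<n]) = [f i] @ ?m"
          unfolding \<open>map (f \<circ> swp n i) [0..<n] = _\<close> using 2 by simp
        ultimately have "?F (map (f \<circ> swp n i) [0..<n]) = rotate (length ?m) (?F (map f [0..<n]))"
          using rotate_append[of ?m "[f i]"] by simp
        thus ?thesis unfolding k rotate_rotate by blast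
      next
        case 3
        have "?F (map (f \<circ> swp n i) [0..<n]) = ?F (map f [0..<n])" unfolding 1 2 using 3 by simp
        thus ?thesis using k by metis
      qed
    qed
  qed
  moreover have "swp n i \<circ> sigma permutes {..<n}"
    by (rule permutes_compose[OF perm swp_permutes[OF i(1)]])
  ultimately show ?thesis
    unfolding stone_Omega_def mem_Collect_eq inv_swp_comp[OF perm i(1)] f_def by blast
qed

text \<open>For the values 1 and 2, the ascent indicator minus the descent indicator is exactly the
  increment of \<open>r\<close>, and increments around a ring add up to 0.\<close>

lemma ascents_eq_descents:
  assumes "\<And>i. i < n \<Longrightarrow> r i = 1 \<or> r i = (2 :: nat)"
  shows "card {i. i < n \<and> r i < r (nxt n i)} = card {i. i < n \<and> r (nxt n i) < r i}"
proof -
  have bij: "bij_betw (nxt n) {..<n} {..<n}"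
  proof -
    have "inj_on (nxt n) {..<n}"
    proof (rule inj_onI)
      fix i j assume "i \<in> {..<n}" "j \<in> {..<n}" "nxt n i = nxt n j"
      thus "i = j" by (cases "Suc i = n"; cases "Suc j = n") (auto simp: nxt_def)
    qed
    moreover have "nxt n ` {..<n} \<subseteq> {..<n}" using nxt_less by auto
    ultimately show ?thesis by (simp add: bij_betw_def endo_inj_surj)
  qed
  have c: "int (card {i. i < n \<and> Q i}) = (\<Sum>i<n. if Q i then 1 else 0)" for Q
  proof -
    have "{i. i < n \<and> Q i} = {i\<in>{..<n}. Q i}" by auto
    thus ?thesis by (simp add: sum.If_cases Int_def)
  qed
  have "int (card {i. i < n \<and> r i < r (nxt n i)}) - int (card {i. i < n \<and> r (nxt n i) < r i})
      = (\<Sum>i<n. int (r (nxt n i)) - int (r i))"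
    unfolding c sum_subtractf[symmetric]
  proof (rule sum.cong)
    fix i assume "i \<in> {..<n}"
    hence "r i = 1 \<or> r i = 2" "r (nxt n i) = 1 \<or> r (nxt n i) = 2" using assms nxt_less by auto
    thus "(if r i < r (nxt n i) then 1 else 0) - (if r (nxt n i) < r i then 1 else 0) = int (r (nxt n i)) - int (r i)"
      by auto
  qed simp
  also have "\<dots> = 0" unfolding sum_subtractf using sum.reindex_bij_betw[OF bij, of "\<lambda>i. int (r i)"] by simp
  finally show ?thesis by simp
qed

text \<open>This is \<open>alp / gam\<close> for one species with \<open>w = R\<close> and
  \<open>u\<close> the variable of a light stone with parameter \<open>q\<close>. If
  \<open>q = 0\<close>, the stone carries \<open>R\<close> itself and the coefficient is identically
  0.\<close>

lemma exchange_coefficient_tendsto: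
  assumes "0 \<le> (q :: real)"
  shows "((\<lambda>R. b * (R - (if 0 < q then 1 / q else R)) / ((if 0 < q then 1 / q else R) * (R - b))) \<longlongrightarrow> q * b) at_top"
proof (cases "0 < q")
  case True
  have "filterlim (\<lambda>R. R - b) at_top at_top"
    using filterlim_tendsto_add_at_top[OF tendsto_const[of "- b"] filterlim_ident] by simp
  hence "((\<lambda>R. q * b * (1 + (b - 1 / q) / (R - b))) \<longlongrightarrow> q * b * (1 + 0)) at_top"
    by (intro tendsto_mult tendsto_add tendsto_const tendsto_divide_0[OF tendsto_const])
      (auto intro: filterlim_at_top_imp_at_infinity)
  moreover have "eventually (\<lambda>R. q * b * (1 + (b - 1 / q) / (R - b)) = b * (R - 1 / q) / (1 / q * (R - b))) at_top"
    using eventually_gt_at_top[of b]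
  proof eventually_elim
    case (elim R)
    have "1 + (b - 1 / q) / (R - b) = ((R - b) + (b - 1 / q)) / (R - b)"
      using elim by (subst add_divide_distrib) simp
    hence "q * b * (1 + (b - 1 / q) / (R - b)) = q * b * ((R - 1 / q) / (R - b))" by simp
    also have "\<dots> = b * (R - 1 / q) / (1 / q * (R - b))" using True by simp
    finally show ?case .
  qed
  ultimately have "((\<lambda>R. b * (R - 1 / q) / (1 / q * (R - b))) \<longlongrightarrow> q * b * (1 + 0)) at_top"
    by (rule Lim_transform_eventually)
  thus ?thesis using True by simp
next
  case False
  then show ?thesis using assms by simp
qed

lemma solve_ascent_relation:
  fixes u R b :: real
  assumes "u * (R - b) * w' = u * (R - b) * w + b * (R - u) * v" "0 < u * (R - b)"
  shows "w' = w + b * (R - u) / (u * (R - b)) * v"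
proof -
  define D where "D = u * (R - b)"
  have "0 < D" "D * w' = D * w + b * (R - u) * v" using assms unfolding D_def by auto
  thus ?thesis unfolding D_def[symmetric] by (simp add: field_simps)
qed

lemma solve_descent_relation:
  fixes u R b :: real
  assumes "u * (R - b) * w' = R * (u - b) * w" "0 < u * (R - b)"
  shows "w' = (1 - b * (R - u) / (u * (R - b))) * w"
proof -
  have "u * (R - b) * w' = u * (R - b) * w + b * (R - u) * (- w)"
    unfolding assms(1) by (simp add: algebra_simps)
  from solve_ascent_relation[OF this assms(2)] show ?thesis by (simp add: left_diff_distrib)
qed

theorem theorem6p1:
  fixes n :: nat and lam :: "nat list" and a :: "nat \<Rightarrow> real"
    and rho :: "nat \<Rightarrow> nat" and p :: "nat \<Rightarrow> real"
    and Psi :: "nat list \<Rightarrow> (nat \<Rightarrow> real) \<Rightarrow> real"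
  assumes "length lam = n" and "sorted lam"
    and "\<forall>k. 0 < a k \<and> a k < 1"
    and "\<forall>j<n. rho j = 1 \<or> rho j = 2"
    and "\<forall>i j. i \<le> j \<longrightarrow> j < n \<longrightarrow> rho i \<le> rho j"
    and "rho 0 = 1" and "rho (n - 1) = 2"
    and "\<forall>j<n. rho j = 1 \<longrightarrow> 0 \<le> p j \<and> p j < 1"
    and "\<exists>j<n. rho j = 1 \<and> 0 < p j"
    and "is_tasep_family n a lam Psi"
  shows "\<exists>\<pi>. is_stationary (rearr lam \<times> stone_Omega n rho) (itasep_trans n a rho p) \<pi> \<and>
     (\<forall>(mu, sigma) \<in> rearr lam \<times> stone_Omega n rho.
        ((\<lambda>R. Psi mu (chi rho p R \<circ> inv sigma) / Pi_poly lam Psi (chi rho p R))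
           \<longlongrightarrow> real (card (stone_Omega n rho)) * \<pi> (mu, sigma)) at_top)"
proof -
  have n2: "2 \<le> n" using assms(6,7,9) by (cases "n = 1") auto
  obtain d where rel: "tasep_rel n a lam Psi" and nz: "\<exists>mu\<in>rearr lam. Psi mu \<noteq> (\<lambda>x. 0)"
    and deg: "\<forall>mu\<in>rearr lam. poly_deg_le n d (Psi mu)"
    and minimal: "\<forall>Phi d'. tasep_rel n a lam Phi \<and> (\<exists>mu\<in>rearr lam. Phi mu \<noteq> (\<lambda>x. 0)) \<and>
                    (\<forall>mu\<in>rearr lam. poly_deg_le n d' (Phi mu)) \<longrightarrow> d \<le> d'"
    using assms(10) unfolding is_tasep_family_def by blast
  have "\<forall>mu\<in>rearr lam. \<exists>q. q \<in> dep n \<and> ev q = Psi mu \<and> tdeg q \<le> d"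
    using deg poly_deg_le_imp_mpol by blast
  then obtain psi where psi_props: "\<forall>mu\<in>rearr lam. psi mu \<in> dep n \<and> ev (psi mu) = Psi mu \<and> tdeg (psi mu) \<le> d"
    by metis
  interpret exchange_family n lam a Psi psi
    by unfold_locales (use assms n2 rel psi_props in auto)
  define \<Omega> where "\<Omega> = stone_Omega n rho"
  have \<Omega>_perm: "inv sigma permutes {..<n}" "sigma permutes {..<n}" if "sigma \<in> \<Omega>" for sigma
    using stone_Omega_permutes[of sigma n rho] that permutes_inv unfolding \<Omega>_def by blast+
  have \<Omega>_fin: "finite \<Omega>" "0 < card \<Omega>"
    unfolding \<Omega>_def using finite_stone_Omega[of n rho] id_stone_Omega[of n rho] card_gt_0_iff by blast+
  obtain mu0 where mu0: "mu0 \<in> S" "Psi mu0 \<noteq> (\<lambda>x. 0)" using nz by blast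
  have psi0: "psi mu0 \<noteq> 0"
  proof
    assume "psi mu0 = 0"
    hence "Psi mu0 x = 0" for x using psi_props mu0(1) by (metis zero_mpol.rep_eq)
    thus False using mu0(2) by auto
  qed
  have nonzero: "Pi_poly lam Psi z \<noteq> 0" if "good z" for z
  proof (rule Pi_nonzero[OF _ _ mu0(1) psi0 _ that])
    show "psi mu \<in> dep n" "tdeg (psi mu) \<le> d" if "mu \<in> S" for mu using psi_props that by blast+
    show "d \<le> d'" if "tasep_rel n a lam Phi" "\<exists>mu\<in>S. Phi mu \<noteq> (\<lambda>x. 0)"
      "\<And>mu. mu \<in> S \<Longrightarrow> poly_deg_le n d' (Phi mu)" for Phi d'
      using minimal that by blast
  qed

  define \<chi> where "\<chi> = chi rho p"
  obtain j0 where j0: "j0 < n" "rho j0 = 1" "0 < p j0" using assms(9) by blast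
  have \<chi>_gt: "1 < \<chi> R j" if "1 < R" "j < n" for R j
    using that assms(8) by (auto simp: \<chi>_def chi_def less_divide_eq_1)
  \<comment> \<open>Above 1 all coordinates exceed 1; above \<open>1 / p j0\<close> the coordinate
    of stone \<open>j0\<close> differs from the value \<open>R\<close> of the last stone, so two
    coordinates are distinct.\<close>
  define R0 where "R0 = max 1 (1 / p j0)"
  have big: "Pi_poly lam Psi (\<chi> R) \<noteq> 0"
    "mu \<in> S \<Longrightarrow> sigma \<in> \<Omega> \<Longrightarrow> 0 \<le> Psi mu (\<chi> R \<circ> inv sigma) / Pi_poly lam Psi (\<chi> R)"
    "mu \<in> S \<Longrightarrow> sigma \<in> \<Omega> \<Longrightarrow> Psi mu (\<chi> R \<circ> inv sigma) / Pi_poly lam Psi (\<chi> R) \<le> 1"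
    if R: "R0 < R" for R mu sigma
  proof -
    have R1: "1 < R" "1 / p j0 < R" using R unfolding R0_def by auto
    have neq: "\<chi> R j0 \<noteq> \<chi> R (n - 1)" using R1 j0 assms(7) by (simp add: \<chi>_def chi_def)
    show "Pi_poly lam Psi (\<chi> R) \<noteq> 0"
      by (rule Psi_ratio_bounds(1)[OF nonzero \<chi>_gt[OF R1(1)] j0(1) _ neq]) (use n2 in auto)
    assume mu: "mu \<in> S" and s: "sigma \<in> \<Omega>"
    let ?y = "\<chi> R \<circ> inv sigma"
    have y: "1 < ?y j" if "j < n" for j
      using \<chi>_gt[OF R1(1)] permutes_in_image[OF \<Omega>_perm(1)[OF s], of j] that by simp
    have sj: "sigma j < n" if "j < n" for j using permutes_in_image[OF \<Omega>_perm(2)[OF s], of j] that by simp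
    have yn: "?y (sigma j0) \<noteq> ?y (sigma (n - 1))"
      using neq permutes_inverses[OF \<Omega>_perm(2)[OF s]] by simp
    have n1: "n - 1 < n" using n2 by simp
    have P: "Pi_poly lam Psi ?y = Pi_poly lam Psi (\<chi> R)" by (rule Pi_permutes[OF \<Omega>_perm(1)[OF s]])
    show "0 \<le> Psi mu ?y / Pi_poly lam Psi (\<chi> R)"
      using Psi_ratio_bounds(2)[OF nonzero y sj[OF j0(1)] sj[OF n1] yn mu] unfolding P .
    show "Psi mu ?y / Pi_poly lam Psi (\<chi> R) \<le> 1"
      using Psi_ratio_bounds(3)[OF nonzero y sj[OF j0(1)] sj[OF n1] yn mu] unfolding P .
  qed

  define F where "F = (\<lambda>mu sigma R. Psi mu (\<chi> R \<circ> inv sigma) / Pi_poly lam Psi (\<chi> R))"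
  have ev_big: "eventually (\<lambda>R. R0 < R) at_top" by (rule eventually_gt_at_top)
  have "\<exists>L. (F mu sigma \<longlongrightarrow> L) at_top" if mu: "mu \<in> S" and s: "sigma \<in> \<Omega>" for mu sigma
  proof -
    \<comment> \<open>All coordinates are affine in \<open>R\<close>, so numerator and denominator
      are restrictions to a line and the ratio is a rational function of \<open>R\<close>.\<close>
    define b where "b = (\<lambda>j. if rho j = 1 \<and> p j > 0 then 1 / p j else 0)"
    define c where "c = (\<lambda>j. if rho j = 1 \<and> p j > 0 then 0 else 1 :: real)"
    have line: "\<chi> R = (\<lambda>j. b j + R * c j)" for R
      by (auto simp: \<chi>_def chi_def b_def c_def fun_eq_iff)
    obtain P where P: "\<And>R. poly P R = ev (psi mu) (\<lambda>i. (b \<circ> inv sigma) i + R * (c \<circ> inv sigma) i)"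
      using polyfun_on_line[OF ev, of "psi mu" "b \<circ> inv sigma" "c \<circ> inv sigma"] by blast
    obtain Q where Q: "\<And>R. poly Q R = ev Pim (\<lambda>i. b i + R * c i)"
      using polyfun_on_line[OF ev, of Pim b c] by blast
    have F: "F mu sigma = (\<lambda>R. poly P R / poly Q R)"
      unfolding F_def P Q line ev_Pim ev_psi[OF mu] by (simp add: comp_def)
    have "poly Q (R0 + 1) \<noteq> 0" using big(1)[of "R0 + 1"] unfolding Q ev_Pim line[symmetric] by simp
    hence "Q \<noteq> 0" by auto
    moreover have "eventually (\<lambda>R. 0 \<le> poly P R / poly Q R \<and> poly P R / poly Q R \<le> 1) at_top"
      using ev_big
    proof eventually_elim
      case (elim R)
      show ?case using big(2,3)[OF elim mu s] fun_cong[OF F, of R] unfolding F_def by simp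
    qed
    ultimately show ?thesis unfolding F by (rule bounded_rational_tendsto)
  qed
  then obtain L where L: "\<And>mu sigma. mu \<in> S \<Longrightarrow> sigma \<in> \<Omega> \<Longrightarrow> (F mu sigma \<longlongrightarrow> L mu sigma) at_top"
    by metis
  have L_nonneg: "0 \<le> L mu sigma" if "mu \<in> S" "sigma \<in> \<Omega>" for mu sigma
  proof (rule tendsto_lowerbound[OF L[OF that]])
    show "eventually (\<lambda>R. 0 \<le> F mu sigma R) at_top"
      using ev_big by eventually_elim (use big(2) that in \<open>simp add: F_def\<close>)
  qed simp
  have L_sum: "(\<Sum>mu\<in>S. L mu sigma) = 1" if s: "sigma \<in> \<Omega>" for sigma
  proof (rule tendsto_unique[OF trivial_limit_at_top_linorder])
    show "((\<lambda>R. \<Sum>mu\<in>S. F mu sigma R) \<longlongrightarrow> (\<Sum>mu\<in>S. L mu sigma)) at_top"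
      by (rule tendsto_sum) (rule L[OF _ s])
    have "eventually (\<lambda>R. (\<Sum>mu\<in>S. F mu sigma R) = 1) at_top"
      using ev_big
    proof eventually_elim
      case (elim R)
      have "(\<Sum>mu\<in>S. F mu sigma R) = Pi_poly lam Psi (\<chi> R \<circ> inv sigma) / Pi_poly lam Psi (\<chi> R)"
        unfolding F_def Pi_poly_def by (simp add: sum_divide_distrib)
      thus ?case using Pi_permutes[OF \<Omega>_perm(1)[OF s]] big(1)[OF elim] by simp
    qed
    thus "((\<lambda>R. \<Sum>mu\<in>S. F mu sigma R) \<longlongrightarrow> 1) at_top" by (rule tendsto_eventually)
  qed

  text \<open>Across an ascent of the stones, the stone of density 2 carries the variable \<open>R\<close>,
    so the coefficients of the exchange relation tend to the transition probabilities.\<close>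
  have L_exchange:
    "mu ! i < mu ! nxt n i \<Longrightarrow>
       L mu (swp n i \<circ> sigma) = L mu sigma + p (inv sigma i) * a (mu ! nxt n i) * L (swap_list n i mu) sigma"
    "mu ! nxt n i < mu ! i \<Longrightarrow> L mu (swp n i \<circ> sigma) = (1 - p (inv sigma i) * a (mu ! i)) * L mu sigma"
    "mu ! i = mu ! nxt n i \<Longrightarrow> L mu (swp n i \<circ> sigma) = L mu sigma"
    if mu: "mu \<in> S" and s: "sigma \<in> \<Omega>" "swp n i \<circ> sigma \<in> \<Omega>" and i: "i < n"
      and asc: "rho (inv sigma i) < rho (inv sigma (nxt n i))" for mu sigma i
  proof -
    define j where "j = inv sigma i"
    define j' where "j' = inv sigma (nxt n i)"
    have jn: "j < n" "j' < n"
      using permutes_in_image[OF \<Omega>_perm(1)[OF s(1)]] i nxt_less[OF i] by (auto simp: j_def j'_def)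
    have "rho j < rho j'" using asc unfolding j_def j'_def .
    moreover have "rho j = 1 \<or> rho j = 2" "rho j' = 1 \<or> rho j' = 2" using assms(4) jn by blast+
    ultimately have rho: "rho j = 1" "rho j' = 2" by auto
    have pj: "0 \<le> p j" using assms(8) jn rho by blast
    let ?u = "\<lambda>R. if 0 < p j then 1 / p j else R"
    have vals: "(\<chi> R \<circ> inv sigma) i = ?u R" "(\<chi> R \<circ> inv sigma) (nxt n i) = R" for R
      using rho by (auto simp: \<chi>_def chi_def j_def[symmetric] j'_def[symmetric])
    have F': "F mu (swp n i \<circ> sigma) R = Psi mu (\<chi> R \<circ> inv sigma \<circ> swp n i) / Pi_poly lam Psi (\<chi> R)" for R
      unfolding F_def inv_swp_comp[OF \<Omega>_perm(2)[OF s(1)] i] by (simp only: comp_assoc)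
    let ?q = "\<lambda>b R. b * (R - ?u R) / (?u R * (R - b))"
    have q: "(?q b \<longlongrightarrow> p j * b) at_top" for b using exchange_coefficient_tendsto[OF pj] .
    have sw: "swap_list n i mu \<in> S" using rearr_swap[OF mu len i] .
    have den: "0 < ?u R * (R - a l)" if "R0 < R" for R l
    proof -
      have "1 < R" using that by (simp add: R0_def)
      moreover have "a l < 1" using assms(3) by blast
      ultimately show ?thesis by (auto intro!: mult_pos_pos)
    qed
    have uni: "L mu (swp n i \<circ> sigma) = l" if "(G \<longlongrightarrow> l) at_top" "\<And>R. R0 < R \<Longrightarrow> F mu (swp n i \<circ> sigma) R = G R" for G l
    proof (rule tendsto_unique[OF trivial_limit_at_top_linorder L[OF mu s(2)]])
      have "eventually (\<lambda>R. G R = F mu (swp n i \<circ> sigma) R) at_top"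
        using ev_big by eventually_elim (use that(2) in simp)
      with that(1) show "(F mu (swp n i \<circ> sigma) \<longlongrightarrow> l) at_top" by (rule Lim_transform_eventually)
    qed
    show "L mu (swp n i \<circ> sigma) = L mu sigma + p (inv sigma i) * a (mu ! nxt n i) * L (swap_list n i mu) sigma"
      if "mu ! i < mu ! nxt n i"
    proof (rule uni)
      let ?b = "a (mu ! nxt n i)"
      show "((\<lambda>R. F mu sigma R + ?q ?b R * F (swap_list n i mu) sigma R) \<longlongrightarrow>
          L mu sigma + p (inv sigma i) * ?b * L (swap_list n i mu) sigma) at_top"
        unfolding j_def[symmetric] by (intro tendsto_add tendsto_mult q L mu sw s)
      fix R assume R: "R0 < R"
      have "Psi mu (\<chi> R \<circ> inv sigma \<circ> swp n i) =
          Psi mu (\<chi> R \<circ> inv sigma) + ?q ?b R * Psi (swap_list n i mu) (\<chi> R \<circ> inv sigma)"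
        by (rule solve_ascent_relation[OF exchange_ascent[OF mu i that, of "\<chi> R \<circ> inv sigma", unfolded vals] den[OF R]])
      thus "F mu (swp n i \<circ> sigma) R = F mu sigma R + ?q ?b R * F (swap_list n i mu) sigma R"
        unfolding F' unfolding F_def by (simp add: add_divide_distrib)
    qed
    show "L mu (swp n i \<circ> sigma) = (1 - p (inv sigma i) * a (mu ! i)) * L mu sigma" if "mu ! nxt n i < mu ! i"
    proof (rule uni)
      let ?b = "a (mu ! i)"
      show "((\<lambda>R. (1 - ?q ?b R) * F mu sigma R) \<longlongrightarrow> (1 - p (inv sigma i) * ?b) * L mu sigma) at_top"
        unfolding j_def[symmetric] by (intro tendsto_diff tendsto_mult tendsto_const q L mu s)
      fix R assume R: "R0 < R"
      have "Psi mu (\<chi> R \<circ> inv sigma \<circ> swp n i) = (1 - ?q ?b R) * Psi mu (\<chi> R \<circ> inv sigma)"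
        by (rule solve_descent_relation[OF exchange_descent[OF mu i that, of "\<chi> R \<circ> inv sigma", unfolded vals] den[OF R]])
      thus "F mu (swp n i \<circ> sigma) R = (1 - ?q ?b R) * F mu sigma R"
        unfolding F' unfolding F_def by simp
    qed
    show "L mu (swp n i \<circ> sigma) = L mu sigma" if "mu ! i = mu ! nxt n i"
      by (rule uni[OF L[OF mu s(1)]]) (simp only: F', simp only: F_def exchange_equal[OF mu i that])
  qed

  define N where "N = real (card \<Omega>)"
  have N: "0 < N" using \<Omega>_fin by (simp add: N_def)
  define \<pi> where "\<pi> = (\<lambda>(mu, sigma). L mu sigma / N)"
  have stat: "\<pi> (nu, tau) = (\<Sum>s\<in>S \<times> \<Omega>. \<pi> s * itasep_trans n a rho p s (nu, tau))"
    if nu: "nu \<in> S" and tau: "tau \<in> \<Omega>" for nu tau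
  proof -
    \<comment> \<open>The contribution of edge \<open>i\<close> to the probability of jumping to
      \<open>(nu, tau)\<close>; the holding probability is accounted for separately.\<close>
    define h where "h = (\<lambda>i (mu, sigma). if rho (inv sigma i) < rho (inv sigma (nxt n i)) then
          (if mu ! nxt n i < mu ! i then
             (if (nu, tau) = (swap_list n i mu, swp n i \<circ> sigma)
                then p (inv sigma i) * a (mu ! i) / real n else 0) +
             (if (nu, tau) = (mu, swp n i \<circ> sigma)
                then (1 - p (inv sigma i) * a (mu ! i)) / real n else 0)
           else (if (nu, tau) = (mu, swp n i \<circ> sigma) then 1 / real n else 0))
        else 0)"
    let ?desc = "\<lambda>i. rho (inv tau (nxt n i)) < rho (inv tau i)"
    have step: "(\<Sum>s\<in>S \<times> \<Omega>. \<pi> s * h i s) = (if ?desc i then \<pi> (nu, tau) / real n else 0)" if i: "i < n" for i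
    proof -
      define tau' where "tau' = swp n i \<circ> tau"
      have tt: "swp n i \<circ> sigma = tau \<longleftrightarrow> sigma = tau'" for sigma
        unfolding tau'_def by (metis comp_assoc id_comp swp_comp_swp)
      have inv': "inv tau' i = inv tau (nxt n i)" "inv tau' (nxt n i) = inv tau i"
        unfolding tau'_def inv_swp_comp[OF \<Omega>_perm(2)[OF tau] i] by simp_all
      define g where "g = (\<lambda>mu. \<pi> (mu, tau') * h i (mu, tau'))"
      \<comment> \<open>Every arrival at \<open>tau\<close> across edge \<open>i\<close> comes from
        the single stone configuration \<open>tau'\<close>, which collapses the double sum.\<close>
      have z: "\<pi> (mu, sigma) * h i (mu, sigma) = (if sigma = tau' then g mu else 0)" for mu sigma
        unfolding g_def h_def using tt[of sigma] by auto
      have "(\<Sum>s\<in>S \<times> \<Omega>. \<pi> s * h i s) = (\<Sum>mu\<in>S. \<Sum>sigma\<in>\<Omega>. \<pi> (mu, sigma) * h i (mu, sigma))"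
        by (simp add: sum.cartesian_product split_def)
      also have "\<dots> = (\<Sum>mu\<in>S. if tau' \<in> \<Omega> then g mu else 0)"
        unfolding z using \<Omega>_fin by simp
      finally have eq: "(\<Sum>s\<in>S \<times> \<Omega>. \<pi> s * h i s) = (\<Sum>mu\<in>S. if tau' \<in> \<Omega> then g mu else 0)" .
      show ?thesis
      proof (cases "?desc i")
        case False
        hence "g mu = 0" for mu unfolding g_def h_def using inv' by simp
        hence "(\<Sum>mu\<in>S. if tau' \<in> \<Omega> then g mu else 0) = 0" by (intro sum.neutral) simp
        thus ?thesis using False eq by simp
      next
        case True
        hence tau': "tau' \<in> \<Omega>"
          using stone_Omega_swp[of tau n rho i] tau i n2 unfolding \<Omega>_def tau'_def by auto
        have st: "swp n i \<circ> tau' = tau" using tt by blast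
        have asc: "rho (inv tau' i) < rho (inv tau' (nxt n i))" using True inv' by simp
        define q where "q = p (inv tau' i)"
        define nu' where "nu' = swap_list n i nu"
        have nu': "nu' \<in> S" unfolding nu'_def by (rule rearr_swap[OF nu len i])
        have ss: "nu = swap_list n i mu \<longleftrightarrow> mu = nu'" if "mu \<in> S" for mu
          unfolding nu'_def using swap_list_swap_list[OF i] rearr_length[OF that] rearr_length[OF nu] len by metis
        have vals: "nu' ! i = nu ! nxt n i" "nu' ! nxt n i = nu ! i"
          unfolding nu'_def using i nxt_less[OF i] by (simp_all add: swap_list_nth)
        \<comment> \<open>\<open>A\<close> collects arrivals in which the particles are exchanged
          along with the stones, \<open>B\<close> those in which only the stones move.\<close>
        define A where "A = (\<lambda>mu. if mu ! nxt n i < mu ! i then \<pi> (mu, tau') * (q * a (mu ! i) / real n) else 0)"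
        define B where "B = (\<lambda>mu. if mu ! nxt n i < mu ! i then \<pi> (mu, tau') * ((1 - q * a (mu ! i)) / real n)
           else \<pi> (mu, tau') / real n)"
        have "(\<Sum>mu\<in>S. g mu) = (\<Sum>mu\<in>S. (if mu = nu' then A mu else 0) + (if mu = nu then B mu else 0))"
        proof (rule sum.cong)
          fix mu assume mu: "mu \<in> S"
          show "g mu = (if mu = nu' then A mu else 0) + (if mu = nu then B mu else 0)"
            unfolding g_def h_def A_def B_def using asc st ss[OF mu] by (auto simp: q_def algebra_simps)
        qed simp
        also have "\<dots> = A nu' + B nu" using nu nu' finite_rearr[of lam] by (simp add: sum.distrib)
        also have "\<dots> = \<pi> (nu, tau) / real n"
        proof -
          \<comment> \<open>The inflow across the edge is the right-hand side of the limiting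
            exchange relation at \<open>tau'\<close>, whose left-hand side is the weight of
            \<open>(nu, tau)\<close>.\<close>
          note ex = L_exchange[OF nu tau' _ i asc, unfolded st, OF tau]
          consider "nu ! i < nu ! nxt n i" | "nu ! nxt n i < nu ! i" | "nu ! i = nu ! nxt n i" by linarith
          thus ?thesis
          proof cases
            case 1
            show ?thesis using ex(1)[OF 1] 1 vals
              by (simp add: A_def B_def \<pi>_def q_def nu'_def[symmetric] add_divide_distrib mult_ac)
          next
            case 2
            show ?thesis using ex(2)[OF 2] 2 vals by (simp add: A_def B_def \<pi>_def q_def mult_ac)
          next
            case 3
            show ?thesis using ex(3)[OF 3] 3 vals by (simp add: A_def B_def \<pi>_def)
          qed
        qed
        finally show ?thesis using eq tau' True by simp
      qed
    qed
    have tr: "itasep_trans n a rho p s (nu, tau) =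
        (if s = (nu, tau) then 1 - real (Kfun n rho tau) / real n else 0) + (\<Sum>i<n. h i s)" for s
      unfolding itasep_trans_def h_def by (auto split: prod.splits)
    have inn: "inv tau i < n" if "i < n" for i
      using permutes_in_image[OF \<Omega>_perm(1)[OF tau], of i] that by simp
    \<comment> \<open>Departures from \<open>tau\<close> are counted by ascents and arrivals by
      descents, each with weight \<open>\<pi> (nu, tau) / n\<close>; their equality on the ring is
      the global balance.\<close>
    have K: "Kfun n rho tau = card {i. i < n \<and> ?desc i}"
      unfolding Kfun_def by (rule ascents_eq_descents[of n "\<lambda>i. rho (inv tau i)"]) (use assms(4) inn in blast)
    have "(\<Sum>s\<in>S \<times> \<Omega>. \<pi> s * itasep_trans n a rho p s (nu, tau)) =
        (\<Sum>s\<in>S \<times> \<Omega>. if s = (nu, tau) then \<pi> s * (1 - real (Kfun n rho tau) / real n) else 0)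
        + (\<Sum>s\<in>S \<times> \<Omega>. \<Sum>i<n. \<pi> s * h i s)"
      unfolding sum.distrib[symmetric] tr by (intro sum.cong) (auto simp: distrib_left sum_distrib_left)
    also have "(\<Sum>s\<in>S \<times> \<Omega>. if s = (nu, tau) then \<pi> s * (1 - real (Kfun n rho tau) / real n) else 0)
        = \<pi> (nu, tau) * (1 - real (Kfun n rho tau) / real n)"
      using nu tau \<Omega>_fin(1) finite_rearr[of lam] by simp
    also have "(\<Sum>s\<in>S \<times> \<Omega>. \<Sum>i<n. \<pi> s * h i s) = (\<Sum>i<n. \<Sum>s\<in>S \<times> \<Omega>. \<pi> s * h i s)"
      by (rule sum.swap)
    also have "\<dots> = (\<Sum>i<n. if ?desc i then \<pi> (nu, tau) / real n else 0)"
      using step by (intro sum.cong) auto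
    also have "\<dots> = real (Kfun n rho tau) * (\<pi> (nu, tau) / real n)"
    proof -
      have "{i. i < n \<and> ?desc i} = {..<n} \<inter> {i. ?desc i}" by auto
      thus ?thesis unfolding K by (simp add: sum.If_cases)
    qed
    finally show ?thesis by (simp add: algebra_simps)
  qed
  show ?thesis
  proof (intro exI[of _ \<pi>] conjI)
    have "(\<Sum>s\<in>S \<times> \<Omega>. \<pi> s) = (\<Sum>sigma\<in>\<Omega>. \<Sum>mu\<in>S. L mu sigma / N)"
      unfolding \<pi>_def by (subst sum.swap) (simp add: sum.cartesian_product)
    also have "\<dots> = (\<Sum>sigma\<in>\<Omega>. 1 / N)"
      by (intro sum.cong) (simp_all add: sum_divide_distrib[symmetric] L_sum)
    also have "\<dots> = 1" using N by (simp add: N_def)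
    finally have "(\<Sum>s\<in>S \<times> \<Omega>. \<pi> s) = 1" .
    thus "is_stationary (rearr lam \<times> stone_Omega n rho) (itasep_trans n a rho p) \<pi>"
      unfolding is_stationary_def \<Omega>_def[symmetric]
    proof (intro conjI ballI)
      show "0 \<le> \<pi> s" if "s \<in> S \<times> \<Omega>" for s using that L_nonneg N by (auto simp: \<pi>_def)
      show "\<pi> t = (\<Sum>s\<in>S \<times> \<Omega>. \<pi> s * itasep_trans n a rho p s t)" if "t \<in> S \<times> \<Omega>" for t
        using that stat by (cases t) blast
    qed
    show "\<forall>(mu, sigma) \<in> rearr lam \<times> stone_Omega n rho.
        ((\<lambda>R. Psi mu (chi rho p R \<circ> inv sigma) / Pi_poly lam Psi (chi rho p R))
           \<longlongrightarrow> real (card (stone_Omega n rho)) * \<pi> (mu, sigma)) at_top"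
      unfolding \<Omega>_def[symmetric] N_def[symmetric] \<chi>_def[symmetric]
      using L N by (auto simp: \<pi>_def F_def)
  qed
qed

end
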